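(* Let $\Omega$ be a minimal free boundary surface in the closed unit ball $B^3\subset\mathbb R^3$, endowed with the induced Riemannian metric, and suppose that $\partial\Omega$ has more than two connected components. Then $\Omega$ is a harmonic domain, but $\Omega$ is not an isoparametric tube.
   Context: Convention: $\Delta=-\operatorname{div}\nabla$ is the (non-negative) Laplace-Beltrami operator; $\nu$ is the inward unit normal to the boundary of a manifold. Minimal free boundary hypersurface. A compact, connected (immersed) minimal hypersurface $\Omega$ of the unit ball $B^n\subset\mathbb R^n$ with smooth boundary such that $\partial\Omega\subseteq\partial B^n$ and $\Omega$ meets $\partial B^n$ orthogonally (along $\partial\Omega$). For $n=3$ it is called a minimal free boundary surface. Harmonic domain. A compact Riemannian manifold $\Omega$ with smooth boundary for which the solution $v$ of $\Delta v=1$ on $\Omega$, $v=0$ on $\partial\Omega$, has $\frac{\partial v}{\partial\nu}$ equal to a constant on $\partial\Omega$. Smooth tube. A compact connected Riemannian manifold $\Omega$ of dimension $m$ with smooth boundary is a smooth tube around $P$ if $P$ is a smooth closed (compact, without boundary) embedded submanifold of $\Omega$, of dimension $k\in\{0,\dots,m-1\}$, and there is $R>0$ such that (a) $\Omega$ is the set of points at distance at most $R$ from $P$; (b) for each $s\in(0,R]$ the equidistant $\Sigma_s=\{x\in\Omega: d(x,P)=s\}$ is a smooth hypersurface of $\Omega$. This is understood in the sense that the normal exponential map $(r,\xi)\mapsto \exp_x(r\nu(x))$, where $\xi=(x,\nu(x))$ ranges over the unit normal bundle $U(P)$ of $P$, is a diffeomorphism $(0,R]\times U(P)\to\Omega\setminus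 P$; in particular $\partial\Omega=\Sigma_R$ and $\rho=d(\cdot,P)$ is smooth on $\Omega\setminus P$. Isoparametric tube. A smooth tube around some $P$ such that every equidistant $\Sigma_s$, $s\in(0,R]$, has constant mean curvature (with respect to the unit normal $-\nabla\rho$). *)

theory Defs
  imports "HOL-Analysis.Analysis"
begin

section \<open>Smooth maps\<close>

text \<open>The class \<open>C^n\<close> and the class \<open>C^\<infinity>\<close> on an open set \<open>W\<close>.\<close>

primrec Ck_on :: "nat \<Rightarrow> 'a::real_normed_vector set \<Rightarrow> ('a \<Rightarrow> 'b::real_normed_vector) \<Rightarrow> bool" where
  "Ck_on 0 W f \<longleftrightarrow> continuous_on W f"
| "Ck_on (Suc n) W f \<longleftrightarrow> (\<forall>x\<in>W. f differentiable (at x)) \<and>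
     (\<forall>v. Ck_on n W (\<lambda>x. frechet_derivative f (at x) v))"

definition smooth_on :: "'a::real_normed_vector set \<Rightarrow> ('a \<Rightarrow> 'b::real_normed_vector) \<Rightarrow> bool" where
  "smooth_on W f \<longleftrightarrow> (\<forall>n. Ck_on n W f)"

text \<open>A chart \<open>(U, \<phi>)\<close> consists of its domain and its coordinate map.\<close>

type_synonym ('p, 'e) chart = "'p set \<times> ('p \<Rightarrow> 'e)"

abbreviation std_chart :: "('e, 'e) chart set" where
  "std_chart \<equiv> {(UNIV, \<lambda>x. x)}"

definition param :: "('p, 'e) chart \<Rightarrow> 'e \<Rightarrow> 'p" where
  "param c = inv_into (fst c) (snd c)"

text \<open>Smoothness of \<open>f : X \<rightarrow> Y\<close>, where \<open>X\<close> and \<open>Y\<close> are subsets of spaces with charts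
  \<open>C\<close> and \<open>D\<close>: every coordinate expression of \<open>f\<close> is, near each point, the restriction of a
  \<open>C^\<infinity>\<close> map defined on an open set. With local extensions the notion makes sense
  up to the boundary of a manifold and on submanifolds. Continuity is included: \<open>f\<close> maps
  a neighbourhood of \<open>x\<close> in \<open>X\<close> into the chart domain around \<open>f x\<close>.\<close>

definition smooth_map ::
  "('x, 'a::real_normed_vector) chart set \<Rightarrow> ('y, 'b::real_normed_vector) chart set \<Rightarrow>
   'x set \<Rightarrow> 'y set \<Rightarrow> ('x \<Rightarrow> 'y) \<Rightarrow> bool" where
  "smooth_map C D X Y f \<longleftrightarrow> f ` X \<subseteq> Y \<and>
     (\<forall>x\<in>X. \<forall>c\<in>C. \<forall>d\<in>D. x \<in> fst c \<and> f x \<in> fst d \<longrightarrow>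
        (\<exists>W k. open W \<and> snd c x \<in> W \<and> smooth_on W k \<and>
           (\<forall>z \<in> X \<inter> fst c. snd c z \<in> W \<longrightarrow> f z \<in> fst d \<and> snd d (f z) = k (snd c z))))"

definition diffeo ::
  "('x, 'a::real_normed_vector) chart set \<Rightarrow> ('y, 'b::real_normed_vector) chart set \<Rightarrow>
   'x set \<Rightarrow> 'y set \<Rightarrow> ('x \<Rightarrow> 'y) \<Rightarrow> bool" where
  "diffeo C D X Y f \<longleftrightarrow> bij_betw f X Y \<and> smooth_map C D X Y f \<and>
     smooth_map D C Y X (inv_into X f)"


section \<open>Manifolds with boundary\<close>

text \<open>The dimension is \<open>CARD('m)\<close>; charts take values in the half-space
  on which a fixed coordinate is nonnegative. The manifold \<open>\<Omega>\<close> carries the subspace topology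
  of a Hausdorff type. Second countability is not demanded: below, manifolds are compact.\<close>

definition bd_index :: "'m::finite" where
  "bd_index = (SOME i. True)"

definition half_space :: "(real ^ 'm) set" where
  "half_space = {x. 0 \<le> x $ bd_index}"

definition smooth_manifold :: "'p::t2_space set \<Rightarrow> ('p, real ^ 'm) chart set \<Rightarrow> bool" where
  "smooth_manifold \<Omega> A \<longleftrightarrow>
     (\<Union>c\<in>A. fst c) = \<Omega> \<and>
     (\<forall>c\<in>A. openin (top_of_set \<Omega>) (fst c) \<and>
        openin (top_of_set half_space) (snd c ` fst c) \<and>
        homeomorphism (fst c) (snd c ` fst c) (snd c) (param c)) \<and>
     (\<forall>c\<in>A. \<forall>d\<in>A.
        smooth_map std_chart std_chart (snd c ` (fst c \<inter> fst d)) UNIV (snd d \<circ> param c))"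

definition mfd_boundary :: "'p set \<Rightarrow> ('p, real ^ 'm) chart set \<Rightarrow> 'p set" where
  "mfd_boundary \<Omega> A = {p\<in>\<Omega>. \<exists>c\<in>A. p \<in> fst c \<and> snd c p $ bd_index = 0}"

text \<open>\<open>chart_D c f p u\<close> is the derivative, at the point \<open>p\<close> and in the coordinate direction
  \<open>u\<close>, of \<open>f\<close> read in the chart \<open>c\<close> (one-sided at boundary points).\<close>

definition chart_D ::
  "('p, real ^ 'm) chart \<Rightarrow> ('p \<Rightarrow> 'b::real_normed_vector) \<Rightarrow> 'p \<Rightarrow> real ^ 'm \<Rightarrow> 'b" where
  "chart_D c f p u = frechet_derivative (f \<circ> param c) (at (snd c p) within snd c ` fst c) u"

text \<open>A tangent vector at \<open>p\<close> is the family of its components in the charts around \<open>p\<close>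
  (and, for uniqueness, \<open>0\<close> at all other charts), subject to the transformation law.\<close>

type_synonym ('p, 'm) tvec = "('p, real ^ 'm) chart \<Rightarrow> real ^ 'm"

definition tangent_space :: "('p, real ^ 'm) chart set \<Rightarrow> 'p \<Rightarrow> ('p, 'm) tvec set" where
  "tangent_space A p = {v.
     (\<forall>c. c \<notin> A \<or> p \<notin> fst c \<longrightarrow> v c = 0) \<and>
     (\<forall>c\<in>A. \<forall>d\<in>A. p \<in> fst c \<and> p \<in> fst d \<longrightarrow> v d = chart_D c (snd d) p (v c))}"

definition velocity ::
  "('p, real ^ 'm) chart set \<Rightarrow> real set \<Rightarrow> (real \<Rightarrow> 'p) \<Rightarrow> real \<Rightarrow> ('p, 'm) tvec" where
  "velocity A I \<gamma> t = (\<lambda>c. if c \<in> A \<and> \<gamma> t \<in> fst c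
     then vector_derivative (snd c \<circ> \<gamma>) (at t within I) else 0)"

text \<open>Embedded submanifolds of dimension \<open>k\<close> without boundary: near each point, a
  diffeomorphism between open sets of the coordinate space straightens \<open>S\<close> to a linear
  subspace. The straightening is defined on an open subset of the whole coordinate space, so
  this also applies to subsets of the boundary of \<open>\<Omega>\<close>.\<close>

definition submanifold ::
  "'p set \<Rightarrow> ('p, real ^ 'm) chart set \<Rightarrow> nat \<Rightarrow> 'p set \<Rightarrow> bool" where
  "submanifold \<Omega> A k S \<longleftrightarrow> S \<subseteq> \<Omega> \<and>
     (\<forall>p\<in>S. \<exists>c\<in>A. p \<in> fst c \<and>
        (\<exists>(W :: (real ^ 'm) set) (\<Psi> :: real ^ 'm \<Rightarrow> real ^ 'm) V. open W \<and> snd c p \<in> W \<and> open (\<Psi> ` W) \<and>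
           diffeo std_chart std_chart W (\<Psi> ` W) \<Psi> \<and>
           subspace V \<and> dim V = k \<and>
           \<Psi> ` (W \<inter> snd c ` (S \<inter> fst c)) = \<Psi> ` W \<inter> V))"

definition sub_tangent :: "('p, real ^ 'm) chart set \<Rightarrow> 'p set \<Rightarrow> 'p \<Rightarrow> ('p, 'm) tvec set" where
  "sub_tangent A S p = {velocity A {-1<..<1} \<gamma> 0 | \<gamma>.
     smooth_map std_chart A {-1<..<1} S \<gamma> \<and> \<gamma> 0 = p}"


section \<open>Riemannian geometry\<close>

text \<open>A Riemannian metric is given by its Gram matrices \<open>g c p\<close> in the charts \<open>c\<close> around \<open>p\<close>.\<close>

type_synonym ('p, 'm) metric = "('p, real ^ 'm) chart \<Rightarrow> 'p \<Rightarrow> real ^ 'm ^ 'm"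

definition riemannian_manifold ::
  "'p::t2_space set \<Rightarrow> ('p, real ^ 'm) chart set \<Rightarrow> ('p, 'm) metric \<Rightarrow> bool" where
  "riemannian_manifold \<Omega> A g \<longleftrightarrow> smooth_manifold \<Omega> A \<and>
     (\<forall>c\<in>A. smooth_map A std_chart (fst c) UNIV (g c)) \<and>
     (\<forall>c\<in>A. \<forall>p\<in>fst c. transpose (g c p) = g c p \<and> (\<forall>u. u \<noteq> 0 \<longrightarrow> 0 < u \<bullet> (g c p *v u))) \<and>
     (\<forall>c\<in>A. \<forall>d\<in>A. \<forall>p\<in>fst c \<inter> fst d. \<forall>u v.
        u \<bullet> (g c p *v v) = chart_D c (snd d) p u \<bullet> (g d p *v chart_D c (snd d) p v))"

definition chart_at :: "('p, real ^ 'm) chart set \<Rightarrow> 'p \<Rightarrow> ('p, real ^ 'm) chart" where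
  "chart_at A p = (SOME c. c \<in> A \<and> p \<in> fst c)"

definition rinner ::
  "('p, real ^ 'm) chart set \<Rightarrow> ('p, 'm) metric \<Rightarrow> 'p \<Rightarrow> ('p, 'm) tvec \<Rightarrow> ('p, 'm) tvec \<Rightarrow> real" where
  "rinner A g p v w = (let c = chart_at A p in v c \<bullet> (g c p *v w c))"

definition christoffel ::
  "('p, 'm) metric \<Rightarrow> ('p, real ^ 'm) chart \<Rightarrow> 'p \<Rightarrow> 'm \<Rightarrow> 'm \<Rightarrow> 'm \<Rightarrow> real" where
  "christoffel g c p k i j = 1 / 2 * (\<Sum>l\<in>UNIV. matrix_inv (g c p) $ k $ l *
     (chart_D c (\<lambda>q. g c q $ j $ l) p (axis i 1) + chart_D c (\<lambda>q. g c q $ i $ l) p (axis j 1)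
      - chart_D c (\<lambda>q. g c q $ i $ j) p (axis l 1)))"

text \<open>\<open>cov_deriv g X e p\<close> is the Levi-Civita derivative \<open>\<nabla>\<^sub>e X\<close> at \<open>p\<close> of the vector field \<open>X\<close>.\<close>

definition cov_deriv ::
  "('p, 'm::finite) metric \<Rightarrow> ('p \<Rightarrow> ('p, 'm) tvec) \<Rightarrow> ('p, 'm) tvec \<Rightarrow> 'p \<Rightarrow> ('p, 'm) tvec" where
  "cov_deriv g X e p = (\<lambda>c. chart_D c (\<lambda>q. X q c) p (e c) +
     (\<chi> k. \<Sum>i\<in>UNIV. \<Sum>j\<in>UNIV. christoffel g c p k i j * e c $ i * X p c $ j))"

definition gradient :: "('p, 'm::finite) metric \<Rightarrow> ('p \<Rightarrow> real) \<Rightarrow> 'p \<Rightarrow> ('p, 'm) tvec" where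
  "gradient g f p = (\<lambda>c. matrix_inv (g c p) *v (\<chi> j. chart_D c f p (axis j 1)))"

text \<open>The divergence is the trace of \<open>e \<mapsto> \<nabla>\<^sub>e X\<close>, computed in the chart \<open>c\<close>.\<close>

definition divergence ::
  "('p, 'm) metric \<Rightarrow> ('p \<Rightarrow> ('p, 'm) tvec) \<Rightarrow> ('p, real ^ 'm) chart \<Rightarrow> 'p \<Rightarrow> real" where
  "divergence g X c p = (\<Sum>i\<in>UNIV. cov_deriv g X (\<lambda>_. axis i 1) p c $ i)"

definition laplacian ::
  "('p, 'm) metric \<Rightarrow> ('p \<Rightarrow> real) \<Rightarrow> ('p, real ^ 'm) chart \<Rightarrow> 'p \<Rightarrow> real" where
  "laplacian g f c p = - divergence g (gradient g f) c p"

definition inward_unit_normal ::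
  "'p set \<Rightarrow> ('p, real ^ 'm) chart set \<Rightarrow> ('p, 'm) metric \<Rightarrow> 'p \<Rightarrow> ('p, 'm) tvec \<Rightarrow> bool" where
  "inward_unit_normal \<Omega> A g p \<nu> \<longleftrightarrow> \<nu> \<in> tangent_space A p \<and> rinner A g p \<nu> \<nu> = 1 \<and>
     (\<forall>w\<in>sub_tangent A (mfd_boundary \<Omega> A) p. rinner A g p \<nu> w = 0) \<and>
     (\<forall>c\<in>A. p \<in> fst c \<longrightarrow> 0 < \<nu> c $ bd_index)"


section \<open>Harmonic domains\<close>

definition harmonic_domain ::
  "'p::t2_space set \<Rightarrow> ('p, real ^ 'm) chart set \<Rightarrow> ('p, 'm) metric \<Rightarrow> bool" where
  "harmonic_domain \<Omega> A g \<longleftrightarrow> compact \<Omega> \<and> riemannian_manifold \<Omega> A g \<and>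
     (\<exists>v :: 'p \<Rightarrow> real. smooth_map A std_chart \<Omega> UNIV v \<and>
        (\<forall>c\<in>A. \<forall>p\<in>fst c. laplacian g v c p = 1) \<and>
        (\<forall>p\<in>mfd_boundary \<Omega> A. v p = 0) \<and>
        (\<exists>a. \<forall>p\<in>mfd_boundary \<Omega> A. \<forall>\<nu>. inward_unit_normal \<Omega> A g p \<nu> \<longrightarrow>
           (\<forall>c\<in>A. p \<in> fst c \<longrightarrow> chart_D c v p (\<nu> c) = a)))"


section \<open>Isoparametric tubes\<close>

text \<open>Riemannian distance: infimum of the lengths of piecewise smooth curves. Each piece
  is smooth up to its end points.\<close>

definition piecewise_smooth_curve ::
  "'p set \<Rightarrow> ('p, real ^ 'm) chart set \<Rightarrow> (real \<Rightarrow> 'p) \<Rightarrow> bool" where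
  "piecewise_smooth_curve \<Omega> A \<gamma> \<longleftrightarrow> (\<exists>T. finite T \<and>
     (\<forall>a b. 0 \<le> a \<and> a < b \<and> b \<le> 1 \<and> {a<..<b} \<inter> T = {} \<longrightarrow> smooth_map std_chart A {a..b} \<Omega> \<gamma>))"

definition curve_length ::
  "('p, real ^ 'm) chart set \<Rightarrow> ('p, 'm) metric \<Rightarrow> (real \<Rightarrow> 'p) \<Rightarrow> real" where
  "curve_length A g \<gamma> = integral {0..1} (\<lambda>t.
     sqrt (rinner A g (\<gamma> t) (velocity A {0..1} \<gamma> t) (velocity A {0..1} \<gamma> t)))"

definition riem_dist ::
  "'p set \<Rightarrow> ('p, real ^ 'm) chart set \<Rightarrow> ('p, 'm) metric \<Rightarrow> 'p \<Rightarrow> 'p \<Rightarrow> real" where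
  "riem_dist \<Omega> A g x y =
     Inf {curve_length A g \<gamma> | \<gamma>. piecewise_smooth_curve \<Omega> A \<gamma> \<and> \<gamma> 0 = x \<and> \<gamma> 1 = y}"

definition dist_to ::
  "'p set \<Rightarrow> ('p, real ^ 'm) chart set \<Rightarrow> ('p, 'm) metric \<Rightarrow> 'p set \<Rightarrow> 'p \<Rightarrow> real" where
  "dist_to \<Omega> A g P x = (INF y\<in>P. riem_dist \<Omega> A g x y)"

definition equidistant ::
  "'p set \<Rightarrow> ('p, real ^ 'm) chart set \<Rightarrow> ('p, 'm) metric \<Rightarrow> 'p set \<Rightarrow> real \<Rightarrow> 'p set" where
  "equidistant \<Omega> A g P s = {x\<in>\<Omega>. dist_to \<Omega> A g P x = s}"

definition geodesic ::
  "'p set \<Rightarrow> ('p, real ^ 'm) chart set \<Rightarrow> ('p, 'm) metric \<Rightarrow> (real \<Rightarrow> 'p) \<Rightarrow> bool" where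
  "geodesic \<Omega> A g \<gamma> \<longleftrightarrow> smooth_map std_chart A {0..1} \<Omega> \<gamma> \<and>
     (\<forall>t\<in>{0..1}. \<forall>c\<in>A. \<gamma> t \<in> fst c \<longrightarrow>
        (let x' = (\<lambda>s. vector_derivative (snd c \<circ> \<gamma>) (at s within {0..1})) in
           vector_derivative x' (at t within {0..1}) +
           (\<chi> k. \<Sum>i\<in>UNIV. \<Sum>j\<in>UNIV. christoffel g c (\<gamma> t) k i j * x' t $ i * x' t $ j) = 0))"

text \<open>\<open>is_exp \<Omega> A g p w y\<close>: the exponential \<open>exp\<^sub>p(w)\<close> is defined and equals \<open>y\<close>. On a
  manifold with boundary the exponential map is only partially defined.\<close>

definition is_exp ::
  "'p set \<Rightarrow> ('p, real ^ 'm) chart set \<Rightarrow> ('p, 'm) metric \<Rightarrow> 'p \<Rightarrow> ('p, 'm) tvec \<Rightarrow> 'p \<Rightarrow> bool" where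
  "is_exp \<Omega> A g p w y \<longleftrightarrow>
     (\<exists>\<gamma>. geodesic \<Omega> A g \<gamma> \<and> \<gamma> 0 = p \<and> velocity A {0..1} \<gamma> 0 = w \<and> \<gamma> 1 = y)"

definition unit_normal_bundle ::
  "('p, real ^ 'm) chart set \<Rightarrow> ('p, 'm) metric \<Rightarrow> 'p set \<Rightarrow> ('p \<times> ('p, 'm) tvec) set" where
  "unit_normal_bundle A g P = {(p, \<nu>). p \<in> P \<and> \<nu> \<in> tangent_space A p \<and>
     rinner A g p \<nu> \<nu> = 1 \<and> (\<forall>w\<in>sub_tangent A P p. rinner A g p \<nu> w = 0)}"

text \<open>The charts that an atlas \<open>A\<close> induces on the product of the real line with the tangent
  bundle; \<open>(0,R] \<times> U(P)\<close> is a submanifold of this product.\<close>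

definition bundle_charts ::
  "('p, real ^ 'm) chart set \<Rightarrow>
   (real \<times> 'p \<times> ('p, 'm) tvec, real \<times> (real ^ 'm) \<times> (real ^ 'm)) chart set" where
  "bundle_charts A = (\<lambda>c. ({(r, p, v). p \<in> fst c}, \<lambda>(r, p, v). (r, snd c p, v c))) ` A"

definition smooth_tube ::
  "'p::t2_space set \<Rightarrow> ('p, real ^ 'm) chart set \<Rightarrow> ('p, 'm) metric \<Rightarrow> 'p set \<Rightarrow> real \<Rightarrow> bool" where
  "smooth_tube \<Omega> A g P R \<longleftrightarrow>
     compact \<Omega> \<and> connected \<Omega> \<and> riemannian_manifold \<Omega> A g \<and>
     P \<noteq> {} \<and> compact P \<and> (\<exists>k<CARD('m). submanifold \<Omega> A k P) \<and> 0 < R \<and>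
     \<Omega> = {x\<in>\<Omega>. dist_to \<Omega> A g P x \<le> R} \<and>
     (\<forall>s\<in>{0<..R}. submanifold \<Omega> A (CARD('m) - 1) (equidistant \<Omega> A g P s)) \<and>
     (\<exists>E. (\<forall>r\<in>{0<..R}. \<forall>(p, \<nu>)\<in>unit_normal_bundle A g P.
             is_exp \<Omega> A g p (\<lambda>c. r *\<^sub>R \<nu> c) (E (r, p, \<nu>))) \<and>
          diffeo (bundle_charts A) A ({0<..R} \<times> unit_normal_bundle A g P) (\<Omega> - P) E)"

text \<open>Mean curvature \<open>h\<close> at \<open>p\<close> of the hypersurface \<open>S\<close> with respect to the unit normal field
  \<open>N\<close> (given on a neighbourhood): the normalized trace of the shape operator
  \<open>e \<mapsto> - \<nabla>\<^sub>e N\<close> of \<open>S\<close>, computed in an orthonormal basis \<open>B\<close> of its tangent space.\<close>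

definition hypersurface_mean_curvature ::
  "('p, real ^ 'm) chart set \<Rightarrow> ('p, 'm) metric \<Rightarrow> 'p set \<Rightarrow> ('p \<Rightarrow> ('p, 'm) tvec) \<Rightarrow>
   'p \<Rightarrow> real \<Rightarrow> bool" where
  "hypersurface_mean_curvature A g S N p h \<longleftrightarrow>
     (\<exists>B \<subseteq> sub_tangent A S p. finite B \<and> card B = CARD('m) - 1 \<and>
        (\<forall>e\<in>B. \<forall>f\<in>B. rinner A g p e f = (if e = f then 1 else 0)) \<and>
        h = 1 / real (CARD('m) - 1) * (\<Sum>e\<in>B. rinner A g p (\<lambda>c. - cov_deriv g N e p c) e))"

definition isoparametric_tube ::
  "'p::t2_space set \<Rightarrow> ('p, real ^ 'm) chart set \<Rightarrow> ('p, 'm) metric \<Rightarrow> bool" where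
  "isoparametric_tube \<Omega> A g \<longleftrightarrow> (\<exists>P R. smooth_tube \<Omega> A g P R \<and>
     (\<forall>s\<in>{0<..R}. \<exists>h. \<forall>p\<in>equidistant \<Omega> A g P s.
        hypersurface_mean_curvature A g (equidistant \<Omega> A g P s)
          (\<lambda>q c. - gradient g (dist_to \<Omega> A g P) q c) p h))"


section \<open>Minimal free boundary hypersurfaces of the unit ball\<close>

definition immersion ::
  "'p::t2_space set \<Rightarrow> ('p, real ^ 'm) chart set \<Rightarrow> ('p \<Rightarrow> real ^ 'n) \<Rightarrow> bool" where
  "immersion \<Omega> A F \<longleftrightarrow> smooth_map A std_chart \<Omega> UNIV F \<and>
     (\<forall>c\<in>A. \<forall>p\<in>fst c. inj (chart_D c F p))"

definition induced_metric :: "('p \<Rightarrow> real ^ 'n) \<Rightarrow> ('p, 'm::finite) metric" where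
  "induced_metric F c p = (\<chi> i j. chart_D c F p (axis i 1) \<bullet> chart_D c F p (axis j 1))"

definition unit_normal ::
  "('p \<Rightarrow> real ^ 'n) \<Rightarrow> ('p, real ^ 'm) chart \<Rightarrow> 'p \<Rightarrow> real ^ 'n \<Rightarrow> bool" where
  "unit_normal F c p n \<longleftrightarrow> norm n = 1 \<and> (\<forall>u. n \<bullet> chart_D c F p u = 0)"

text \<open>The second fundamental form of the immersion \<open>F\<close> with respect to the unit normal \<open>n\<close> at
  \<open>p\<close>, and the mean curvature: the normalized trace with respect to the induced metric.\<close>

definition second_fundamental_form ::
  "('p \<Rightarrow> real ^ 'n) \<Rightarrow> ('p, real ^ 'm) chart \<Rightarrow> 'p \<Rightarrow> real ^ 'n \<Rightarrow> real ^ 'm ^ 'm" where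
  "second_fundamental_form F c p n =
     (\<chi> i j. chart_D c (\<lambda>q. chart_D c F q (axis j 1)) p (axis i 1) \<bullet> n)"

definition immersion_mean_curvature ::
  "('p \<Rightarrow> real ^ 'n) \<Rightarrow> ('p, real ^ 'm) chart \<Rightarrow> 'p \<Rightarrow> real ^ 'n \<Rightarrow> real" where
  "immersion_mean_curvature F c p n = 1 / real CARD('m) *
     (\<Sum>i\<in>UNIV. \<Sum>j\<in>UNIV. matrix_inv (induced_metric F c p) $ i $ j *
        second_fundamental_form F c p n $ i $ j)"

text \<open>In the last clause, \<open>F p\<close> is a normal of the unit sphere at \<open>F p\<close>; two hypersurfaces meet
  orthogonally if their normals are orthogonal.\<close>

definition minimal_free_boundary_hypersurface ::
  "'p::t2_space set \<Rightarrow> ('p, real ^ 'm) chart set \<Rightarrow> ('p \<Rightarrow> real ^ 'n) \<Rightarrow> bool" where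
  "minimal_free_boundary_hypersurface \<Omega> A F \<longleftrightarrow>
     CARD('n) = CARD('m) + 1 \<and>
     compact \<Omega> \<and> connected \<Omega> \<and> smooth_manifold \<Omega> A \<and> immersion \<Omega> A F \<and>
     F ` \<Omega> \<subseteq> cball 0 1 \<and> F ` mfd_boundary \<Omega> A \<subseteq> sphere 0 1 \<and>
     (\<forall>c\<in>A. \<forall>p\<in>fst c. \<forall>n. unit_normal F c p n \<longrightarrow> immersion_mean_curvature F c p n = 0) \<and>
     (\<forall>p\<in>mfd_boundary \<Omega> A. \<forall>c\<in>A. p \<in> fst c \<longrightarrow> (\<forall>n. unit_normal F c p n \<longrightarrow> n \<bullet> F p = 0))"

end

theory Submission
  imports Defs
begin

text \<open>Harmonicity: by minimality the divergence of the tangential part of the position vector is the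
  dimension, so \<open>(1 - |F|\<^sup>2) / 4\<close> solves the Dirichlet problem; orthogonality at the boundary means
  that the inward normal is \<open>- F\<close> there, so the normal derivative of this function is \<open>1 / 2\<close>.

  No surface whose boundary has more than two components is a smooth tube around any \<open>P\<close>, whatever the
  metric; the mean curvature of the equidistants plays no role. Since geodesics start in every normal
  direction, \<open>P\<close> avoids the boundary, and the diffeomorphism with \<open>(0, R] \<times> U(P)\<close> exhibits \<open>\<Omega> - P\<close> as
  a half-open collar \<open>(0, R] \<times> \<partial>\<Omega>\<close>. Near each of its points \<open>P\<close> is a point or a two-sided curve, so at
  most two components of the collar can accumulate there, whereas connectedness of \<open>\<Omega>\<close> forces every one
  of them to accumulate at every point of \<open>P\<close>.\<close>

section \<open>Calculus of smooth maps\<close>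

text \<open>\<open>smooth_tube\<close> does not state that the boundary is the outermost
  equidistant, so the collar over the boundary needs two inclusions between
  \<open>mfd_boundary \<Omega> A\<close> and the set of outer ends \<open>E (R, p, \<nu>)\<close>.
  The delicate one excludes rays that meet the boundary before radius \<open>R\<close>: in a
  manifold with boundary a geodesic may a priori run inside the boundary. In dimension two the
  boundary is a curve whose tangent line is already spanned by a ray touching it, so a contact
  cannot be isolated and would spread along the ray towards \<open>P\<close>.

  \<open>P\<close> is not assumed connected, so the accumulation of every collar at all of
  \<open>P\<close> does not follow from one point. It comes from the end sets \<open>Q X\<close>,
  the points of \<open>P\<close> at which the collar over \<open>X\<close> accumulates.
  Two-sidedness makes them open in \<open>P\<close>, and they are connected because the end of a
  collar is. Hence two of them agree or are disjoint, and different end sets would split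
  \<Omega>.\<close>

lemma Ck_on_subset: "Ck_on n W f \<Longrightarrow> V \<subseteq> W \<Longrightarrow> Ck_on n V f"
  by (induction n arbitrary: f) (auto intro: continuous_on_subset)

text \<open>Openness of \<open>W\<close> lets the values on \<open>W\<close> determine the
  derivatives there; the induction then runs over the directional derivatives.\<close>

lemma Ck_on_cong:
  assumes "open W" "\<And>x. x \<in> W \<Longrightarrow> f x = g x" "Ck_on n W f"
  shows "Ck_on n W g"
  using assms(2,3)
proof (induction n arbitrary: f g)
  case 0
  then show ?case by (auto cong: continuous_on_cong_simp)
next
  case (Suc n)
  have fd: "f differentiable (at x)" if "x \<in> W" for x using Suc.prems that by auto
  have eq: "frechet_derivative f (at x) = frechet_derivative g (at x)" if "x \<in> W" for x
    using frechet_derivative_transform_within_open[OF fd assms(1)] that Suc.prems by auto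
  have "g differentiable (at x)" if "x \<in> W" for x
    using fd[OF that] that Suc.prems(1) assms(1)
    by (meson differentiable_def has_derivative_transform_within_open)
  moreover have "Ck_on n W (\<lambda>x. frechet_derivative g (at x) v)" for v
    by (rule Suc.IH[where f="\<lambda>x. frechet_derivative f (at x) v"]) (use Suc.prems eq in auto)
  ultimately show ?case by simp
qed

text \<open>The derivative may be given by any formula \<open>f'\<close>, which spares rewriting
  \<open>frechet_derivative\<close>, a choice operator.\<close>

lemma Ck_on_SucI:
  assumes "open W" "\<And>x. x \<in> W \<Longrightarrow> (f has_derivative f' x) (at x)"
    "\<And>v. Ck_on n W (\<lambda>x. f' x v)"
  shows "Ck_on (Suc n) W f"
proof -
  have "Ck_on n W (\<lambda>x. frechet_derivative f (at x) v)" for v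
    by (rule Ck_on_cong[OF assms(1) _ assms(3)[of v]])
       (use frechet_derivative_at[OF assms(2)] in metis)
  then show ?thesis using assms(2) by (auto simp: differentiable_def)
qed

lemma Ck_on_SucD:
  assumes "Ck_on (Suc n) W f"
  shows "Ck_on n W f"
  using assms
proof (induction n arbitrary: f)
  case 0
  then show ?case
    by (auto intro!: continuous_at_imp_continuous_on differentiable_imp_continuous_within)
next
  case (Suc n)
  then show ?case by (metis Ck_on.simps(2))
qed

lemma Ck_on_has_derivative:
  "Ck_on (Suc n) W f \<Longrightarrow> x \<in> W \<Longrightarrow> (f has_derivative frechet_derivative f (at x)) (at x)"
  by (simp flip: frechet_derivative_works)

lemma Ck_on_const: "Ck_on n W (\<lambda>x. c)"
  by (induction n arbitrary: c) auto

lemma Ck_on_bounded_linear: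
  assumes "bounded_linear L" "open W" "Ck_on n W f"
  shows "Ck_on n W (\<lambda>x. L (f x))"
  using assms(3)
proof (induction n arbitrary: f)
  case 0
  then show ?case using bounded_linear.continuous_on[OF assms(1)] by auto
next
  case (Suc n)
  show ?case
    by (rule Ck_on_SucI[OF assms(2) bounded_linear.has_derivative[OF assms(1) Ck_on_has_derivative[OF Suc.prems]]])
       (use Suc in auto)
qed

lemma Ck_on_add:
  assumes "open W" "Ck_on n W f" "Ck_on n W g"
  shows "Ck_on n W (\<lambda>x. f x + g x)"
  using assms(2,3)
proof (induction n arbitrary: f g)
  case 0
  then show ?case by (auto intro: continuous_intros)
next
  case (Suc n)
  show ?case
    by (rule Ck_on_SucI[OF assms(1) has_derivative_add[OF Ck_on_has_derivative[OF Suc.prems(1)]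
          Ck_on_has_derivative[OF Suc.prems(2)]]]) (use Suc in auto)
qed

lemma Ck_on_sum:
  assumes "open W" "\<And>i. i \<in> I \<Longrightarrow> Ck_on n W (f i)"
  shows "Ck_on n W (\<lambda>x. \<Sum>i\<in>I. f i x)"
  using assms(2)
  by (induction I rule: infinite_finite_induct) (auto intro: Ck_on_const Ck_on_add[OF assms(1)])

text \<open>By the product rule the derivative is a sum of two terms of the same bilinear shape,
  with factors of one order less.\<close>

lemma Ck_on_bilinear:
  assumes "bounded_bilinear B" "open W" "Ck_on n W f" "Ck_on n W g"
  shows "Ck_on n W (\<lambda>x. B (f x) (g x))"
  using assms(3,4)
proof (induction n arbitrary: f g)
  case 0
  then show ?case using bounded_bilinear.continuous_on[OF assms(1)] by auto
next
  case (Suc n)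
  have f: "Ck_on n W f" and g: "Ck_on n W g" using Suc.prems Ck_on_SucD by blast+
  have "Ck_on n W (\<lambda>x. frechet_derivative f (at x) v)" "Ck_on n W (\<lambda>x. frechet_derivative g (at x) v)" for v
    using Suc.prems by auto
  then show ?case
    by (intro Ck_on_SucI[OF assms(2) bounded_bilinear.FDERIV[OF assms(1) Ck_on_has_derivative[OF Suc.prems(1)]
          Ck_on_has_derivative[OF Suc.prems(2)]]] Ck_on_add[OF assms(2)] Suc.IH f g)
qed

text \<open>The chain rule differentiates \<open>g\<close> in the direction of the derivative of
  \<open>f\<close>, which moves with \<open>x\<close>, while \<open>Ck_on\<close> speaks of fixed
  directions only. Expanding that direction in the basis of the middle space, whence its sort,
  leaves products of functions of class C^n.\<close>

lemma Ck_on_compose: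
  fixes f :: "'a::real_normed_vector \<Rightarrow> 'b::euclidean_space" and g :: "'b \<Rightarrow> 'c::real_normed_vector"
  assumes "open W" "open V" "f ` W \<subseteq> V" "Ck_on n W f" "Ck_on n V g"
  shows "Ck_on n W (\<lambda>x. g (f x))"
  using assms(4,5)
proof (induction n arbitrary: g)
  case 0
  then show ?case using continuous_on_compose2[OF _ _ assms(3)] by simp
next
  case (Suc n)
  have f: "Ck_on n W f" using Suc.prems Ck_on_SucD by blast
  let ?Df = "\<lambda>x. frechet_derivative f (at x)" and ?Dg = "\<lambda>y. frechet_derivative g (at y)"
  have Df: "(f has_derivative ?Df x) (at x)" if "x \<in> W" for x
    using Ck_on_has_derivative[OF Suc.prems(1) that] .
  have Dg: "(g has_derivative ?Dg (f x)) (at (f x))" if "x \<in> W" for x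
    using Ck_on_has_derivative[OF Suc.prems(2)] that assms(3) by blast
  show ?case
  proof (rule Ck_on_SucI[OF assms(1)])
    show "((\<lambda>x. g (f x)) has_derivative (\<lambda>v. ?Dg (f x) (?Df x v))) (at x)" if "x \<in> W" for x
      using diff_chain_at[OF Df[OF that] Dg[OF that]] by (simp add: o_def)
    fix v
    have eq: "(\<Sum>b\<in>Basis. (?Df x v \<bullet> b) *\<^sub>R ?Dg (f x) b) = ?Dg (f x) (?Df x v)" if "x \<in> W" for x
    proof -
      have "linear (?Dg (f x))" using Dg[OF that] has_derivative_linear by blast
      then have "?Dg (f x) (\<Sum>b\<in>Basis. (?Df x v \<bullet> b) *\<^sub>R b) = (\<Sum>b\<in>Basis. (?Df x v \<bullet> b) *\<^sub>R ?Dg (f x) b)"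
        by (simp add: linear_sum linear_scale)
      then show ?thesis by (simp add: euclidean_representation)
    qed
    have "Ck_on n W (\<lambda>x. \<Sum>b\<in>Basis. (?Df x v \<bullet> b) *\<^sub>R ?Dg (f x) b)"
    proof (intro Ck_on_sum[OF assms(1)] Ck_on_bilinear[OF bounded_bilinear_scaleR assms(1)])
      show "Ck_on n W (\<lambda>x. ?Df x v \<bullet> b)" for b
        by (rule Ck_on_bounded_linear[OF bounded_linear_inner_left assms(1)]) (use Suc.prems in auto)
      show "Ck_on n W (\<lambda>x. ?Dg (f x) b)" for b
        by (rule Suc.IH[OF f]) (use Suc.prems in auto)
    qed
    from Ck_on_cong[OF assms(1) eq this]
    show "Ck_on n W (\<lambda>x. ?Dg (f x) (?Df x v))" .
  qed
qed

lemma smooth_on_subset: "smooth_on W f \<Longrightarrow> V \<subseteq> W \<Longrightarrow> smooth_on V f"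
  unfolding smooth_on_def using Ck_on_subset by blast

lemma smooth_on_const: "smooth_on W (\<lambda>x. c)"
  unfolding smooth_on_def using Ck_on_const by blast

lemma smooth_on_bounded_linear:
  "bounded_linear L \<Longrightarrow> open W \<Longrightarrow> smooth_on W f \<Longrightarrow> smooth_on W (\<lambda>x. L (f x))"
  unfolding smooth_on_def using Ck_on_bounded_linear by blast

lemma smooth_on_linear: "bounded_linear L \<Longrightarrow> smooth_on W L"
proof -
  assume L: "bounded_linear L"
  have "Ck_on n UNIV (\<lambda>x. x)" for n
  proof (cases n)
    case (Suc m)
    have "Ck_on (Suc m) UNIV (\<lambda>x. x)"
      by (rule Ck_on_SucI) (auto intro: has_derivative_ident Ck_on_const)
    with Suc show ?thesis by blast
  qed auto
  then have "smooth_on UNIV L"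
    using smooth_on_bounded_linear[OF L open_UNIV, of "\<lambda>x. x"] unfolding smooth_on_def by blast
  then show ?thesis by (rule smooth_on_subset) simp
qed

lemma smooth_on_ident: "smooth_on W (\<lambda>x. x)"
  by (rule smooth_on_linear[OF bounded_linear_ident])

lemma smooth_on_add:
  "open W \<Longrightarrow> smooth_on W f \<Longrightarrow> smooth_on W g \<Longrightarrow> smooth_on W (\<lambda>x. f x + g x)"
  unfolding smooth_on_def using Ck_on_add by blast

lemma smooth_on_sum:
  "open W \<Longrightarrow> (\<And>i. i \<in> I \<Longrightarrow> smooth_on W (f i)) \<Longrightarrow> smooth_on W (\<lambda>x. \<Sum>i\<in>I. f i x)"
  by (simp add: smooth_on_def Ck_on_sum)

lemma smooth_on_bilinear:
  "bounded_bilinear B \<Longrightarrow> open W \<Longrightarrow> smooth_on W f \<Longrightarrow> smooth_on W g \<Longrightarrow>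
   smooth_on W (\<lambda>x. B (f x) (g x))"
  unfolding smooth_on_def using Ck_on_bilinear by blast

lemma smooth_on_compose:
  fixes f :: "'a::real_normed_vector \<Rightarrow> 'b::euclidean_space" and g :: "'b \<Rightarrow> 'c::real_normed_vector"
  shows "open W \<Longrightarrow> open V \<Longrightarrow> f ` W \<subseteq> V \<Longrightarrow> smooth_on W f \<Longrightarrow> smooth_on V g \<Longrightarrow>
    smooth_on W (\<lambda>x. g (f x))"
  unfolding smooth_on_def using Ck_on_compose by blast

lemma smooth_on_frechet_derivative:
  "smooth_on W f \<Longrightarrow> smooth_on W (\<lambda>x. frechet_derivative f (at x) v)"
  unfolding smooth_on_def by (metis Ck_on.simps(2))

lemma smooth_on_has_derivative:
  "smooth_on W f \<Longrightarrow> x \<in> W \<Longrightarrow> (f has_derivative frechet_derivative f (at x)) (at x)"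
  unfolding smooth_on_def using Ck_on_has_derivative by blast

lemma smooth_on_continuous_on: "smooth_on W f \<Longrightarrow> continuous_on W f"
  unfolding smooth_on_def by (metis Ck_on.simps(1))

lemma frechet_derivative_linear:
  assumes "smooth_on W f" "x \<in> W"
  shows "linear (frechet_derivative f (at x))"
  using has_derivative_linear[OF smooth_on_has_derivative[OF assms]] .

section \<open>Symmetry of second derivatives\<close>

lemma second_difference_mvt:
  fixes f :: "'a::real_normed_vector \<Rightarrow> real"
  assumes f: "smooth_on (ball x e) f" and h: "0 < h" "h * (norm u + norm v) < e"
  shows "\<exists>y. norm (y - x) \<le> h * (norm u + norm v) \<and>
    f (x + h *\<^sub>R u + h *\<^sub>R v) - f (x + h *\<^sub>R u) - f (x + h *\<^sub>R v) + f x =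
      h * h * frechet_derivative (\<lambda>z. frechet_derivative f (at z) u) (at y) v"
proof -
  let ?D = "\<lambda>z. frechet_derivative f (at z)" and ?D2 = "\<lambda>z. frechet_derivative (\<lambda>z. frechet_derivative f (at z) u) (at z)"
  have nrm: "norm (s *\<^sub>R u + t *\<^sub>R v) \<le> h * (norm u + norm v)" if "0 \<le> s" "s \<le> h" "0 \<le> t" "t \<le> h" for s t
  proof -
    have "norm (s *\<^sub>R u + t *\<^sub>R v) \<le> s * norm u + t * norm v"
      using norm_triangle_ineq[of "s *\<^sub>R u" "t *\<^sub>R v"] that by simp
    also have "\<dots> \<le> h * norm u + h * norm v"
      using that by (intro add_mono mult_right_mono) auto
    finally show ?thesis by (simp add: algebra_simps)
  qed
  have inb: "x + s *\<^sub>R u + t *\<^sub>R v \<in> ball x e" if "0 \<le> s" "s \<le> h" "0 \<le> t" "t \<le> h" for s t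
  proof -
    have "dist (x + (s *\<^sub>R u + t *\<^sub>R v)) x < e"
      using nrm[OF that] h by (simp only: dist_norm add_diff_cancel_left')
    then show ?thesis by (simp add: dist_commute add.assoc)
  qed
  have D1: "((\<lambda>s. f (x + s *\<^sub>R u + t *\<^sub>R v)) has_real_derivative ?D (x + s *\<^sub>R u + t *\<^sub>R v) u) (at s)"
    if "0 \<le> s" "s \<le> h" "0 \<le> t" "t \<le> h" for s t
  proof -
    have fd: "(f has_derivative ?D (x + s *\<^sub>R u + t *\<^sub>R v)) (at (x + s *\<^sub>R u + t *\<^sub>R v))"
      using smooth_on_has_derivative[OF f inb[OF that]] .
    have "((\<lambda>s. x + s *\<^sub>R u + t *\<^sub>R v) has_derivative (\<lambda>r. r *\<^sub>R u)) (at s)"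
      by (auto intro!: derivative_eq_intros)
    from diff_chain_at[OF this fd]
    have "((\<lambda>s. f (x + s *\<^sub>R u + t *\<^sub>R v)) has_derivative (\<lambda>r. ?D (x + s *\<^sub>R u + t *\<^sub>R v) (r *\<^sub>R u))) (at s)"
      by (simp add: o_def)
    moreover have "?D (x + s *\<^sub>R u + t *\<^sub>R v) (r *\<^sub>R u) = ?D (x + s *\<^sub>R u + t *\<^sub>R v) u * r" for r
      using linear_scale[OF has_derivative_linear[OF fd]] by (simp add: mult.commute)
    ultimately show ?thesis by (simp add: has_field_derivative_def)
  qed
  \<comment> \<open>Mean value theorem in direction \<open>u\<close>, for the difference of
    \<open>f\<close> on two parallel segments; a second application below treats direction
    \<open>v\<close>. The second difference is symmetric in \<open>u\<close> and \<open>v\<close>,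
    so it yields both mixed derivatives.\<close>
  have "\<exists>\<sigma>. 0 < \<sigma> \<and> \<sigma> < h \<and>
     (f (x + h *\<^sub>R u + h *\<^sub>R v) - f (x + h *\<^sub>R u + 0 *\<^sub>R v)) - (f (x + 0 *\<^sub>R u + h *\<^sub>R v) - f (x + 0 *\<^sub>R u + 0 *\<^sub>R v)) =
     (h - 0) * (?D (x + \<sigma> *\<^sub>R u + h *\<^sub>R v) u - ?D (x + \<sigma> *\<^sub>R u + 0 *\<^sub>R v) u)"
    by (rule MVT2[OF h(1)], intro DERIV_diff D1) (use h in auto)
  then obtain \<sigma> where \<sigma>: "0 < \<sigma>" "\<sigma> < h" and eq1:
    "(f (x + h *\<^sub>R u + h *\<^sub>R v) - f (x + h *\<^sub>R u + 0 *\<^sub>R v)) - (f (x + 0 *\<^sub>R u + h *\<^sub>R v) - f (x + 0 *\<^sub>R u + 0 *\<^sub>R v)) =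
     (h - 0) * (?D (x + \<sigma> *\<^sub>R u + h *\<^sub>R v) u - ?D (x + \<sigma> *\<^sub>R u + 0 *\<^sub>R v) u)" by blast
  have D2: "((\<lambda>t. ?D (x + \<sigma> *\<^sub>R u + t *\<^sub>R v) u) has_real_derivative ?D2 (x + \<sigma> *\<^sub>R u + t *\<^sub>R v) v) (at t)"
    if "0 \<le> t" "t \<le> h" for t
  proof -
    have fd: "((\<lambda>z. ?D z u) has_derivative ?D2 (x + \<sigma> *\<^sub>R u + t *\<^sub>R v)) (at (x + \<sigma> *\<^sub>R u + t *\<^sub>R v))"
      using smooth_on_has_derivative[OF smooth_on_frechet_derivative[OF f] inb] \<sigma> that by simp
    have "((\<lambda>t. x + \<sigma> *\<^sub>R u + t *\<^sub>R v) has_derivative (\<lambda>r. r *\<^sub>R v)) (at t)"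
      by (auto intro!: derivative_eq_intros)
    from diff_chain_at[OF this fd]
    have "((\<lambda>t. ?D (x + \<sigma> *\<^sub>R u + t *\<^sub>R v) u) has_derivative (\<lambda>r. ?D2 (x + \<sigma> *\<^sub>R u + t *\<^sub>R v) (r *\<^sub>R v))) (at t)"
      by (simp add: o_def)
    moreover have "?D2 (x + \<sigma> *\<^sub>R u + t *\<^sub>R v) (r *\<^sub>R v) = ?D2 (x + \<sigma> *\<^sub>R u + t *\<^sub>R v) v * r" for r
      using linear_scale[OF has_derivative_linear[OF fd]] by (simp add: mult.commute)
    ultimately show ?thesis by (simp add: has_field_derivative_def)
  qed
  have "\<exists>\<tau>. 0 < \<tau> \<and> \<tau> < h \<and> ?D (x + \<sigma> *\<^sub>R u + h *\<^sub>R v) u - ?D (x + \<sigma> *\<^sub>R u + 0 *\<^sub>R v) u =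
      (h - 0) * ?D2 (x + \<sigma> *\<^sub>R u + \<tau> *\<^sub>R v) v"
    by (rule MVT2[OF h(1)]) (use D2 in auto)
  then obtain \<tau> where \<tau>: "0 < \<tau>" "\<tau> < h" and eq2:
    "?D (x + \<sigma> *\<^sub>R u + h *\<^sub>R v) u - ?D (x + \<sigma> *\<^sub>R u + 0 *\<^sub>R v) u = (h - 0) * ?D2 (x + \<sigma> *\<^sub>R u + \<tau> *\<^sub>R v) v"
    by blast
  show ?thesis
    by (rule exI[where x="x + \<sigma> *\<^sub>R u + \<tau> *\<^sub>R v"])
       (use eq1 eq2 nrm[of \<sigma> \<tau>] \<sigma> \<tau> in \<open>simp add: algebra_simps\<close>)
qed

text \<open>Both orders of differentiation come from the same second difference, so the mixed
  derivatives agree at points \<open>y\<close> and \<open>z\<close> arbitrarily close to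
  \<open>x\<close>; continuity carries this to \<open>x\<close>.\<close>

lemma symmetric_second_derivative_real:
  fixes f :: "'a::real_normed_vector \<Rightarrow> real"
  assumes f: "smooth_on W f" and W: "open W" "x \<in> W"
  shows "frechet_derivative (\<lambda>z. frechet_derivative f (at z) u) (at x) v =
         frechet_derivative (\<lambda>z. frechet_derivative f (at z) v) (at x) u" (is "?A x = ?B x")
proof -
  obtain e where e: "e > 0" "ball x e \<subseteq> W" using W openE by blast
  have fb: "smooth_on (ball x e) f" using f e smooth_on_subset by blast
  have "\<exists>y. norm (y - x) < \<delta> \<and> (\<exists>z. norm (z - x) < \<delta> \<and> ?A y = ?B z)" if "\<delta> > 0" for \<delta>
  proof -
    \<comment> \<open>The summand 1 keeps \<open>m\<close> positive for
      \<open>u = v = 0\<close>.\<close>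
    define m where "m = norm u + norm v + 1"
    have m: "m > 0" by (simp add: m_def add_nonneg_pos)
    define h where "h = min e \<delta> / (2 * m)"
    have h: "h > 0" using m e that by (simp add: h_def)
    have "h * (norm u + norm v) \<le> h * m" using h by (simp add: m_def)
    also have "\<dots> = min e \<delta> / 2" using m by (simp add: h_def)
    finally have hs: "h * (norm u + norm v) < e" "h * (norm u + norm v) < \<delta>" using e that by auto
    obtain y where y: "norm (y - x) \<le> h * (norm u + norm v)"
       "f (x + h *\<^sub>R u + h *\<^sub>R v) - f (x + h *\<^sub>R u) - f (x + h *\<^sub>R v) + f x = h * h * ?A y"
      using second_difference_mvt[OF fb h hs(1)] by blast
    obtain z where z: "norm (z - x) \<le> h * (norm v + norm u)"
       "f (x + h *\<^sub>R v + h *\<^sub>R u) - f (x + h *\<^sub>R v) - f (x + h *\<^sub>R u) + f x = h * h * ?B z"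
      using second_difference_mvt[OF fb h, of v u] hs by (auto simp: add.commute)
    have "h * h * ?A y = h * h * ?B z" using y(2) z(2) by (simp add: algebra_simps)
    then have "?A y = ?B z" using h by simp
    moreover have "norm (y - x) < \<delta>" "norm (z - x) < \<delta>" using y z hs by (auto simp: add.commute)
    ultimately show ?thesis by blast
  qed
  then have "\<exists>y z. norm (y - x) < 1 / real (Suc n) \<and> norm (z - x) < 1 / real (Suc n) \<and> ?A y = ?B z" for n
    by (metis of_nat_0_less_iff zero_less_Suc zero_less_divide_1_iff)
  then obtain y z where yz: "\<And>n. norm (y n - x) < 1 / real (Suc n)" "\<And>n. norm (z n - x) < 1 / real (Suc n)"
    "\<And>n. ?A (y n) = ?B (z n)" by metis
  have lim: "w \<longlonglongrightarrow> x" if "\<And>n. norm (w n - x) < 1 / real (Suc n)" for w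
  proof -
    have "(\<lambda>n. w n - x) \<longlonglongrightarrow> 0"
      by (rule Lim_null_comparison[OF _ LIMSEQ_inverse_real_of_nat])
         (use that in \<open>auto simp: inverse_eq_divide intro!: always_eventually less_imp_le\<close>)
    then show ?thesis using LIM_zero_iff by blast
  qed
  have cont: "isCont ?A x" "isCont ?B x"
    using smooth_on_continuous_on[OF smooth_on_frechet_derivative[OF smooth_on_frechet_derivative[OF f]]]
      W continuous_on_eq_continuous_at by blast+
  have "(\<lambda>n. ?A (y n)) \<longlonglongrightarrow> ?A x" by (rule isCont_tendsto_compose[OF cont(1) lim[OF yz(1)]])
  moreover have "(\<lambda>n. ?B (z n)) \<longlonglongrightarrow> ?B x" by (rule isCont_tendsto_compose[OF cont(2) lim[OF yz(2)]])
  ultimately show ?thesis using yz(3) LIMSEQ_unique by simp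
qed

lemma symmetric_second_derivative:
  fixes f :: "'a::real_normed_vector \<Rightarrow> 'b::euclidean_space"
  assumes f: "smooth_on W f" and W: "open W" "x \<in> W"
  shows "frechet_derivative (\<lambda>z. frechet_derivative f (at z) u) (at x) v =
         frechet_derivative (\<lambda>z. frechet_derivative f (at z) v) (at x) u"
proof (rule euclidean_eqI)
  fix b :: 'b
  define fb where "fb = (\<lambda>z. f z \<bullet> b)"
  have fb: "smooth_on W fb" unfolding fb_def by (rule smooth_on_bounded_linear[OF bounded_linear_inner_left W(1) f])
  have inner: "(frechet_derivative g (at z) w) \<bullet> b = frechet_derivative (\<lambda>z. g z \<bullet> b) (at z) w"
    if "smooth_on W g" "z \<in> W" for g :: "'a \<Rightarrow> 'b" and z w
  proof -
    have "((\<lambda>z. g z \<bullet> b) has_derivative (\<lambda>w. frechet_derivative g (at z) w \<bullet> b)) (at z)"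
      by (rule has_derivative_inner_left[OF smooth_on_has_derivative[OF that]])
    from frechet_derivative_at[OF this] show ?thesis by metis
  qed
  have "frechet_derivative (\<lambda>z. frechet_derivative f (at z) a) (at x) c \<bullet> b =
        frechet_derivative (\<lambda>z. frechet_derivative fb (at z) a) (at x) c" for a c
  proof -
    have "frechet_derivative (\<lambda>z. frechet_derivative f (at z) a) (at x) c \<bullet> b =
       frechet_derivative (\<lambda>z. frechet_derivative f (at z) a \<bullet> b) (at x) c"
      by (rule inner[OF smooth_on_frechet_derivative[OF f] W(2)])
    moreover have "frechet_derivative (\<lambda>z. frechet_derivative fb (at z) a) (at x) =
       frechet_derivative (\<lambda>z. frechet_derivative f (at z) a \<bullet> b) (at x)"
      by (rule frechet_derivative_transform_within_open[OF _ W])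
         (use smooth_on_has_derivative[OF smooth_on_frechet_derivative[OF fb] W(2)] inner[OF f] in
           \<open>auto simp: differentiable_def fb_def\<close>)
    ultimately show ?thesis by simp
  qed
  then show "frechet_derivative (\<lambda>z. frechet_derivative f (at z) u) (at x) v \<bullet> b =
         frechet_derivative (\<lambda>z. frechet_derivative f (at z) v) (at x) u \<bullet> b"
    using symmetric_second_derivative_real[OF fb W] by simp
qed

section \<open>Charts\<close>

abbreviation chart_image :: "('p, 'e) chart \<Rightarrow> 'e set" where
  "chart_image c \<equiv> snd c ` fst c"

text \<open>\<open>k\<close> is a smooth extension of the coordinate expression of \<open>f\<close> to a full neighbourhood of
  the coordinates of \<open>p\<close>.\<close>

definition local_rep ::
  "('p, real ^ 'm) chart \<Rightarrow> 'p \<Rightarrow> ('p \<Rightarrow> 'b::real_normed_vector) \<Rightarrow> (real ^ 'm) set \<Rightarrow> (real ^ 'm \<Rightarrow> 'b) \<Rightarrow> bool" where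
  "local_rep c p f W k \<longleftrightarrow> open W \<and> snd c p \<in> W \<and> smooth_on W k \<and> (\<forall>z\<in>W \<inter> chart_image c. f (param c z) = k z)"

text \<open>Uniqueness needs approach within \<open>S\<close> along every coordinate direction.
  Positive multiples of basis vectors suffice: their boundary coordinate is nonnegative, so they
  never leave the half-space.\<close>

lemma half_space_derivative_unique:
  fixes f :: "real ^ 'm::finite \<Rightarrow> 'b::real_normed_vector"
  assumes "x \<in> half_space" "e > 0" "\<And>z. z \<in> half_space \<Longrightarrow> dist z x < e \<Longrightarrow> z \<in> S"
    and "(f has_derivative D) (at x within S)" "(f has_derivative D') (at x within S)"
  shows "D = D'"
proof (rule frechet_derivative_unique_within[OF assms(4,5)])
  fix i :: "real ^ 'm" and r :: real assume i: "i \<in> Basis" and r: "r > 0"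
  define d where "d = min e r / 2"
  have d: "d > 0" "d < e" "d < r" using assms(2) r by (auto simp: d_def min_def)
  have "i $ bd_index \<ge> 0" using i by (auto simp: Basis_vec_def axis_def)
  then have "x + d *\<^sub>R i \<in> S"
    using i d assms(1) by (intro assms(3)) (auto simp: half_space_def dist_norm)
  then show "\<exists>d. 0 < \<bar>d\<bar> \<and> \<bar>d\<bar> < r \<and> x + d *\<^sub>R i \<in> S" using d by (intro exI[of _ d]) auto
qed

lemma has_derivative_transform_near:
  assumes "(f has_derivative f') (at x within S)" "open W" "x \<in> W" "x \<in> S"
    "\<And>y. y \<in> W \<Longrightarrow> y \<in> S \<Longrightarrow> f y = g y"
  shows "(g has_derivative f') (at x within S)"
proof -
  obtain e where "e > 0" "ball x e \<subseteq> W" using assms(2,3) openE by blast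
  then show ?thesis
    using assms by (intro has_derivative_transform_within[OF assms(1)]) (auto simp: dist_commute subset_iff)
qed

lemma smooth_map_stdD:
  assumes "smooth_map std_chart D X Y f" "x \<in> X" "d \<in> D" "f x \<in> fst d"
  obtains W k where "open W" "x \<in> W" "smooth_on W k"
    "\<And>z. z \<in> X \<Longrightarrow> z \<in> W \<Longrightarrow> f z \<in> fst d \<and> snd d (f z) = k z"
proof -
  have "\<forall>d\<in>D. f x \<in> fst d \<longrightarrow> (\<exists>W k. open W \<and> x \<in> W \<and> smooth_on W k \<and>
      (\<forall>z\<in>X. z \<in> W \<longrightarrow> f z \<in> fst d \<and> snd d (f z) = k z))"
    using assms(1,2) by (simp add: smooth_map_def)
  then show ?thesis using assms(3,4) that by meson
qed

text \<open>One-sided Fermat principle. It is applied to boundary coordinates along curves, which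
  are minimal at boundary points.\<close>

lemma deriv_nonneg_right:
  fixes f :: "real \<Rightarrow> real"
  assumes D: "(f has_vector_derivative l) (at t within S)" and S: "{t..<t + e} \<subseteq> S" "e > 0"
    and W: "open W" "t \<in> W" and min: "\<And>s. s \<in> S \<Longrightarrow> s \<in> W \<Longrightarrow> f t \<le> f s"
  shows "0 \<le> l"
proof (rule ccontr)
  assume "\<not> 0 \<le> l"
  then obtain d where d: "d > 0" "\<And>h. 0 < h \<Longrightarrow> t + h \<in> S \<Longrightarrow> h < d \<Longrightarrow> f (t + h) < f t"
    using has_real_derivative_neg_dec_right[OF D[unfolded has_real_derivative_iff_has_vector_derivative[symmetric]]]
    by auto
  obtain b where b: "b > 0" "ball t b \<subseteq> W" using W openE by blast
  define h where "h = min (min b d) e / 2"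
  have "h > 0" "h < b" "h < d" "h < e" using b d S by (auto simp: h_def)
  then have "t + h \<in> S" "t + h \<in> W" "f (t + h) < f t" using b S d by (auto simp: dist_norm subset_iff)
  then show False using min by fastforce
qed

lemma deriv_nonpos_left:
  fixes f :: "real \<Rightarrow> real"
  assumes D: "(f has_vector_derivative l) (at t within S)" and S: "{t - e<..t} \<subseteq> S" "e > 0"
    and W: "open W" "t \<in> W" and min: "\<And>s. s \<in> S \<Longrightarrow> s \<in> W \<Longrightarrow> f t \<le> f s"
  shows "l \<le> 0"
proof (rule ccontr)
  assume "\<not> l \<le> 0"
  then obtain d where d: "d > 0" "\<And>h. 0 < h \<Longrightarrow> t - h \<in> S \<Longrightarrow> h < d \<Longrightarrow> f (t - h) < f t"
    using has_real_derivative_pos_inc_left[OF D[unfolded has_real_derivative_iff_has_vector_derivative[symmetric]]]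
    by auto
  obtain b where b: "b > 0" "ball t b \<subseteq> W" using W openE by blast
  define h where "h = min (min b d) e / 2"
  have "h > 0" "h < b" "h < d" "h < e" using b d S by (auto simp: h_def)
  then have "t - h \<in> S" "t - h \<in> W" "f (t - h) < f t" using b S d by (auto simp: dist_norm subset_iff)
  then show False using min by fastforce
qed

section \<open>Manifolds with boundary: charts, transition maps, derivatives\<close>

locale manifold =
  fixes \<Omega> :: "'p::t2_space set" and A :: "('p, real ^ 'm::finite) chart set"
  assumes manifold: "smooth_manifold \<Omega> A"
begin

lemma chart_domain: "c \<in> A \<Longrightarrow> fst c \<subseteq> \<Omega>"
  and chart_exists: "p \<in> \<Omega> \<Longrightarrow> \<exists>c\<in>A. p \<in> fst c"
  and chart_domain_open: "c \<in> A \<Longrightarrow> openin (top_of_set \<Omega>) (fst c)"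
  and chart_image_open: "c \<in> A \<Longrightarrow> openin (top_of_set half_space) (chart_image c)"
  and chart_homeo: "c \<in> A \<Longrightarrow> homeomorphism (fst c) (chart_image c) (snd c) (param c)"
  using manifold unfolding smooth_manifold_def by blast+

lemma param_coord: "c \<in> A \<Longrightarrow> p \<in> fst c \<Longrightarrow> param c (snd c p) = p"
  and coord_param: "c \<in> A \<Longrightarrow> z \<in> chart_image c \<Longrightarrow> snd c (param c z) = z"
  and param_in: "c \<in> A \<Longrightarrow> z \<in> chart_image c \<Longrightarrow> param c z \<in> fst c"
  using chart_homeo unfolding homeomorphism_def by blast+

lemma coord_nonneg: "c \<in> A \<Longrightarrow> p \<in> fst c \<Longrightarrow> 0 \<le> snd c p $ bd_index"
  using openin_imp_subset[OF chart_image_open] unfolding half_space_def by blast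

text \<open>Chart images are only relatively open in the half-space, so metric neighbourhoods are
  balls cut with the half-space; openness in \<Omega> is converted into such a neighbourhood
  here.\<close>

lemma chart_nbhd:
  assumes c: "c \<in> A" "p \<in> fst c" and U: "openin (top_of_set \<Omega>) U" "p \<in> U"
  obtains e where "e > 0" "\<And>z. z \<in> half_space \<Longrightarrow> dist z (snd c p) < e \<Longrightarrow> z \<in> chart_image c \<and> param c z \<in> U"
proof -
  have cont: "continuous_on (chart_image c) (param c)" and im: "param c ` chart_image c = fst c"
    using chart_homeo[OF c(1)] unfolding homeomorphism_def by blast+
  have "openin (top_of_set (fst c)) (fst c \<inter> U)"
    using U chart_domain[OF c(1)] by (auto simp: openin_open)
  then have "openin (top_of_set (chart_image c)) (chart_image c \<inter> param c -` (fst c \<inter> U))"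
    using continuous_openin_preimage[OF cont, of "fst c"] im by blast
  then have "openin (top_of_set half_space) (chart_image c \<inter> param c -` (fst c \<inter> U))"
    using chart_image_open[OF c(1)] openin_trans by blast
  moreover have "snd c p \<in> chart_image c \<inter> param c -` (fst c \<inter> U)"
    using c U param_coord by auto
  ultimately obtain e where "e > 0" "ball (snd c p) e \<inter> half_space \<subseteq> chart_image c \<inter> param c -` (fst c \<inter> U)"
    unfolding openin_contains_ball by blast
  then show ?thesis using that[of e] by (simp add: dist_commute subset_iff)
qed

lemma coord_preimage_open:
  assumes c: "c \<in> A" and W: "open W"
  shows "openin (top_of_set \<Omega>) {p \<in> fst c. snd c p \<in> W}"
proof -
  have "continuous_on (fst c) (snd c)" using chart_homeo[OF c] unfolding homeomorphism_def by blast
  then have "openin (top_of_set (fst c)) (fst c \<inter> snd c -` W)"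
    using W continuous_openin_preimage_gen by blast
  then have "openin (top_of_set \<Omega>) (fst c \<inter> snd c -` W)"
    using chart_domain_open[OF c] openin_trans by blast
  moreover have "fst c \<inter> snd c -` W = {p \<in> fst c. snd c p \<in> W}" by auto
  ultimately show ?thesis by simp
qed

text \<open>Any extension \<open>k\<close> across the boundary computes the one-sided derivative,
  because derivatives within a half-ball are unique. \<open>k\<close> is only differentiable at the
  point, so that it also serves for the gradient components in the Laplacian computation.\<close>

lemma chart_D_eqI:
  assumes c: "c \<in> A" "p \<in> fst c" and W: "open W" "snd c p \<in> W"
    and k: "(k has_derivative D) (at (snd c p))" "\<And>z. z \<in> W \<inter> chart_image c \<Longrightarrow> f (param c z) = k z"
  shows "chart_D c f p = D"
proof -
  let ?x = "snd c p" and ?S = "chart_image c"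
  have xS: "?x \<in> ?S" using c by auto
  have "(k has_derivative D) (at ?x within ?S)" using k(1) has_derivative_at_withinI by blast
  then have D: "((f \<circ> param c) has_derivative D) (at ?x within ?S)"
    by (rule has_derivative_transform_near[OF _ W xS]) (use k(2) in auto)
  then have D': "((f \<circ> param c) has_derivative chart_D c f p) (at ?x within ?S)"
    unfolding chart_D_def[abs_def] using frechet_derivative_works differentiable_def by blast
  obtain e where "e > 0" "\<And>z. z \<in> half_space \<Longrightarrow> dist z ?x < e \<Longrightarrow> z \<in> ?S"
    using chart_nbhd[OF c chart_domain_open[OF c(1)] c(2)] by metis
  then show ?thesis
    using half_space_derivative_unique[OF _ _ _ D' D] openin_imp_subset[OF chart_image_open[OF c(1)]] xS by blast
qed

lemma local_rep_derivative:
  assumes c: "c \<in> A" "p \<in> fst c" and k: "local_rep c p f W k"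
  shows "chart_D c f p = frechet_derivative k (at (snd c p))"
  using chart_D_eqI[OF c _ _ smooth_on_has_derivative] k unfolding local_rep_def by blast

lemma local_rep_linear:
  assumes "c \<in> A" "p \<in> fst c" "local_rep c p f W k"
  shows "linear (chart_D c f p)"
  using local_rep_derivative[OF assms] assms(3) frechet_derivative_linear unfolding local_rep_def by metis

lemma local_rep_at:
  assumes "c \<in> A" "q \<in> fst c" "snd c q \<in> W" "local_rep c p f W k"
  shows "local_rep c q f W k" "f q = k (snd c q)"
  using assms param_coord unfolding local_rep_def by (auto; metis IntI imageI)+

lemma smooth_map_local_rep:
  assumes sm: "smooth_map A D X Y f" and X: "openin (top_of_set \<Omega>) X" "p \<in> X"
    and c: "c \<in> A" "p \<in> fst c" and d: "d \<in> D" "f p \<in> fst d"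
  obtains W k where "local_rep c p (\<lambda>q. snd d (f q)) W k"
    "\<And>z. z \<in> W \<inter> chart_image c \<Longrightarrow> param c z \<in> X \<and> f (param c z) \<in> fst d \<and> snd d (f (param c z)) = k z"
proof -
  obtain W k where W: "open W" "snd c p \<in> W" "smooth_on W k"
    "\<And>z. z \<in> X \<inter> fst c \<Longrightarrow> snd c z \<in> W \<Longrightarrow> f z \<in> fst d \<and> snd d (f z) = k (snd c z)"
    using sm X c d unfolding smooth_map_def by meson
  obtain e where e: "e > 0" "\<And>z. z \<in> half_space \<Longrightarrow> dist z (snd c p) < e \<Longrightarrow> z \<in> chart_image c \<and> param c z \<in> X"
    using chart_nbhd[OF c X] by metis
  have *: "param c z \<in> X \<and> f (param c z) \<in> fst d \<and> snd d (f (param c z)) = k z"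
    if "z \<in> (W \<inter> ball (snd c p) e) \<inter> chart_image c" for z
  proof -
    have "z \<in> half_space" using that openin_imp_subset[OF chart_image_open[OF c(1)]] by blast
    then have "param c z \<in> X" using e(2) that by (auto simp: dist_commute)
    then show ?thesis using W(4)[of "param c z"] that param_in coord_param c by auto
  qed
  have "local_rep c p (\<lambda>q. snd d (f q)) (W \<inter> ball (snd c p) e) k"
    unfolding local_rep_def using W e * by (auto intro: smooth_on_subset)
  then show ?thesis using that * by blast
qed

lemma transition_local_rep:
  assumes c: "c \<in> A" "p \<in> fst c" and d: "d \<in> A" "p \<in> fst d"
  obtains W k where "local_rep c p (snd d) W k"
    "\<And>z. z \<in> W \<inter> chart_image c \<Longrightarrow> param c z \<in> fst d \<and> snd d (param c z) = k z"
proof -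
  have sm: "smooth_map std_chart std_chart (snd c ` (fst c \<inter> fst d)) UNIV (snd d \<circ> param c)"
    using manifold c d unfolding smooth_manifold_def by blast
  have "snd c p \<in> snd c ` (fst c \<inter> fst d)" using c d by blast
  from smooth_map_stdD[OF sm this, of "(UNIV, \<lambda>x. x)"]
  obtain W k where W: "open W" "snd c p \<in> W" "smooth_on W k"
    "\<And>z. z \<in> snd c ` (fst c \<inter> fst d) \<Longrightarrow> z \<in> W \<Longrightarrow> snd d (param c z) = k z"
    by auto
  obtain e where e: "e > 0" "\<And>z. z \<in> half_space \<Longrightarrow> dist z (snd c p) < e \<Longrightarrow> z \<in> chart_image c \<and> param c z \<in> fst d"
    using chart_nbhd[OF c chart_domain_open[OF d(1)] d(2)] by metis
  have *: "param c z \<in> fst d \<and> snd d (param c z) = k z"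
    if "z \<in> (W \<inter> ball (snd c p) e) \<inter> chart_image c" for z
  proof -
    have "z \<in> half_space" using that openin_imp_subset[OF chart_image_open[OF c(1)]] by blast
    then have "param c z \<in> fst d" using e(2) that by (auto simp: dist_commute)
    moreover have "z = snd c (param c z)" "param c z \<in> fst c" using that coord_param param_in c by auto
    ultimately show ?thesis using W(4)[of z] that by blast
  qed
  have "local_rep c p (snd d) (W \<inter> ball (snd c p) e) k"
    unfolding local_rep_def using W e * by (auto intro: smooth_on_subset)
  then show ?thesis using that * by blast
qed

lemma chart_D_coord:
  assumes c: "c \<in> A" "p \<in> fst c"
  shows "chart_D c (snd c) p u = u"
proof -
  have "local_rep c p (snd c) UNIV (\<lambda>z. z)"
    unfolding local_rep_def using coord_param[OF c(1)] smooth_on_ident by auto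
  from local_rep_derivative[OF c this] show ?thesis by simp
qed

text \<open>The domain shrinks to \<open>V\<close> because the extension \<open>t\<close> of the
  transition map has no geometric meaning outside the chart image and has to be kept inside
  \<open>W\<close> by force.\<close>

lemma local_rep_change:
  assumes c: "c \<in> A" "p \<in> fst c" and d: "d \<in> A" "p \<in> fst d" and k: "local_rep d p f W k"
    and t: "local_rep c p (snd d) W' t" "\<And>z. z \<in> W' \<inter> chart_image c \<Longrightarrow> param c z \<in> fst d"
  obtains V where "local_rep c p f V (\<lambda>z. k (t z))" "V \<subseteq> W'" "t ` V \<subseteq> W"
proof -
  have W: "open W" "snd d p \<in> W" and smk: "smooth_on W k" and eqk: "\<And>z. z \<in> W \<inter> chart_image d \<Longrightarrow> f (param d z) = k z"
    using k unfolding local_rep_def by auto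
  have W': "open W'" "snd c p \<in> W'" and smt: "smooth_on W' t" and eqt: "\<And>z. z \<in> W' \<inter> chart_image c \<Longrightarrow> snd d (param c z) = t z"
    using t unfolding local_rep_def by auto
  define V where "V = W' \<inter> t -` W"
  have V: "open V" unfolding V_def
    using smooth_on_continuous_on[OF smt] W'(1) W(1) by (simp add: continuous_on_open_vimage Int_commute)
  have tp: "t (snd c p) = snd d p" using eqt[of "snd c p"] W' c param_coord by auto
  then have "snd c p \<in> V" using W W' by (auto simp: V_def)
  moreover have "smooth_on V (\<lambda>z. k (t z))"
    using smooth_on_compose[OF V W(1) _ smooth_on_subset[OF smt] smk] by (auto simp: V_def)
  moreover have "f (param c z) = k (t z)" if "z \<in> V \<inter> chart_image c" for z
  proof -
    have z: "z \<in> W' \<inter> chart_image c" "t z \<in> W" using that by (auto simp: V_def)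
    have "param c z \<in> fst d" "snd d (param c z) = t z" using z eqt t(2) by auto
    then have "param d (t z) = param c z" "t z \<in> chart_image d"
      using param_coord[OF d(1)] by (metis, metis imageI)
    then show ?thesis using eqk[of "t z"] z by auto
  qed
  ultimately have "local_rep c p f V (\<lambda>z. k (t z))" using V unfolding local_rep_def by blast
  then show ?thesis using that V_def by blast
qed

lemma chart_D_chain:
  assumes c: "c \<in> A" "p \<in> fst c" and d: "d \<in> A" "p \<in> fst d" and k: "local_rep d p f W k"
  shows "chart_D c f p u = chart_D d f p (chart_D c (snd d) p u)"
proof -
  obtain W' t where t: "local_rep c p (snd d) W' t" "\<And>z. z \<in> W' \<inter> chart_image c \<Longrightarrow> param c z \<in> fst d \<and> snd d (param c z) = t z"
    using transition_local_rep[OF c d] by blast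
  obtain V where V: "local_rep c p f V (\<lambda>z. k (t z))" using local_rep_change[OF c d k t(1)] t(2) by metis
  have tp: "t (snd c p) = snd d p" using local_rep_at(2)[OF c _ t(1)] t(1) by (auto simp: local_rep_def)
  have Dt: "(t has_derivative frechet_derivative t (at (snd c p))) (at (snd c p))"
    using t(1) smooth_on_has_derivative unfolding local_rep_def by blast
  have Dk: "(k has_derivative frechet_derivative k (at (snd d p))) (at (t (snd c p)))"
    using k smooth_on_has_derivative unfolding local_rep_def tp by blast
  have "frechet_derivative (\<lambda>z. k (t z)) (at (snd c p)) =
      frechet_derivative k (at (snd d p)) \<circ> frechet_derivative t (at (snd c p))"
    using frechet_derivative_at[OF diff_chain_at[OF Dt Dk]] by (simp add: o_def)
  then show ?thesis
    using local_rep_derivative[OF c V] local_rep_derivative[OF d k] local_rep_derivative[OF c t(1)] by simp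
qed

lemma chart_D_cocycle:
  assumes c: "c \<in> A" "p \<in> fst c" and d: "d \<in> A" "p \<in> fst d" and e: "e \<in> A" "p \<in> fst e"
  shows "chart_D d (snd e) p (chart_D c (snd d) p u) = chart_D c (snd e) p u"
  using transition_local_rep[OF d e] chart_D_chain[OF c d] by metis

lemma chart_D_transition_inverse:
  assumes c: "c \<in> A" "p \<in> fst c" and d: "d \<in> A" "p \<in> fst d"
  shows "chart_D d (snd c) p (chart_D c (snd d) p u) = u"
  using chart_D_cocycle[OF c d c] chart_D_coord[OF c] by simp

lemma interior_chart_ball:
  assumes c: "c \<in> A" "p \<in> fst c" "snd c p $ bd_index > 0" and U: "openin (top_of_set \<Omega>) U" "p \<in> U"
  obtains e where "e > 0" "ball (snd c p) e \<subseteq> chart_image c" "param c ` ball (snd c p) e \<subseteq> U"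
    "\<And>z. z \<in> ball (snd c p) e \<Longrightarrow> z $ bd_index > 0"
proof -
  obtain e where e: "e > 0" "\<And>z. z \<in> half_space \<Longrightarrow> dist z (snd c p) < e \<Longrightarrow> z \<in> chart_image c \<and> param c z \<in> U"
    using chart_nbhd[OF c(1,2) U] by metis
  define r where "r = min e (snd c p $ bd_index)"
  have r: "r > 0" using e c by (simp add: r_def)
  have pos: "z $ bd_index > 0" if "z \<in> ball (snd c p) r" for z
  proof -
    have "\<bar>(snd c p - z) $ bd_index\<bar> < r"
      using component_le_norm_cart[of "snd c p - z" bd_index] that by (simp add: dist_norm)
    then show ?thesis by (auto simp: r_def)
  qed
  then have "z \<in> half_space \<and> dist z (snd c p) < e" if "z \<in> ball (snd c p) r" for z
    using that by (auto simp: half_space_def r_def dist_commute less_imp_le)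
  then show ?thesis using that[OF r] e pos by blast
qed

text \<open>Otherwise the boundary coordinate of \<open>c\<close>, read in \<open>d\<close>, has a
  minimum at the centre of a full ball, so its differential vanishes. That contradicts the
  invertibility of the coordinate change, tested on the vector sent to
  \<open>axis bd_index 1\<close>.\<close>

lemma boundary_chart_independent:
  assumes c: "c \<in> A" "p \<in> fst c" and d: "d \<in> A" "p \<in> fst d" and p: "snd c p $ bd_index = 0"
  shows "snd d p $ bd_index = 0"
proof (rule ccontr)
  assume "snd d p $ bd_index \<noteq> 0"
  then have pos: "snd d p $ bd_index > 0" using coord_nonneg[OF d] by simp
  obtain W t where t: "local_rep d p (snd c) W t" "\<And>z. z \<in> W \<inter> chart_image d \<Longrightarrow> param d z \<in> fst c \<and> snd c (param d z) = t z"
    using transition_local_rep[OF d c] by blast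
  obtain e where e: "e > 0" "ball (snd d p) e \<subseteq> chart_image d"
    using interior_chart_ball[OF d pos chart_domain_open[OF d(1)] d(2)] by metis
  have tp: "t (snd d p) = snd c p" using local_rep_at(2)[OF d _ t(1)] t(1) by (auto simp: local_rep_def)
  have W: "open W" "snd d p \<in> W" using t(1) by (auto simp: local_rep_def)
  have Dt: "(t has_derivative frechet_derivative t (at (snd d p))) (at (snd d p))"
    using t(1) smooth_on_has_derivative unfolding local_rep_def by blast
  have Dt0: "((\<lambda>z. t z $ bd_index) has_derivative (\<lambda>u. frechet_derivative t (at (snd d p)) u $ bd_index)) (at (snd d p))"
    using bounded_linear.has_derivative[OF bounded_linear_vec_nth Dt] .
  have "(\<lambda>u. frechet_derivative t (at (snd d p)) u $ bd_index) = (\<lambda>u. 0)"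
  proof (rule differential_zero_maxmin[OF _ _ Dt0])
    show "snd d p \<in> W \<inter> ball (snd d p) e" "open (W \<inter> ball (snd d p) e)" using W e by auto
    have "0 \<le> t y $ bd_index" if "y \<in> W \<inter> ball (snd d p) e" for y
      using t(2)[of y] e(2) coord_nonneg[OF c(1), of "param d y"] that by auto
    then show "(\<forall>y\<in>W \<inter> ball (snd d p) e. t y $ bd_index \<le> t (snd d p) $ bd_index) \<or>
      (\<forall>y\<in>W \<inter> ball (snd d p) e. t (snd d p) $ bd_index \<le> t y $ bd_index)"
      using tp p by auto
  qed
  then have "chart_D d (snd c) p u $ bd_index = 0" for u
    using local_rep_derivative[OF d t(1)] by metis
  from this[of "chart_D c (snd d) p (axis bd_index 1)"] show False
    using chart_D_transition_inverse[OF c d] by simp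
qed

lemma mfd_boundary_iff:
  "c \<in> A \<Longrightarrow> p \<in> fst c \<Longrightarrow> p \<in> mfd_boundary \<Omega> A \<longleftrightarrow> snd c p $ bd_index = 0"
  using boundary_chart_independent chart_domain unfolding mfd_boundary_def by blast

lemma closedin_mfd_boundary: "closedin (top_of_set \<Omega>) (mfd_boundary \<Omega> A)"
proof -
  have "openin (top_of_set \<Omega>) (\<Omega> - mfd_boundary \<Omega> A)"
  proof (subst openin_subopen, intro ballI)
    fix p assume p: "p \<in> \<Omega> - mfd_boundary \<Omega> A"
    then obtain c where c: "c \<in> A" "p \<in> fst c" using chart_exists by blast
    have pos: "snd c p $ bd_index > 0" using p mfd_boundary_iff[OF c] coord_nonneg[OF c] by auto
    have "open {x :: real ^ 'm. x $ bd_index > 0}"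
      by (simp add: open_halfspace_component_gt_cart)
    from coord_preimage_open[OF c(1) this]
    show "\<exists>T. openin (top_of_set \<Omega>) T \<and> p \<in> T \<and> T \<subseteq> \<Omega> - mfd_boundary \<Omega> A"
      using c pos mfd_boundary_iff[OF c(1)] chart_domain[OF c(1)]
      by (intro exI[of _ "{q \<in> fst c. snd c q \<in> {x. x $ bd_index > 0}}"]) auto
  qed
  then show ?thesis by (simp add: closedin_def mfd_boundary_def)
qed

lemma compact_mfd_boundary: "compact \<Omega> \<Longrightarrow> compact (mfd_boundary \<Omega> A)"
  using closedin_compact closedin_mfd_boundary by blast

section \<open>Tangent vectors and velocities of curves\<close>

definition tangent_vector :: "('p, real ^ 'm) chart \<Rightarrow> 'p \<Rightarrow> real ^ 'm \<Rightarrow> ('p, 'm) tvec" where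
  "tangent_vector c p u = (\<lambda>d. if d \<in> A \<and> p \<in> fst d then chart_D c (snd d) p u else 0)"

lemma tangent_vector:
  assumes c: "c \<in> A" "p \<in> fst c"
  shows "tangent_vector c p u \<in> tangent_space A p" "tangent_vector c p u c = u"
  using chart_D_cocycle[OF c] chart_D_coord[OF c] c
  by (auto simp: tangent_space_def tangent_vector_def)

lemma curve_has_derivative:
  fixes \<gamma> :: "real \<Rightarrow> 'p"
  assumes \<gamma>: "smooth_map std_chart A I X \<gamma>" and t: "t \<in> I" and c: "c \<in> A" "\<gamma> t \<in> fst c"
    and ntriv: "at t within I \<noteq> bot"
  shows "((snd c \<circ> \<gamma>) has_vector_derivative velocity A I \<gamma> t c) (at t within I)"
proof -
  obtain W k where W: "open W" "t \<in> W" "smooth_on W k" "\<And>s. s \<in> I \<Longrightarrow> s \<in> W \<Longrightarrow> \<gamma> s \<in> fst c \<and> snd c (\<gamma> s) = k s"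
    by (rule smooth_map_stdD[OF \<gamma> t c]) blast
  have "(k has_derivative frechet_derivative k (at t)) (at t within I)"
    using smooth_on_has_derivative[OF W(3,2)] has_derivative_at_withinI by blast
  then have "((snd c \<circ> \<gamma>) has_derivative frechet_derivative k (at t)) (at t within I)"
    by (rule has_derivative_transform_near[OF _ W(1,2) t]) (use W in auto)
  then have "(snd c \<circ> \<gamma>) differentiable (at t within I)" unfolding differentiable_def by blast
  then show ?thesis using c by (simp add: velocity_def vector_derivative_works)
qed

lemma velocity_tangent:
  fixes \<gamma> :: "real \<Rightarrow> 'p"
  assumes \<gamma>: "smooth_map std_chart A I X \<gamma>" and t: "t \<in> I" and ntriv: "at t within I \<noteq> bot"
  shows "velocity A I \<gamma> t \<in> tangent_space A (\<gamma> t)"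
  unfolding tangent_space_def
proof (intro CollectI conjI allI impI ballI)
  fix c assume "c \<notin> A \<or> \<gamma> t \<notin> fst c"
  then show "velocity A I \<gamma> t c = 0" by (auto simp: velocity_def)
next
  fix c d assume c: "c \<in> A" and d: "d \<in> A" and "\<gamma> t \<in> fst c \<and> \<gamma> t \<in> fst d"
  then have p: "\<gamma> t \<in> fst c" "\<gamma> t \<in> fst d" by auto
  obtain W k where W: "open W" "t \<in> W" "smooth_on W k" "\<And>s. s \<in> I \<Longrightarrow> s \<in> W \<Longrightarrow> \<gamma> s \<in> fst c \<and> snd c (\<gamma> s) = k s"
    by (rule smooth_map_stdD[OF \<gamma> t c p(1)]) blast
  obtain W' h where h: "local_rep c (\<gamma> t) (snd d) W' h" "\<And>z. z \<in> W' \<inter> chart_image c \<Longrightarrow> param c z \<in> fst d \<and> snd d (param c z) = h z"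
    using transition_local_rep[OF c p(1) d p(2)] by blast
  have kt: "k t = snd c (\<gamma> t)" using W t by auto
  have W': "open W'" "k t \<in> W'" using h kt by (auto simp: local_rep_def)
  define V where "V = W \<inter> k -` W'"
  have V: "open V" "t \<in> V" unfolding V_def
    using smooth_on_continuous_on[OF W(3)] W W' by (auto simp: continuous_on_open_vimage Int_commute)
  have Dh: "(h has_derivative chart_D c (snd d) (\<gamma> t)) (at (k t))"
    using h(1) smooth_on_has_derivative local_rep_derivative[OF c p(1) h(1)] kt unfolding local_rep_def by metis
  have eq: "snd d (\<gamma> s) = h (snd c (\<gamma> s))" if "s \<in> I" "s \<in> V" for s
  proof -
    have "\<gamma> s \<in> fst c" "snd c (\<gamma> s) = k s" "k s \<in> W'" using that W by (auto simp: V_def)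
    then show ?thesis using h(2)[of "snd c (\<gamma> s)"] param_coord[OF c, of "\<gamma> s"]
      by (metis IntI imageI)
  qed
  have "((snd c \<circ> \<gamma>) has_derivative (\<lambda>r. r *\<^sub>R velocity A I \<gamma> t c)) (at t within I)"
    using curve_has_derivative[OF \<gamma> t c p(1) ntriv] by (simp add: has_vector_derivative_def)
  then have "((\<lambda>s. h (snd c (\<gamma> s))) has_derivative (\<lambda>r. chart_D c (snd d) (\<gamma> t) (r *\<^sub>R velocity A I \<gamma> t c))) (at t within I)"
    using has_derivative_compose[of "snd c \<circ> \<gamma>" _ t I h "chart_D c (snd d) (\<gamma> t)"] Dh kt by (simp add: o_def)
  moreover have "linear (chart_D c (snd d) (\<gamma> t))" using Dh has_derivative_linear by blast
  ultimately have "((\<lambda>s. h (snd c (\<gamma> s))) has_vector_derivative chart_D c (snd d) (\<gamma> t) (velocity A I \<gamma> t c)) (at t within I)"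
    by (simp add: has_vector_derivative_def linear_scale)
  then have "((snd d \<circ> \<gamma>) has_vector_derivative chart_D c (snd d) (\<gamma> t) (velocity A I \<gamma> t c)) (at t within I)"
    unfolding has_vector_derivative_def
    by (rule has_derivative_transform_near[OF _ V t]) (use eq in auto)
  then show "velocity A I \<gamma> t d = chart_D c (snd d) (\<gamma> t) (velocity A I \<gamma> t c)"
    using curve_has_derivative[OF \<gamma> t d p(2) ntriv] vector_derivative_unique_within[OF ntriv] by blast
qed

text \<open>Frees \<open>rinner\<close> from the chart picked by \<open>chart_at\<close>: the
  transformation laws of vectors and Gram matrices cancel.\<close>

lemma rinner_chart:
  assumes g: "riemannian_manifold \<Omega> A g" and c: "c \<in> A" "p \<in> fst c"
    and v: "v \<in> tangent_space A p" and w: "w \<in> tangent_space A p"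
  shows "rinner A g p v w = v c \<bullet> (g c p *v w c)"
proof -
  let ?d = "chart_at A p"
  have "?d \<in> A \<and> p \<in> fst ?d"
    unfolding chart_at_def by (rule someI[of "\<lambda>c. c \<in> A \<and> p \<in> fst c", OF conjI[OF c]])
  then have d: "?d \<in> A" "p \<in> fst ?d" by auto
  have "v ?d = chart_D c (snd ?d) p (v c)" "w ?d = chart_D c (snd ?d) p (w c)"
    using v w c d unfolding tangent_space_def by blast+
  moreover have "u \<bullet> (g c p *v u') = chart_D c (snd ?d) p u \<bullet> (g ?d p *v chart_D c (snd ?d) p u')" for u u'
    using g c d unfolding riemannian_manifold_def by blast
  ultimately show ?thesis by (simp add: rinner_def Let_def)
qed

lemma tangent_space_eqI:
  assumes "v \<in> tangent_space A p" "w \<in> tangent_space A p" "c \<in> A" "p \<in> fst c" "v c = w c"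
  shows "v = w"
proof
  fix d
  show "v d = w d"
  proof (cases "d \<in> A \<and> p \<in> fst d")
    case True
    then have "v d = chart_D c (snd d) p (v c)" "w d = chart_D c (snd d) p (w c)"
      using assms unfolding tangent_space_def by blast+
    then show ?thesis using assms(5) by simp
  next
    case False
    then have "v d = 0" "w d = 0" using assms(1,2) unfolding tangent_space_def by blast+
    then show ?thesis by simp
  qed
qed

text \<open>At a boundary point the boundary coordinate along the curve is minimal, so its
  derivative has a sign. With \<open>velocity_outward\<close>, a curve defined on both sides of
  \<open>t\<close> is tangent to the boundary.\<close>

lemma velocity_inward:
  fixes \<gamma> :: "real \<Rightarrow> 'p"
  assumes \<gamma>: "smooth_map std_chart A I X \<gamma>" and t: "{t..<t + e} \<subseteq> I" "e > 0"
    and c: "c \<in> A" "\<gamma> t \<in> fst c" "snd c (\<gamma> t) $ bd_index = 0"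
  shows "0 \<le> velocity A I \<gamma> t c $ bd_index"
proof -
  have tI: "t \<in> I" using t by auto
  obtain W k where W: "open W" "t \<in> W" "\<And>s. s \<in> I \<Longrightarrow> s \<in> W \<Longrightarrow> \<gamma> s \<in> fst c \<and> snd c (\<gamma> s) = k s"
    by (rule smooth_map_stdD[OF \<gamma> tI c(1,2)]) blast
  have "at t within {t..<t + e} \<noteq> bot" using t by (simp add: trivial_limit_within islimpt_Ico)
  then have "at t within I \<noteq> bot" using t(1) at_le[OF t(1)] by (metis bot.extremum_uniqueI)
  from curve_has_derivative[OF \<gamma> tI c(1,2) this]
  have "((\<lambda>s. snd c (\<gamma> s) $ bd_index) has_vector_derivative velocity A I \<gamma> t c $ bd_index) (at t within I)"
    using bounded_linear.has_vector_derivative[OF bounded_linear_vec_nth, of "snd c \<circ> \<gamma>" _ _ bd_index] by (simp add: o_def)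
  then show ?thesis
    by (rule deriv_nonneg_right[OF _ t W(1,2)]) (metis W(3) c(1,3) coord_nonneg)
qed

lemma velocity_outward:
  fixes \<gamma> :: "real \<Rightarrow> 'p"
  assumes \<gamma>: "smooth_map std_chart A I X \<gamma>" and t: "{t - e<..t} \<subseteq> I" "e > 0"
    and c: "c \<in> A" "\<gamma> t \<in> fst c" "snd c (\<gamma> t) $ bd_index = 0"
  shows "velocity A I \<gamma> t c $ bd_index \<le> 0"
proof -
  have tI: "t \<in> I" using t by auto
  obtain W k where W: "open W" "t \<in> W" "\<And>s. s \<in> I \<Longrightarrow> s \<in> W \<Longrightarrow> \<gamma> s \<in> fst c \<and> snd c (\<gamma> s) = k s"
    by (rule smooth_map_stdD[OF \<gamma> tI c(1,2)]) blast
  have "at t within {t - e<..t} \<noteq> bot" using t by (simp add: trivial_limit_within islimpt_Ioc)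
  then have "at t within I \<noteq> bot" using t(1) at_le[OF t(1)] by (metis bot.extremum_uniqueI)
  from curve_has_derivative[OF \<gamma> tI c(1,2) this]
  have "((\<lambda>s. snd c (\<gamma> s) $ bd_index) has_vector_derivative velocity A I \<gamma> t c $ bd_index) (at t within I)"
    using bounded_linear.has_vector_derivative[OF bounded_linear_vec_nth, of "snd c \<circ> \<gamma>" _ _ bd_index] by (simp add: o_def)
  then show ?thesis
    by (rule deriv_nonpos_left[OF _ t W(1,2)]) (metis W(3) c(1,3) coord_nonneg)
qed

end

section \<open>The normal exponential map of a tube\<close>

lemma positive_definite_solve:
  fixes G :: "real ^ 'm::finite ^ 'm"
  assumes "\<And>u. u \<noteq> 0 \<Longrightarrow> 0 < u \<bullet> (G *v u)"
  obtains w where "G *v w = b"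
proof -
  have lin: "linear ((*v) G)" by simp
  have "inj ((*v) G)"
    unfolding linear_injective_0[OF lin] using assms by fastforce
  then have "surj ((*v) G)" using lin linear_injective_imp_surjective by blast
  then show ?thesis using that by (metis surjD)
qed

text \<open>A weak inverse function theorem for a derivative known at one point only: strict
  inequalities on both sides of 0 and the intermediate value theorem give a neighbourhood of values,
  without injectivity.\<close>

lemma derivative_nonzero_covers:
  fixes f :: "real \<Rightarrow> real"
  assumes cont: "continuous_on {-e<..<e} f" and D: "(f has_vector_derivative l) (at 0)" "l \<noteq> 0" and e: "e > 0"
  obtains \<eta> where "\<eta> > 0" "\<And>t. \<bar>t - f 0\<bar> < \<eta> \<Longrightarrow> \<exists>s. \<bar>s\<bar> < e \<and> f s = t"
proof -
  have *: "\<exists>\<eta>>0. \<forall>t. \<bar>t - f 0\<bar> < \<eta> \<longrightarrow> (\<exists>s. \<bar>s\<bar> < e \<and> f s = t)"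
    if cont: "continuous_on {-e<..<e} f" and D: "(f has_real_derivative l) (at 0)" "l > 0"
    for f :: "real \<Rightarrow> real" and l
  proof -
    obtain d where d: "d > 0" "\<And>h. 0 < h \<Longrightarrow> h < d \<Longrightarrow> f 0 < f h"
      using DERIV_pos_inc_right[OF D] by auto
    obtain d' where d': "d' > 0" "\<And>h. 0 < h \<Longrightarrow> h < d' \<Longrightarrow> f (- h) < f 0"
      using DERIV_pos_inc_left[OF D] by auto
    define h where "h = min (min d d') e / 2"
    have h: "h > 0" "h < d" "h < d'" "h < e" using d d' e by (auto simp: h_def)
    have c: "continuous_on {- h..h} f" by (rule continuous_on_subset[OF cont]) (use h in auto)
    define \<eta> where "\<eta> = min (f h - f 0) (f 0 - f (- h))"
    have "\<exists>s. \<bar>s\<bar> < e \<and> f s = t" if "\<bar>t - f 0\<bar> < \<eta>" for t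
    proof -
      have "f (- h) \<le> t" "t \<le> f h" using that unfolding \<eta>_def by linarith+
      then obtain s where "- h \<le> s" "s \<le> h" "f s = t" using IVT'[of f "- h" t h] c h by auto
      then show ?thesis using h by (intro exI[of _ s]) auto
    qed
    moreover have "\<eta> > 0" using d d' h by (auto simp: \<eta>_def)
    ultimately show ?thesis by blast
  qed
  show ?thesis
  proof (cases "l > 0")
    case True
    then show ?thesis using *[OF cont _ True] D that
      unfolding has_real_derivative_iff_has_vector_derivative by blast
  next
    case False
    have "continuous_on {-e<..<e} (\<lambda>s. - f s)" using cont by (intro continuous_intros)
    moreover have "((\<lambda>s. - f s) has_real_derivative - l) (at 0)"
      using D by (auto simp: has_real_derivative_iff_has_vector_derivative intro: has_vector_derivative_minus)
    ultimately obtain \<eta> where "\<eta> > 0" "\<And>t. \<bar>t + f 0\<bar> < \<eta> \<Longrightarrow> \<exists>s. \<bar>s\<bar> < e \<and> - f s = t"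
      using *[of "\<lambda>s. - f s" "- l"] False D(2) by fastforce
    then show ?thesis
      by (intro that[of \<eta>]) (metis abs_minus_commute add.commute add.inverse_inverse diff_minus_eq_add minus_diff_eq)+
  qed
qed

section \<open>The normal exponential map in bundle coordinates\<close>

locale tube = manifold \<Omega> A for \<Omega> :: "'p::t2_space set" and A :: "('p, real ^ 'm::finite) chart set" +
  fixes g :: "('p, 'm) metric" and P :: "'p set" and R :: real and E :: "real \<times> 'p \<times> ('p, 'm) tvec \<Rightarrow> 'p"
  assumes riem: "riemannian_manifold \<Omega> A g" and compact: "compact \<Omega>"
    and P: "P \<subseteq> \<Omega>" "compact P" and R: "0 < R"
    and exp: "\<And>r p \<nu>. r \<in> {0<..R} \<Longrightarrow> (p, \<nu>) \<in> unit_normal_bundle A g P \<Longrightarrow>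
        is_exp \<Omega> A g p (\<lambda>c. r *\<^sub>R \<nu> c) (E (r, p, \<nu>))"
    and diffeo: "diffeo (bundle_charts A) A ({0<..R} \<times> unit_normal_bundle A g P) (\<Omega> - P) E"
begin

abbreviation (input) U where "U \<equiv> unit_normal_bundle A g P"

definition bundle_chart :: "('p, real ^ 'm) chart \<Rightarrow> (real \<times> 'p \<times> ('p, 'm) tvec, real \<times> (real ^ 'm) \<times> (real ^ 'm)) chart" where
  "bundle_chart c = ({(r, p, v). p \<in> fst c}, \<lambda>(r, p, v). (r, snd c p, v c))"

lemma bundle_chart_in: "c \<in> A \<Longrightarrow> bundle_chart c \<in> bundle_charts A"
  by (auto simp: bundle_charts_def bundle_chart_def)

lemma bundle_chart_simps [simp]:
  "(r, p, v) \<in> fst (bundle_chart c) \<longleftrightarrow> p \<in> fst c"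
  "snd (bundle_chart c) (r, p, v) = (r, snd c p, v c)"
  by (auto simp: bundle_chart_def)

definition E' :: "'p \<Rightarrow> real \<times> 'p \<times> ('p, 'm) tvec" where
  "E' = inv_into ({0<..R} \<times> U) E"

lemma E_bij: "bij_betw E ({0<..R} \<times> U) (\<Omega> - P)"
  and E_smooth: "smooth_map (bundle_charts A) A ({0<..R} \<times> U) (\<Omega> - P) E"
  and E'_smooth: "smooth_map A (bundle_charts A) (\<Omega> - P) ({0<..R} \<times> U) E'"
  using diffeo unfolding diffeo_def E'_def by auto

lemma E_in: "r \<in> {0<..R} \<Longrightarrow> (p, \<nu>) \<in> U \<Longrightarrow> E (r, p, \<nu>) \<in> \<Omega> - P"
  using E_bij unfolding bij_betw_def by blast

lemma E'_E: "r \<in> {0<..R} \<Longrightarrow> (p, \<nu>) \<in> U \<Longrightarrow> E' (E (r, p, \<nu>)) = (r, p, \<nu>)"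
  using E_bij by (simp add: E'_def bij_betw_inv_into_left)

lemma E_E': "q \<in> \<Omega> - P \<Longrightarrow> E (E' q) = q"
  using E_bij by (simp add: E'_def bij_betw_inv_into_right)

lemma E'_in:
  assumes "q \<in> \<Omega> - P"
  obtains r p \<nu> where "E' q = (r, p, \<nu>)" "r \<in> {0<..R}" "(p, \<nu>) \<in> U" "E (r, p, \<nu>) = q"
proof -
  have "E' q \<in> {0<..R} \<times> U"
    using bij_betw_apply[OF bij_betw_inv_into[OF E_bij] assms] by (simp add: E'_def)
  moreover obtain r p \<nu> where eq: "E' q = (r, p, \<nu>)" by (rule prod_cases3)
  ultimately show ?thesis using that[OF eq] E_E'[OF assms] by (simp only: eq mem_Times_iff fst_conv snd_conv)
qed

lemma normal_foot: "(p, \<nu>) \<in> U \<Longrightarrow> p \<in> P" "(p, \<nu>) \<in> U \<Longrightarrow> \<nu> \<in> tangent_space A p"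
  by (auto simp: unit_normal_bundle_def)

lemma open_complement: "openin (top_of_set \<Omega>) (\<Omega> - P)"
  using P compact by (simp add: openin_diff closed_subset compact_imp_closed)

text \<open>Continuity is expressed through the coordinates \<open>(r, snd c p, \<nu> c)\<close>,
  since these are what the smoothness of \<open>E\<close> refers to on the bundle.\<close>

lemma E_continuous:
  assumes \<xi>: "(p, \<nu>) \<in> U" and r: "r \<in> {0<..R}" and N: "openin (top_of_set \<Omega>) N" "E (r, p, \<nu>) \<in> N"
    and c: "c \<in> A" "p \<in> fst c"
  obtains e where "e > 0" "\<And>s p' \<nu>'. s \<in> {0<..R} \<Longrightarrow> (p', \<nu>') \<in> U \<Longrightarrow> p' \<in> fst c \<Longrightarrow>
    dist (s, snd c p', \<nu>' c) (r, snd c p, \<nu> c) < e \<Longrightarrow> E (s, p', \<nu>') \<in> N"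
proof -
  obtain d where d: "d \<in> A" "E (r, p, \<nu>) \<in> fst d" using E_in[OF r \<xi>] chart_exists by blast
  obtain e where e: "e > 0" "\<And>z. z \<in> half_space \<Longrightarrow> dist z (snd d (E (r, p, \<nu>))) < e \<Longrightarrow> z \<in> chart_image d \<and> param d z \<in> N"
    using chart_nbhd[OF d N] by metis
  have "(r, p, \<nu>) \<in> {0<..R} \<times> U" using r \<xi> by auto
  then obtain W k where W: "open W" "(r, snd c p, \<nu> c) \<in> W" "smooth_on W k"
    "\<And>z. z \<in> ({0<..R} \<times> U) \<inter> fst (bundle_chart c) \<Longrightarrow> snd (bundle_chart c) z \<in> W \<Longrightarrow>
       E z \<in> fst d \<and> snd d (E z) = k (snd (bundle_chart c) z)"
    using E_smooth bundle_chart_in[OF c(1)] d c(2) bundle_chart_simps unfolding smooth_map_def by metis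
  have k0: "k (r, snd c p, \<nu> c) = snd d (E (r, p, \<nu>))"
    using W(4)[of "(r, p, \<nu>)"] W(2) r \<xi> c by (simp add: bundle_chart_simps)
  have "open (W \<inter> k -` ball (snd d (E (r, p, \<nu>))) e)"
    using smooth_on_continuous_on[OF W(3)] W(1) by (simp add: continuous_on_open_vimage Int_commute)
  moreover have "(r, snd c p, \<nu> c) \<in> W \<inter> k -` ball (snd d (E (r, p, \<nu>))) e" using W k0 e by auto
  ultimately obtain b where b: "b > 0" "ball (r, snd c p, \<nu> c) b \<subseteq> W \<inter> k -` ball (snd d (E (r, p, \<nu>))) e"
    using openE by blast
  show ?thesis
  proof (rule that[OF b(1)])
    fix s p' \<nu>' assume s: "s \<in> {0<..R}" "(p', \<nu>') \<in> U" "p' \<in> fst c" "dist (s, snd c p', \<nu>' c) (r, snd c p, \<nu> c) < b"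
    then have "(s, snd c p', \<nu>' c) \<in> ball (r, snd c p, \<nu> c) b" by (metis mem_ball dist_commute)
    then have "(s, snd c p', \<nu>' c) \<in> W \<inter> k -` ball (snd d (E (r, p, \<nu>))) e" using b(2) by blast
    then have in_W: "(s, snd c p', \<nu>' c) \<in> W" "dist (k (s, snd c p', \<nu>' c)) (snd d (E (r, p, \<nu>))) < e"
      by (simp_all add: dist_commute)
    then have E: "E (s, p', \<nu>') \<in> fst d" "snd d (E (s, p', \<nu>')) = k (s, snd c p', \<nu>' c)"
      using W(4)[of "(s, p', \<nu>')"] s by (auto simp: bundle_chart_simps)
    then have "snd d (E (s, p', \<nu>')) \<in> half_space" using coord_nonneg[OF d(1) E(1)] unfolding half_space_def by blast
    then show "E (s, p', \<nu>') \<in> N" using e(2) in_W(2) E param_coord[OF d(1) E(1)] by metis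
  qed
qed

lemma E'_local_rep:
  assumes q: "q \<in> \<Omega> - P" "E' q = (r, p, \<nu>)" and c: "c \<in> A" "p \<in> fst c" and d: "d \<in> A" "q \<in> fst d"
  obtains W k where "local_rep d q (\<lambda>q. snd (bundle_chart c) (E' q)) W k"
    "\<And>z. z \<in> W \<inter> chart_image d \<Longrightarrow> param d z \<in> \<Omega> - P \<and> E' (param d z) \<in> fst (bundle_chart c) \<and>
       snd (bundle_chart c) (E' (param d z)) = k z"
  using smooth_map_local_rep[OF E'_smooth open_complement q(1) d bundle_chart_in[OF c(1)]] q c
  by (metis bundle_chart_simps(1))

lemma E'_continuous:
  assumes q: "q \<in> \<Omega> - P" "E' q = (r, p, \<nu>)" and c: "c \<in> A" "p \<in> fst c" and e: "e > 0"
  obtains N where "openin (top_of_set \<Omega>) N" "q \<in> N" "N \<subseteq> \<Omega> - P"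
    "\<And>q' r' p' \<nu>'. q' \<in> N \<Longrightarrow> E' q' = (r', p', \<nu>') \<Longrightarrow> p' \<in> fst c \<and> dist (r', snd c p', \<nu>' c) (r, snd c p, \<nu> c) < e"
proof -
  obtain d where d: "d \<in> A" "q \<in> fst d" using q chart_exists by blast
  obtain W k where k: "local_rep d q (\<lambda>q. snd (bundle_chart c) (E' q)) W k"
    "\<And>z. z \<in> W \<inter> chart_image d \<Longrightarrow> param d z \<in> \<Omega> - P \<and> E' (param d z) \<in> fst (bundle_chart c) \<and>
       snd (bundle_chart c) (E' (param d z)) = k z"
    using E'_local_rep[OF q c d] by metis
  have W: "open W" "snd d q \<in> W" "smooth_on W k" using k(1) by (auto simp: local_rep_def)
  have kq: "k (snd d q) = (r, snd c p, \<nu> c)"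
    using local_rep_at(2)[OF d W(2) k(1)] q by (simp add: bundle_chart_simps)
  define V where "V = W \<inter> k -` ball (r, snd c p, \<nu> c) e"
  have V: "open V" unfolding V_def
    using smooth_on_continuous_on[OF W(3)] W(1) by (simp add: continuous_on_open_vimage Int_commute)
  have main: "q' \<in> \<Omega> - P \<and> (\<forall>r' p' \<nu>'. E' q' = (r', p', \<nu>') \<longrightarrow> p' \<in> fst c \<and> dist (r', snd c p', \<nu>' c) (r, snd c p, \<nu> c) < e)"
    if "q' \<in> {q' \<in> fst d. snd d q' \<in> V}" for q'
  proof -
    have "snd d q' \<in> W \<inter> chart_image d" "dist (k (snd d q')) (r, snd c p, \<nu> c) < e" "param d (snd d q') = q'"
      using that param_coord[OF d(1)] by (auto simp: V_def dist_commute)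
    then show ?thesis using k(2)[of "snd d q'"] by auto
  qed
  show ?thesis
  proof (rule that[of "{q' \<in> fst d. snd d q' \<in> V}"])
    show "openin (top_of_set \<Omega>) {q' \<in> fst d. snd d q' \<in> V}" using coord_preimage_open[OF d(1) V] .
    show "q \<in> {q' \<in> fst d. snd d q' \<in> V}" using d W kq e by (auto simp: V_def)
  qed (use main in blast)+
qed

lemma ray_derivative:
  assumes \<xi>: "(p, \<nu>) \<in> U" and r: "r \<in> {0<..R}" and d: "d \<in> A" "E (r, p, \<nu>) \<in> fst d"
  obtains w W where "((\<lambda>s. snd d (E (s, p, \<nu>))) has_vector_derivative w) (at r within {0<..R})"
    "open W" "r \<in> W" "\<And>s. s \<in> {0<..R} \<Longrightarrow> s \<in> W \<Longrightarrow> E (s, p, \<nu>) \<in> fst d"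
proof -
  obtain c where c: "c \<in> A" "p \<in> fst c" using \<xi> normal_foot P chart_exists by blast
  have "(r, p, \<nu>) \<in> {0<..R} \<times> U" using r \<xi> by auto
  then obtain W k where W: "open W" "(r, snd c p, \<nu> c) \<in> W" "smooth_on W k"
    "\<And>z. z \<in> ({0<..R} \<times> U) \<inter> fst (bundle_chart c) \<Longrightarrow> snd (bundle_chart c) z \<in> W \<Longrightarrow>
       E z \<in> fst d \<and> snd d (E z) = k (snd (bundle_chart c) z)"
    using E_smooth bundle_chart_in[OF c(1)] d c(2) bundle_chart_simps unfolding smooth_map_def by metis
  define V where "V = (\<lambda>s. (s, snd c p, \<nu> c)) -` W"
  have V: "open V" "r \<in> V" unfolding V_def using W by (auto intro!: open_vimage continuous_intros)
  have eq: "E (s, p, \<nu>) \<in> fst d" "snd d (E (s, p, \<nu>)) = k (s, snd c p, \<nu> c)" if "s \<in> {0<..R}" "s \<in> V" for s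
    using W(4)[of "(s, p, \<nu>)"] that \<xi> c by (auto simp: bundle_chart_simps V_def)
  have "((\<lambda>s. (s, snd c p, \<nu> c)) has_derivative (\<lambda>h. (h, 0, 0))) (at r)"
    by (auto intro!: derivative_eq_intros simp: zero_prod_def)
  from diff_chain_at[OF this smooth_on_has_derivative[OF W(3,2)]]
  have "((\<lambda>s. k (s, snd c p, \<nu> c)) has_derivative (\<lambda>h. frechet_derivative k (at (r, snd c p, \<nu> c)) (h, 0, 0))) (at r within {0<..R})"
    by (simp add: o_def has_derivative_at_withinI)
  then have "((\<lambda>s. snd d (E (s, p, \<nu>))) has_derivative (\<lambda>h. frechet_derivative k (at (r, snd c p, \<nu> c)) (h, 0, 0))) (at r within {0<..R})"
    by (rule has_derivative_transform_near[OF _ V r]) (use eq in auto)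
  then have "(\<lambda>s. snd d (E (s, p, \<nu>))) differentiable (at r within {0<..R})" unfolding differentiable_def by blast
  then show ?thesis using that[OF _ V] eq(1) vector_derivative_works by blast
qed

lemma ray_within_nontrivial: "r \<in> {0<..R} \<Longrightarrow> at r within {0<..R} \<noteq> bot"
  using R by (simp add: trivial_limit_within islimpt_Ioc)

text \<open>Along a ray the inverse \<open>E'\<close> changes the radius alone, at unit speed. The
  nonzero radial component later rules out critical points of the radius.\<close>

lemma E'_derivative_ray:
  assumes \<xi>: "(p, \<nu>) \<in> U" and r: "r \<in> {0<..R}" and d: "d \<in> A" "E (r, p, \<nu>) \<in> fst d" and c: "c \<in> A" "p \<in> fst c"
    and w: "((\<lambda>s. snd d (E (s, p, \<nu>))) has_vector_derivative w) (at r within {0<..R})"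
    and k: "local_rep d (E (r, p, \<nu>)) (\<lambda>q. snd (bundle_chart c) (E' q)) W k"
  shows "frechet_derivative k (at (snd d (E (r, p, \<nu>)))) w = (1, 0, 0)"
proof -
  let ?y = "\<lambda>s. snd d (E (s, p, \<nu>))"
  have W: "open W" "?y r \<in> W" "smooth_on W k" "\<And>z. z \<in> W \<inter> chart_image d \<Longrightarrow> snd (bundle_chart c) (E' (param d z)) = k z"
    using k by (auto simp: local_rep_def)
  obtain V where V: "open V" "r \<in> V" "\<And>s. s \<in> {0<..R} \<Longrightarrow> s \<in> V \<Longrightarrow> E (s, p, \<nu>) \<in> fst d"
    using ray_derivative[OF \<xi> r d] by metis
  have Dk: "(k has_derivative frechet_derivative k (at (?y r))) (at (?y r))"
    using smooth_on_has_derivative[OF W(3,2)] .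
  have comp: "((\<lambda>s. k (?y s)) has_derivative (\<lambda>h. frechet_derivative k (at (?y r)) (h *\<^sub>R w))) (at r within {0<..R})"
    using has_derivative_compose[OF w[unfolded has_vector_derivative_def] Dk] .
  have "continuous (at r within {0<..R}) ?y" using w has_vector_derivative_continuous by blast
  then have "\<forall>\<^sub>F s in at r within {0<..R}. ?y s \<in> W"
    using W(1,2) by (simp add: continuous_within tendsto_def)
  moreover have "\<forall>\<^sub>F s in at r within {0<..R}. s \<in> V \<inter> {0<..R}"
    using V(1,2) by (auto simp: eventually_at_topological)
  ultimately have ev: "\<forall>\<^sub>F s in at r within {0<..R}. k (?y s) = (s, snd c p, \<nu> c)"
  proof eventually_elim
    case (elim s)
    then have "E (s, p, \<nu>) \<in> fst d" using V by auto
    then have "k (?y s) = snd (bundle_chart c) (E' (E (s, p, \<nu>)))" using W(4)[of "?y s"] elim param_coord[OF d(1)] by auto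
    then show ?case using E'_E[OF _ \<xi>] elim bundle_chart_simps by auto
  qed
  have eqr: "k (?y r) = (r, snd c p, \<nu> c)"
    using W(4)[of "?y r"] W(2) d param_coord[OF d] E'_E[OF r \<xi>] bundle_chart_simps by auto
  have "((\<lambda>s. (s, snd c p, \<nu> c)) has_derivative (\<lambda>h. frechet_derivative k (at (?y r)) (h *\<^sub>R w))) (at r within {0<..R})"
    using has_derivative_transform_eventually[OF comp ev eqr r] .
  moreover have "linear (frechet_derivative k (at (?y r)))" using Dk has_derivative_linear by blast
  ultimately have "((\<lambda>s. (s, snd c p, \<nu> c)) has_vector_derivative frechet_derivative k (at (?y r)) w) (at r within {0<..R})"
    by (simp add: has_vector_derivative_def linear_scale)
  moreover have "((\<lambda>s. (s, snd c p, \<nu> c)) has_vector_derivative (1, 0, 0)) (at r within {0<..R})"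
    unfolding has_vector_derivative_def by (auto intro!: derivative_eq_intros simp: zero_prod_def)
  ultimately show ?thesis
    using vector_derivative_unique_within[OF ray_within_nontrivial[OF r]] by blast
qed

text \<open>At a boundary point of \<open>P\<close>, curves in \<open>P\<close> run on both sides of
  the point and are therefore tangent to the boundary, so the outward unit normal of the boundary
  belongs to \<open>U\<close>. The geodesic that \<open>exp\<close> provides in that direction would
  have to leave \<Omega>.\<close>

lemma foot_interior: "P \<inter> mfd_boundary \<Omega> A = {}"
proof (rule ccontr)
  assume "P \<inter> mfd_boundary \<Omega> A \<noteq> {}"
  then obtain p c where p: "p \<in> P" and c: "c \<in> A" "p \<in> fst c" and bd: "snd c p $ bd_index = 0"
    unfolding mfd_boundary_def by blast
  let ?G = "g c p"
  have posd: "\<And>u. u \<noteq> 0 \<Longrightarrow> 0 < u \<bullet> (?G *v u)" and sym: "transpose ?G = ?G"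
    using riem c unfolding riemannian_manifold_def by blast+
  \<comment> \<open>\<open>w\<close> is the metric gradient of the boundary coordinate, so
    orthogonality to \<open>w\<close> means that the boundary coordinate vanishes; \<open>u\<close>
    below is its outward unit multiple.\<close>
  obtain w where w: "?G *v w = axis bd_index 1" using positive_definite_solve[OF posd] by metis
  have w0: "w \<noteq> 0"
  proof
    assume "w = 0"
    then have "axis bd_index 1 = (0 :: real ^ 'm)" using w by simp
    then show False by (simp add: axis_eq_0_iff)
  qed
  define N where "N = w \<bullet> (?G *v w)"
  have N: "N > 0" "N = w $ bd_index" using posd[OF w0] w by (auto simp: N_def inner_axis)
  define u where "u = (- 1 / sqrt N) *\<^sub>R w"
  have Gu: "?G *v u = (- 1 / sqrt N) *\<^sub>R axis bd_index 1"
    unfolding u_def matrix_vector_mult_scaleR w ..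
  have uu: "u \<bullet> (?G *v u) = 1"
    unfolding Gu using N by (simp add: u_def inner_axis real_sqrt_mult_self)
  have ubd: "u $ bd_index < 0" using N by (simp add: u_def)
  define \<nu> where "\<nu> = tangent_vector c p u"
  have \<nu>: "\<nu> \<in> tangent_space A p" "\<nu> c = u" using tangent_vector[OF c] by (auto simp: \<nu>_def)
  have "(p, \<nu>) \<in> U"
    unfolding unit_normal_bundle_def
  proof (clarsimp simp: p \<nu>, intro conjI ballI)
    show "rinner A g p \<nu> \<nu> = 1" using rinner_chart[OF riem c \<nu>(1) \<nu>(1)] \<nu> uu by simp
  next
    fix w' assume "w' \<in> sub_tangent A P p"
    then obtain \<gamma> where \<gamma>: "smooth_map std_chart A {-1<..<1} P \<gamma>" "\<gamma> 0 = p" "w' = velocity A {-1<..<1} \<gamma> 0"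
      unfolding sub_tangent_def by blast
    have "0 \<le> w' c $ bd_index"
      using velocity_inward[OF \<gamma>(1), of 0 1 c] \<gamma> c bd by (simp add: subset_iff)
    moreover have "w' c $ bd_index \<le> 0"
      using velocity_outward[OF \<gamma>(1), of 0 1 c] \<gamma> c bd by (simp add: subset_iff)
    ultimately have w'0: "w' c $ bd_index = 0" by simp
    have "at 0 within {-1<..<1::real} \<noteq> bot" using at_within_open[of 0 "{-1<..<1::real}"] by simp
    then have "velocity A {-1<..<1} \<gamma> 0 \<in> tangent_space A (\<gamma> 0)"
      by (intro velocity_tangent[OF \<gamma>(1)]) simp_all
    then have w't: "w' \<in> tangent_space A p" by (simp only: \<gamma>(2,3))
    have "u \<bullet> (?G *v w' c) = (?G *v u) \<bullet> w' c"
      using dot_lmul_matrix[of u ?G "w' c"] transpose_matrix_vector[of ?G u] sym by simp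
    also have "\<dots> = 0" unfolding Gu using w'0 by (simp add: inner_axis inner_commute)
    finally show "rinner A g p \<nu> w' = 0" using rinner_chart[OF riem c \<nu>(1) w't] \<nu> by simp
  qed
  then have "is_exp \<Omega> A g p (\<lambda>c. R *\<^sub>R \<nu> c) (E (R, p, \<nu>))" using exp R by simp
  then obtain \<gamma> where \<gamma>: "smooth_map std_chart A {0..1} \<Omega> \<gamma>" "\<gamma> 0 = p" "velocity A {0..1} \<gamma> 0 = (\<lambda>c. R *\<^sub>R \<nu> c)"
    unfolding is_exp_def geodesic_def by blast
  have "0 \<le> (R *\<^sub>R \<nu> c) $ bd_index"
    using velocity_inward[OF \<gamma>(1), of 0 1 c] \<gamma> c bd by (simp add: subset_iff)
  then show False using ubd R \<nu> by (simp add: zero_le_mult_iff)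
qed

text \<open>At an interior point the radius, which never exceeds \<open>R\<close>, would have a
  maximum on a full coordinate ball and hence a vanishing differential, while it grows at unit speed
  along the ray.\<close>

lemma outer_end_in_boundary:
  assumes \<xi>: "(p, \<nu>) \<in> U"
  shows "E (R, p, \<nu>) \<in> mfd_boundary \<Omega> A"
proof (rule ccontr)
  assume nb: "E (R, p, \<nu>) \<notin> mfd_boundary \<Omega> A"
  have RR: "R \<in> {0<..R}" using R by simp
  let ?q = "E (R, p, \<nu>)"
  have q: "?q \<in> \<Omega> - P" "E' ?q = (R, p, \<nu>)" using E_in[OF RR \<xi>] E'_E[OF RR \<xi>] by auto
  obtain d where d: "d \<in> A" "?q \<in> fst d" using q chart_exists by blast
  obtain c where c: "c \<in> A" "p \<in> fst c" using \<xi> normal_foot P chart_exists by blast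
  have pos: "snd d ?q $ bd_index > 0" using nb mfd_boundary_iff[OF d] coord_nonneg[OF d] by auto
  obtain W k where k: "local_rep d ?q (\<lambda>q. snd (bundle_chart c) (E' q)) W k"
    "\<And>z. z \<in> W \<inter> chart_image d \<Longrightarrow> param d z \<in> \<Omega> - P \<and> E' (param d z) \<in> fst (bundle_chart c) \<and>
       snd (bundle_chart c) (E' (param d z)) = k z"
    using E'_local_rep[OF q c d] by metis
  have W: "open W" "snd d ?q \<in> W" "smooth_on W k" using k(1) by (auto simp: local_rep_def)
  obtain e where e: "e > 0" "ball (snd d ?q) e \<subseteq> chart_image d"
    using interior_chart_ball[OF d pos open_complement q(1)] by metis
  obtain w where w: "((\<lambda>s. snd d (E (s, p, \<nu>))) has_vector_derivative w) (at R within {0<..R})"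
    using ray_derivative[OF \<xi> RR d] by metis
  have Dk: "((\<lambda>z. fst (k z)) has_derivative (\<lambda>h. fst (frechet_derivative k (at (snd d ?q)) h))) (at (snd d ?q))"
    using has_derivative_fst[OF smooth_on_has_derivative[OF W(3,2)]] .
  have "(\<lambda>h. fst (frechet_derivative k (at (snd d ?q)) h)) = (\<lambda>h. 0)"
  proof (rule differential_zero_maxmin[OF _ _ Dk])
    show "snd d ?q \<in> W \<inter> ball (snd d ?q) e" "open (W \<inter> ball (snd d ?q) e)" using W e by auto
    have "fst (k (snd d ?q)) = R"
      using local_rep_at(2)[OF d W(2) k(1)] q bundle_chart_simps by (metis fst_conv)
    moreover have "fst (k z) \<le> R" if "z \<in> W \<inter> ball (snd d ?q) e" for z
    proof -
      have z: "param d z \<in> \<Omega> - P" "snd (bundle_chart c) (E' (param d z)) = k z" using k(2) that e by auto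
      obtain r p' \<nu>' where "E' (param d z) = (r, p', \<nu>')" "r \<in> {0<..R}" using E'_in[OF z(1)] by metis
      then show ?thesis using z(2) bundle_chart_simps by (metis fst_conv greaterThanAtMost_iff)
    qed
    ultimately show "(\<forall>y\<in>W \<inter> ball (snd d ?q) e. fst (k y) \<le> fst (k (snd d ?q))) \<or>
        (\<forall>y\<in>W \<inter> ball (snd d ?q) e. fst (k (snd d ?q)) \<le> fst (k y))" by simp
  qed
  moreover have "frechet_derivative k (at (snd d ?q)) w = (1, 0, 0)"
    using E'_derivative_ray[OF \<xi> RR d c w k(1)] .
  ultimately show False by (metis fst_conv zero_neq_one)
qed

end

lemma continuous_on_openinI:
  assumes "\<And>x B. x \<in> S \<Longrightarrow> open B \<Longrightarrow> f x \<in> B \<Longrightarrow> \<exists>N. openin (top_of_set S) N \<and> x \<in> N \<and> f ` N \<subseteq> B"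
  shows "continuous_on S f"
  unfolding continuous_on_topological
proof (intro ballI allI impI)
  fix x B assume "x \<in> S" "open B" "f x \<in> B"
  then obtain N where N: "openin (top_of_set S) N" "x \<in> N" "f ` N \<subseteq> B" using assms by blast
  then obtain T where "open T" "N = S \<inter> T" unfolding openin_open by blast
  then show "\<exists>A. open A \<and> x \<in> A \<and> (\<forall>y\<in>S. y \<in> A \<longrightarrow> f y \<in> B)" using N by blast
qed

context tube
begin

lemma boundary_in_complement: "mfd_boundary \<Omega> A \<subseteq> \<Omega> - P"
  using foot_interior by (auto simp: mfd_boundary_def)

text \<open>A ray touching the boundary before its end is tangent to it, so along the boundary the
  footpoint and the normal are stationary: near the contact point, the boundary is the ray.\<close>

lemma boundary_ray_open:
  assumes j: "(UNIV :: 'm set) = {bd_index, j}" "j \<noteq> bd_index"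
    and \<xi>: "(p, \<nu>) \<in> U" and t0: "t0 \<in> {0<..<R}" "E (t0, p, \<nu>) \<in> mfd_boundary \<Omega> A"
  obtains \<eta> where "\<eta> > 0" "\<And>t. \<bar>t - t0\<bar> < \<eta> \<Longrightarrow> t \<in> {0<..<R} \<and> E (t, p, \<nu>) \<in> mfd_boundary \<Omega> A"
proof -
  let ?q = "E (t0, p, \<nu>)" and ?e2 = "axis j 1 :: real ^ 'm"
  have t0R: "t0 \<in> {0<..R}" using t0 by auto
  have q: "?q \<in> \<Omega> - P" "E' ?q = (t0, p, \<nu>)" using E_in[OF t0R \<xi>] E'_E[OF t0R \<xi>] by auto
  obtain d where d: "d \<in> A" "?q \<in> fst d" using q chart_exists by blast
  obtain c where c: "c \<in> A" "p \<in> fst c" using \<xi> normal_foot P chart_exists by blast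
  have x0: "snd d ?q $ bd_index = 0" using t0 mfd_boundary_iff[OF d] by blast
  obtain W k where k: "local_rep d ?q (\<lambda>q. snd (bundle_chart c) (E' q)) W k"
    "\<And>z. z \<in> W \<inter> chart_image d \<Longrightarrow> param d z \<in> \<Omega> - P \<and> E' (param d z) \<in> fst (bundle_chart c) \<and>
       snd (bundle_chart c) (E' (param d z)) = k z"
    using E'_local_rep[OF q c d] by metis
  have W: "open W" "snd d ?q \<in> W" "smooth_on W k" using k(1) by (auto simp: local_rep_def)
  have k0: "k (snd d ?q) = (t0, snd c p, \<nu> c)" using local_rep_at(2)[OF d W(2) k(1)] q by simp
  \<comment> \<open>On \<open>V\<close> the radius stays below \<open>R\<close>. Every nearby
    contact time then has room on both sides, so the boundary coordinate along the ray has a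
    two-sided minimum.\<close>
  define V where "V = W \<inter> (\<lambda>z. fst (k z)) -` {..<R}"
  have "open V" unfolding V_def
    using continuous_on_fst[OF smooth_on_continuous_on[OF W(3)]] W(1)
    by (simp add: continuous_on_open_vimage Int_commute)
  moreover have "snd d ?q \<in> V" using W(2) k0 t0 by (simp add: V_def)
  ultimately obtain e1 where e1: "e1 > 0" "ball (snd d ?q) e1 \<subseteq> V" using openE by blast
  obtain e2 where e2: "e2 > 0" "\<And>z. z \<in> half_space \<Longrightarrow> dist z (snd d ?q) < e2 \<Longrightarrow> z \<in> chart_image d \<and> param d z \<in> \<Omega> - P"
    using chart_nbhd[OF d open_complement q(1)] by metis
  define e where "e = min e1 e2"
  have e: "e > 0" using e1 e2 by (simp add: e_def)
  \<comment> \<open>In dimension two the boundary near \<open>?q\<close> is the coordinate line in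
    direction \<open>j\<close>.\<close>
  define x where "x s = snd d ?q + s *\<^sub>R ?e2" for s
  have xbd: "x s $ bd_index = 0" for s using x0 j by (simp add: x_def axis_def)
  have xd: "dist (x s) (snd d ?q) = \<bar>s\<bar>" for s by (simp add: x_def dist_norm)
  have xV: "x s \<in> W" "fst (k (x s)) < R" if "\<bar>s\<bar> < e" for s
  proof -
    have "x s \<in> ball (snd d ?q) e1" using xd[of s] that by (simp add: e_def dist_commute)
    then show "x s \<in> W" "fst (k (x s)) < R" using e1 by (auto simp: V_def)
  qed
  have xim: "x s \<in> chart_image d" if "\<bar>s\<bar> < e" for s
    using e2(2)[of "x s"] xd[of s] xbd[of s] that by (simp add: e_def half_space_def)
  define h where "h s = k (x s)" for s
  let ?Dk = "\<lambda>s. frechet_derivative k (at (x s))"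
  have Dk: "(k has_derivative ?Dk s) (at (x s))" if "\<bar>s\<bar> < e" for s
    using smooth_on_has_derivative[OF W(3) xV(1)[OF that]] .
  have Dh: "(h has_vector_derivative ?Dk s ?e2) (at s)" if "\<bar>s\<bar> < e" for s
  proof -
    have "(x has_derivative (\<lambda>r. r *\<^sub>R ?e2)) (at s)"
      unfolding x_def by (auto intro!: derivative_eq_intros)
    from diff_chain_at[OF this Dk[OF that]]
    show ?thesis
      using linear_scale[OF has_derivative_linear[OF Dk[OF that]]]
      by (simp add: has_vector_derivative_def h_def[abs_def] o_def)
  qed
  have point: "\<exists>r p' \<nu>' l. E' (param d (x s)) = (r, p', \<nu>') \<and> r \<in> {0<..<R} \<and> (p', \<nu>') \<in> U \<and>
      E (r, p', \<nu>') = param d (x s) \<and> p' \<in> fst c \<and> h s = (r, snd c p', \<nu>' c) \<and>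
      param d (x s) \<in> mfd_boundary \<Omega> A \<and> l *\<^sub>R ?Dk s ?e2 = (1, 0, 0)" if s: "\<bar>s\<bar> < e" for s
  proof -
    let ?\<beta> = "param d (x s)"
    have \<beta>: "?\<beta> \<in> fst d" "snd d ?\<beta> = x s" using param_in[OF d(1)] coord_param[OF d(1)] xim[OF s] by auto
    have kz: "?\<beta> \<in> \<Omega> - P" "E' ?\<beta> \<in> fst (bundle_chart c)" "snd (bundle_chart c) (E' ?\<beta>) = h s"
      using k(2)[of "x s"] xV(1)[OF s] xim[OF s] by (auto simp: h_def)
    have bd: "?\<beta> \<in> mfd_boundary \<Omega> A" using mfd_boundary_iff[OF d(1) \<beta>(1)] \<beta>(2) xbd by simp
    obtain r p' \<nu>' where r: "E' ?\<beta> = (r, p', \<nu>')" "r \<in> {0<..R}" "(p', \<nu>') \<in> U" "E (r, p', \<nu>') = ?\<beta>"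
      using E'_in[OF kz(1)] by metis
    have hs: "p' \<in> fst c" "h s = (r, snd c p', \<nu>' c)" using kz(2,3) r(1) by auto
    have rR: "r < R" using xV(2)[OF s] hs(2) by (simp add: h_def)
    have dE: "E (r, p', \<nu>') \<in> fst d" using r \<beta> by simp
    obtain w V2 where w: "((\<lambda>s. snd d (E (s, p', \<nu>'))) has_vector_derivative w) (at r within {0<..R})"
      and V2: "open V2" "r \<in> V2" "\<And>s. s \<in> {0<..R} \<Longrightarrow> s \<in> V2 \<Longrightarrow> E (s, p', \<nu>') \<in> fst d"
      using ray_derivative[OF r(3) r(2) d(1) dE] by metis
    have wbd: "((\<lambda>s. snd d (E (s, p', \<nu>')) $ bd_index) has_vector_derivative w $ bd_index) (at r within {0<..R})"
      using bounded_linear.has_vector_derivative[OF bounded_linear_vec_nth w] .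
    have min: "snd d (E (r, p', \<nu>')) $ bd_index \<le> snd d (E (s, p', \<nu>')) $ bd_index"
      if "s \<in> {0<..R}" "s \<in> V2" for s
      using coord_nonneg[OF d(1) V2(3)[OF that]] r(4) \<beta>(2) xbd by simp
    have "0 \<le> w $ bd_index"
      by (rule deriv_nonneg_right[OF wbd _ _ V2(1,2) min, of "R - r"]) (use r rR in auto)
    moreover have "w $ bd_index \<le> 0"
      by (rule deriv_nonpos_left[OF wbd _ _ V2(1,2) min, of r]) (use r rR in auto)
    ultimately have wbd0: "w $ bd_index = 0" by simp
    have "w $ i = (w $ j *\<^sub>R ?e2) $ i" for i
    proof -
      have "i = bd_index \<or> i = j" using j(1) by blast
      then show ?thesis using wbd0 j(2) by (auto simp: axis_def)
    qed
    then have weq: "w = w $ j *\<^sub>R ?e2" unfolding vec_eq_iff by blast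
    have "snd d ?\<beta> \<in> W" using \<beta>(2) xV(1)[OF s] by simp
    from local_rep_at(1)[OF d(1) \<beta>(1) this k(1)]
    have "local_rep d (E (r, p', \<nu>')) (\<lambda>q. snd (bundle_chart c) (E' q)) W k" using r(4) by simp
    from E'_derivative_ray[OF r(3) r(2) d(1) dE c(1) hs(1) w this]
    have "?Dk s w = (1, 0, 0)" using r(4) \<beta>(2) by simp
    then have "w $ j *\<^sub>R ?Dk s ?e2 = (1, 0, 0)"
      unfolding linear_scale[OF has_derivative_linear[OF Dk[OF s]], symmetric] weq[symmetric] .
    then show ?thesis using r rR hs bd by auto
  qed
  \<comment> \<open>\<open>l\<close> is the \<open>j\<close>-component of the ray velocity; the
    equation makes it nonzero, so moving along the boundary changes the radius and, to first order,
    neither foot nor normal.\<close>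
  have D2: "snd (?Dk s ?e2) = 0" "fst (?Dk s ?e2) \<noteq> 0" if s: "\<bar>s\<bar> < e" for s
  proof -
    obtain l where l: "l *\<^sub>R ?Dk s ?e2 = (1, 0, 0)" using point[OF s] by blast
    have "fst (l *\<^sub>R ?Dk s ?e2) = 1" "snd (l *\<^sub>R ?Dk s ?e2) = 0" unfolding l by (simp_all add: zero_prod_def)
    then show "snd (?Dk s ?e2) = 0" "fst (?Dk s ?e2) \<noteq> 0" by auto
  qed
  have "((\<lambda>s. snd (h s)) has_vector_derivative 0) (at s within {-e<..<e})" if "s \<in> {-e<..<e}" for s
  proof -
    have s: "\<bar>s\<bar> < e" using that by auto
    have "((\<lambda>s. snd (h s)) has_vector_derivative snd (?Dk s ?e2)) (at s)"
      using bounded_linear.has_vector_derivative[OF bounded_linear_snd Dh[OF s]] .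
    then show ?thesis using D2(1)[OF s] by (simp add: has_vector_derivative_at_within)
  qed
  then obtain C where C: "\<And>s. s \<in> {-e<..<e} \<Longrightarrow> snd (h s) = C"
    using has_vector_derivative_zero_constant[of "{-e<..<e}" "\<lambda>s. snd (h s)"] by auto
  have h0: "h 0 = (t0, snd c p, \<nu> c)" using k0 by (simp add: h_def x_def)
  have sndh: "snd (h s) = (snd c p, \<nu> c)" if "\<bar>s\<bar> < e" for s
  proof -
    have "s \<in> {-e<..<e}" "0 \<in> {-e<..<e}" using that e by auto
    then have "snd (h s) = C" "snd (h 0) = C" using C by blast+
    then show ?thesis using h0 by simp
  qed
  have on_ray: "fst (h s) \<in> {0<..<R} \<and> E (fst (h s), p, \<nu>) \<in> mfd_boundary \<Omega> A" if s: "\<bar>s\<bar> < e" for s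
  proof -
    obtain r p' \<nu>' where r: "r \<in> {0<..<R}" "(p', \<nu>') \<in> U" "E (r, p', \<nu>') = param d (x s)" "p' \<in> fst c"
      "h s = (r, snd c p', \<nu>' c)" "param d (x s) \<in> mfd_boundary \<Omega> A" using point[OF s] by auto
    have coords: "snd c p' = snd c p" "\<nu>' c = \<nu> c" using sndh[OF s] r(5) by auto
    have "p' = p" using param_coord[OF c(1) r(4)] param_coord[OF c] unfolding coords(1) by simp
    moreover have "\<nu>' = \<nu>"
      using tangent_space_eqI[of \<nu>' p \<nu> c] coords(2) c normal_foot(2) r(2) \<xi> \<open>p' = p\<close> by blast
    ultimately show ?thesis using r by simp
  qed
  have "continuous_on {-e<..<e} (\<lambda>s. fst (h s))"
  proof (intro continuous_at_imp_continuous_on ballI)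
    fix s assume "s \<in> {-e<..<e}"
    then have "\<bar>s\<bar> < e" by auto
    then have "isCont h s" using Dh has_vector_derivative_continuous by blast
    then show "isCont (\<lambda>s. fst (h s)) s" by (intro continuous_intros)
  qed
  moreover have "((\<lambda>s. fst (h s)) has_vector_derivative fst (?Dk 0 ?e2)) (at 0)"
    using bounded_linear.has_vector_derivative[OF bounded_linear_fst Dh[of 0]] e by simp
  \<comment> \<open>The radii met along the boundary fill a neighbourhood of \<open>t0\<close>, and
    by \<open>on_ray\<close> all these boundary points lie on the one ray of
    \<open>(p, \<nu>)\<close>.\<close>
  ultimately obtain \<eta> where "\<eta> > 0" "\<And>t. \<bar>t - fst (h 0)\<bar> < \<eta> \<Longrightarrow> \<exists>s. \<bar>s\<bar> < e \<and> fst (h s) = t"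
    using derivative_nonzero_covers[OF _ _ D2(2)[of 0] e] e by auto
  then show ?thesis using that on_ray h0 by (metis fst_conv)
qed

section \<open>The collar of the boundary\<close>

lemma continuous_on_E'_radius: "continuous_on (\<Omega> - P) (\<lambda>q. fst (E' q))"
proof (rule continuous_on_openinI)
  fix q and B :: "real set" assume q: "q \<in> \<Omega> - P" and B: "open B" "fst (E' q) \<in> B"
  obtain r p \<nu> where E': "E' q = (r, p, \<nu>)" "(p, \<nu>) \<in> U" using E'_in[OF q] by metis
  obtain c where c: "c \<in> A" "p \<in> fst c" using E' normal_foot P chart_exists by blast
  obtain e where e: "e > 0" "ball r e \<subseteq> B" using B E' openE by (metis fst_conv)
  obtain N where N: "openin (top_of_set \<Omega>) N" "q \<in> N" "N \<subseteq> \<Omega> - P"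
    "\<And>q' r' p' \<nu>'. q' \<in> N \<Longrightarrow> E' q' = (r', p', \<nu>') \<Longrightarrow> p' \<in> fst c \<and> dist (r', snd c p', \<nu>' c) (r, snd c p, \<nu> c) < e"
    using E'_continuous[OF q E'(1) c e(1)] by metis
  have "fst (E' q') \<in> B" if "q' \<in> N" for q'
  proof -
    obtain r' p' \<nu>' where eq: "E' q' = (r', p', \<nu>')" by (rule prod_cases3)
    have "dist r' r \<le> dist (r', snd c p', \<nu>' c) (r, snd c p, \<nu> c)"
      using dist_fst_le[of "(r', snd c p', \<nu>' c)" "(r, snd c p, \<nu> c)"] by simp
    also have "\<dots> < e" using N(4)[OF that eq] by blast
    finally have "r' \<in> ball r e" by (simp add: dist_commute)
    then show ?thesis using e(2) eq by auto
  qed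
  moreover have "openin (top_of_set (\<Omega> - P)) N"
    using N(1,3) by (meson Diff_subset openin_subset_trans)
  ultimately show "\<exists>N. openin (top_of_set (\<Omega> - P)) N \<and> q \<in> N \<and> (\<lambda>q. fst (E' q)) ` N \<subseteq> B" using N(2) by blast
qed

text \<open>The contact times of a ray in \<open>(0, R)\<close> form an open set by
  \<open>boundary_ray_open\<close>, and a relatively closed one because the boundary is closed. One
  early contact thus puts the whole open ray into the boundary. But the radius has a positive
  minimum \<open>m\<close> on the compact boundary, and the ray passes through radius
  \<open>m / 2\<close>.\<close>

lemma boundary_eq_outer:
  assumes j: "(UNIV :: 'm set) = {bd_index, j}" "j \<noteq> bd_index"
    and q: "q \<in> mfd_boundary \<Omega> A"
  shows "fst (E' q) = R"
proof (rule ccontr)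
  let ?B = "mfd_boundary \<Omega> A"
  assume ne: "fst (E' q) \<noteq> R"
  have qc: "q \<in> \<Omega> - P" using q boundary_in_complement by blast
  obtain t0 p \<nu> where t0: "E' q = (t0, p, \<nu>)" "t0 \<in> {0<..R}" and \<xi>: "(p, \<nu>) \<in> U" and Eq: "E (t0, p, \<nu>) = q"
    using E'_in[OF qc] by metis
  have t0R: "t0 \<in> {0<..<R}" using t0 ne by auto
  obtain c where c: "c \<in> A" "p \<in> fst c" using \<xi> normal_foot P chart_exists by blast
  define S where "S = {t \<in> {0<..<R}. E (t, p, \<nu>) \<in> ?B}"
  define T where "T = {t \<in> {0<..<R}. E (t, p, \<nu>) \<notin> ?B}"
  have oS: "open S"
    unfolding open_dist
  proof
    fix t assume "t \<in> S"
    then obtain \<eta> where "\<eta> > 0" "\<And>t'. \<bar>t' - t\<bar> < \<eta> \<Longrightarrow> t' \<in> {0<..<R} \<and> E (t', p, \<nu>) \<in> ?B"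
      using boundary_ray_open[OF j \<xi>, of t] by (auto simp: S_def)
    then show "\<exists>e>0. \<forall>y. dist y t < e \<longrightarrow> y \<in> S" by (auto simp: S_def dist_real_def)
  qed
  have oT: "open T"
    unfolding open_dist
  proof
    fix t assume t: "t \<in> T"
    then have tR: "t \<in> {0<..R}" by (auto simp: T_def)
    have "openin (top_of_set \<Omega>) (\<Omega> - ?B)" using closedin_mfd_boundary by (simp add: closedin_def)
    moreover have "E (t, p, \<nu>) \<in> \<Omega> - ?B" using t E_in[OF tR \<xi>] by (auto simp: T_def)
    ultimately obtain e where e: "e > 0" "\<And>s p' \<nu>'. s \<in> {0<..R} \<Longrightarrow> (p', \<nu>') \<in> U \<Longrightarrow> p' \<in> fst c \<Longrightarrow>
      dist (s, snd c p', \<nu>' c) (t, snd c p, \<nu> c) < e \<Longrightarrow> E (s, p', \<nu>') \<in> \<Omega> - ?B"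
      using E_continuous[OF \<xi> tR _ _ c] by metis
    have "s \<in> T" if "dist s t < min e (min t (R - t))" for s
    proof -
      have s: "s \<in> {0<..<R}" "dist s t < e" using that by (auto simp: dist_real_def)
      then have "E (s, p, \<nu>) \<in> \<Omega> - ?B" using e(2)[OF _ \<xi> c(2), of s] by (simp add: dist_Pair_Pair)
      then show ?thesis using s by (auto simp: T_def)
    qed
    moreover have "min e (min t (R - t)) > 0" using e t by (auto simp: T_def)
    ultimately show "\<exists>e>0. \<forall>y. dist y t < e \<longrightarrow> y \<in> T" by blast
  qed
  have "S \<inter> {0<..<R} = {} \<or> T \<inter> {0<..<R} = {}"
    by (rule connectedD[OF connected_Ioo oS oT]) (auto simp: S_def T_def)
  moreover have "t0 \<in> S \<inter> {0<..<R}" using t0R Eq q by (auto simp: S_def)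
  ultimately have "T = {}" by (auto simp: T_def)
  then have all: "E (t, p, \<nu>) \<in> ?B" if "t \<in> {0<..<R}" for t using that by (auto simp: T_def)
  have "continuous_on ?B (\<lambda>q. fst (E' q))"
    using continuous_on_E'_radius continuous_on_subset boundary_in_complement by blast
  then obtain q0 where q0: "q0 \<in> ?B" "\<And>q'. q' \<in> ?B \<Longrightarrow> fst (E' q0) \<le> fst (E' q')"
    using continuous_attains_inf[OF compact_mfd_boundary[OF compact]] q by blast
  define m where "m = fst (E' q0)"
  obtain r0 p0 \<nu>0 where "E' q0 = (r0, p0, \<nu>0)" "r0 \<in> {0<..R}"
    using E'_in q0(1) boundary_in_complement by blast
  then have m: "0 < m" "m \<le> R" by (auto simp: m_def)
  have m2: "m / 2 \<in> {0<..<R}" using m by auto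
  have "m \<le> fst (E' (E (m / 2, p, \<nu>)))" using q0(2)[OF all[OF m2]] by (simp add: m_def)
  also have "\<dots> = m / 2" using E'_E[of "m / 2", OF _ \<xi>] m2 by auto
  finally show False using m by simp
qed

definition outer_retraction :: "'p \<Rightarrow> real \<times> 'p" where
  "outer_retraction q = (fst (E' q), E (R, snd (E' q)))"

text \<open>The point of radius \<open>r\<close> on the ray ending at \<open>b\<close>. Only foot
  and normal of \<open>E' b\<close> enter, so the continuity proof does not depend on the radius of
  boundary points.\<close>

definition collar :: "real \<times> 'p \<Rightarrow> 'p" where
  "collar = (\<lambda>(r, b). E (r, snd (E' b)))"

lemma continuous_on_outer_retraction: "continuous_on (\<Omega> - P) outer_retraction"
  unfolding outer_retraction_def
proof (intro continuous_on_Pair continuous_on_E'_radius continuous_on_openinI)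
  fix q B assume q: "q \<in> \<Omega> - P" and B: "open B" "E (R, snd (E' q)) \<in> B"
  obtain r p \<nu> where E': "E' q = (r, p, \<nu>)" and \<xi>: "(p, \<nu>) \<in> U" using E'_in[OF q] by metis
  obtain c where c: "c \<in> A" "p \<in> fst c" using \<xi> normal_foot P chart_exists by blast
  have RR: "R \<in> {0<..R}" using R by simp
  have "openin (top_of_set \<Omega>) (\<Omega> \<inter> B)" "E (R, p, \<nu>) \<in> \<Omega> \<inter> B" using B E' E_in[OF RR \<xi>] by auto
  then obtain e where e: "e > 0" "\<And>s p' \<nu>'. s \<in> {0<..R} \<Longrightarrow> (p', \<nu>') \<in> U \<Longrightarrow> p' \<in> fst c \<Longrightarrow>
      dist (s, snd c p', \<nu>' c) (R, snd c p, \<nu> c) < e \<Longrightarrow> E (s, p', \<nu>') \<in> \<Omega> \<inter> B"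
    using E_continuous[OF \<xi> RR _ _ c] by metis
  obtain N where N: "openin (top_of_set \<Omega>) N" "q \<in> N" "N \<subseteq> \<Omega> - P"
    "\<And>q' r' p' \<nu>'. q' \<in> N \<Longrightarrow> E' q' = (r', p', \<nu>') \<Longrightarrow> p' \<in> fst c \<and> dist (r', snd c p', \<nu>' c) (r, snd c p, \<nu> c) < e"
    using E'_continuous[OF q E' c e(1)] by metis
  have "E (R, snd (E' q')) \<in> B" if q': "q' \<in> N" for q'
  proof -
    have "q' \<in> \<Omega> - P" using q' N(3) by blast
    then obtain r' p' \<nu>' where eq: "E' q' = (r', p', \<nu>')" "(p', \<nu>') \<in> U" using E'_in by metis
    have "dist (R, snd c p', \<nu>' c) (R, snd c p, \<nu> c) = dist (snd c p', \<nu>' c) (snd c p, \<nu> c)"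
      by (simp add: dist_Pair_Pair)
    also have "\<dots> \<le> dist (r', snd c p', \<nu>' c) (r, snd c p, \<nu> c)"
      using dist_snd_le[of "(r', snd c p', \<nu>' c)" "(r, snd c p, \<nu> c)"] by simp
    also have "\<dots> < e" using N(4)[OF q' eq(1)] by blast
    finally show ?thesis using e(2)[OF RR eq(2)] N(4)[OF q' eq(1)] eq(1) by auto
  qed
  moreover have "openin (top_of_set (\<Omega> - P)) N"
    using N(1,3) by (meson Diff_subset openin_subset_trans)
  ultimately show "\<exists>N. openin (top_of_set (\<Omega> - P)) N \<and> q \<in> N \<and> (\<lambda>q. E (R, snd (E' q))) ` N \<subseteq> B" using N(2) by blast
qed

lemma continuous_on_collar: "continuous_on ({0<..R} \<times> mfd_boundary \<Omega> A) collar"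
proof (rule continuous_on_openinI)
  let ?B = "mfd_boundary \<Omega> A"
  fix x O1 assume x: "x \<in> {0<..R} \<times> ?B" and O1: "open O1" "collar x \<in> O1"
  obtain r b where rb: "x = (r, b)" "r \<in> {0<..R}" "b \<in> ?B" using x by auto
  have b: "b \<in> \<Omega> - P" using rb boundary_in_complement by blast
  obtain r0 p \<nu> where E': "E' b = (r0, p, \<nu>)" and \<xi>: "(p, \<nu>) \<in> U" using E'_in[OF b] by metis
  obtain c where c: "c \<in> A" "p \<in> fst c" using \<xi> normal_foot P chart_exists by blast
  have "openin (top_of_set \<Omega>) (\<Omega> \<inter> O1)" "E (r, p, \<nu>) \<in> \<Omega> \<inter> O1"
    using O1 E' E_in[OF rb(2) \<xi>] rb by (auto simp: collar_def)
  then obtain e where e: "e > 0" "\<And>s p' \<nu>'. s \<in> {0<..R} \<Longrightarrow> (p', \<nu>') \<in> U \<Longrightarrow> p' \<in> fst c \<Longrightarrow>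
      dist (s, snd c p', \<nu>' c) (r, snd c p, \<nu> c) < e \<Longrightarrow> E (s, p', \<nu>') \<in> \<Omega> \<inter> O1"
    using E_continuous[OF \<xi> rb(2) _ _ c] by metis
  have "e / 2 > 0" using e by simp
  then obtain N where N: "openin (top_of_set \<Omega>) N" "b \<in> N" "N \<subseteq> \<Omega> - P"
    "\<And>q' r' p' \<nu>'. q' \<in> N \<Longrightarrow> E' q' = (r', p', \<nu>') \<Longrightarrow> p' \<in> fst c \<and> dist (r', snd c p', \<nu>' c) (r0, snd c p, \<nu> c) < e / 2"
    using E'_continuous[OF b E' c] by metis
  let ?N = "({0<..R} \<inter> ball r (e / 2)) \<times> (?B \<inter> N)"
  have "openin (top_of_set ?B) (?B \<inter> N)"
    using N(1) by (auto simp: openin_open mfd_boundary_def)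
  then have "openin (top_of_set ({0<..R} \<times> ?B)) ?N"
    by (intro openin_Times) auto
  moreover have "x \<in> ?N" using rb N(2) e by auto
  moreover have "collar ` ?N \<subseteq> O1"
  proof (clarsimp simp: collar_def)
    fix r' b' assume r': "0 < r'" "r' \<le> R" "dist r r' * 2 < e" and b': "b' \<in> ?B" "b' \<in> N"
    have "b' \<in> \<Omega> - P" using b' N(3) by blast
    then obtain r1 p' \<nu>' where eq: "E' b' = (r1, p', \<nu>')" "(p', \<nu>') \<in> U" using E'_in by metis
    have "dist (r', snd c p', \<nu>' c) (r, snd c p, \<nu> c) \<le> dist r' r + dist (snd c p', \<nu>' c) (snd c p, \<nu> c)"
      unfolding dist_Pair_Pair[of r'] by (rule sqrt_sum_squares_le_sum) auto
    also have "dist (snd c p', \<nu>' c) (snd c p, \<nu> c) \<le> dist (r1, snd c p', \<nu>' c) (r0, snd c p, \<nu> c)"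
      using dist_snd_le[of "(r1, snd c p', \<nu>' c)" "(r0, snd c p, \<nu> c)"] by simp
    also have "\<dots> < e / 2" using N(4)[OF b'(2) eq(1)] by blast
    also have "dist r' r < e / 2" using r' by (simp add: dist_commute)
    finally have "dist (r', snd c p', \<nu>' c) (r, snd c p, \<nu> c) < e" by simp
    then show "E (r', snd (E' b')) \<in> O1" using e(2)[of r' p' \<nu>'] r' eq N(4)[OF b'(2) eq(1)] by auto
  qed
  ultimately show "\<exists>N. openin (top_of_set ({0<..R} \<times> ?B)) N \<and> x \<in> N \<and> collar ` N \<subseteq> O1" by blast
qed

text \<open>By \<open>boundary_eq_outer\<close> a boundary point is the outer end of its own ray,
  and by \<open>outer_end_in_boundary\<close> every ray ends on the boundary; this makes the two
  maps inverse to each other.\<close>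

lemma collar_homeomorphism:
  assumes j: "(UNIV :: 'm set) = {bd_index, j}" "j \<noteq> bd_index"
  shows "homeomorphism ({0<..R} \<times> mfd_boundary \<Omega> A) (\<Omega> - P) collar outer_retraction"
proof (rule homeomorphismI[OF continuous_on_collar continuous_on_outer_retraction])
  let ?B = "mfd_boundary \<Omega> A"
  have RR: "R \<in> {0<..R}" using R by simp
  have bdry: "\<exists>p \<nu>. E' b = (R, p, \<nu>) \<and> (p, \<nu>) \<in> U \<and> E (R, p, \<nu>) = b" if "b \<in> ?B" for b
    using boundary_eq_outer[OF j that] E'_in boundary_in_complement that by (metis fst_conv subsetD)
  show "collar ` ({0<..R} \<times> ?B) \<subseteq> \<Omega> - P"
  proof clarify
    fix r b assume "r \<in> {0<..R}" "b \<in> ?B"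
    then show "collar (r, b) \<in> \<Omega> - P" using bdry[of b] E_in by (auto simp: collar_def)
  qed
  show "outer_retraction ` (\<Omega> - P) \<subseteq> {0<..R} \<times> ?B"
  proof
    fix y assume "y \<in> outer_retraction ` (\<Omega> - P)"
    then obtain q where q: "q \<in> \<Omega> - P" "y = outer_retraction q" by blast
    obtain r p \<nu> where "E' q = (r, p, \<nu>)" "r \<in> {0<..R}" "(p, \<nu>) \<in> U" using E'_in[OF q(1)] by metis
    then show "y \<in> {0<..R} \<times> ?B" using q outer_end_in_boundary by (simp add: outer_retraction_def)
  qed
  show "outer_retraction (collar x) = x" if x: "x \<in> {0<..R} \<times> ?B" for x
  proof -
    obtain r b where rb: "x = (r, b)" "r \<in> {0<..R}" "b \<in> ?B" using x by auto
    obtain p \<nu> where p: "E' b = (R, p, \<nu>)" "(p, \<nu>) \<in> U" "E (R, p, \<nu>) = b" using bdry[OF rb(3)] by blast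
    then show ?thesis using E'_E[OF rb(2) p(2)] rb by (simp add: collar_def outer_retraction_def)
  qed
  show "collar (outer_retraction q) = q" if q: "q \<in> \<Omega> - P" for q
  proof -
    obtain r p \<nu> where r: "E' q = (r, p, \<nu>)" "r \<in> {0<..R}" "(p, \<nu>) \<in> U" "E (r, p, \<nu>) = q" using E'_in[OF q] by metis
    then show ?thesis using E'_E[OF RR r(3)] by (simp add: collar_def outer_retraction_def)
  qed
qed

end

section \<open>Boundary components of a tube\<close>

text \<open>\<open>P\<close> is locally two-sided, so at most two of the collars over the components of \<open>B\<close> accumulate
  at any point of \<open>P\<close>; but all of them accumulate on the whole of \<open>P\<close>, because the end of a
  single collar is connected and \<open>\<Omega>\<close> is connected.\<close>

theorem collar_components_le_2:
  fixes \<Omega> P B :: "'a::t2_space set" and R :: real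
  assumes \<Omega>: "compact \<Omega>" "connected \<Omega>" and P: "P \<subseteq> \<Omega>" "compact P" "P \<noteq> {}"
    and B: "compact B" and R: "0 < R"
    and homeo: "homeomorphism ({0<..R} \<times> B) (\<Omega> - P) G H"
    and sides: "\<And>p. p \<in> P \<Longrightarrow> \<exists>N D1 D2. openin (top_of_set \<Omega>) N \<and> p \<in> N \<and> N - P \<subseteq> D1 \<union> D2 \<and>
      connected D1 \<and> connected D2 \<and> D1 \<subseteq> \<Omega> - P \<and> D2 \<subseteq> \<Omega> - P \<and> N \<inter> P \<subseteq> closure D1 \<inter> closure D2"
    and fin: "finite (components B)"
  shows "card (components B) \<le> 2"
proof -
  have contG: "continuous_on ({0<..R} \<times> B) G" and contH: "continuous_on (\<Omega> - P) H"
    and GH: "\<And>y. y \<in> \<Omega> - P \<Longrightarrow> G (H y) = y" and HG: "\<And>x. x \<in> {0<..R} \<times> B \<Longrightarrow> H (G x) = x"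
    and Gim: "G ` ({0<..R} \<times> B) = \<Omega> - P" and Him: "H ` (\<Omega> - P) = {0<..R} \<times> B"
    using homeo unfolding homeomorphism_def by blast+
  define C where "C = components B"
  have C: "X \<subseteq> B" "X \<noteq> {}" "connected X" "compact X" if "X \<in> C" for X
    using that in_components_subset in_components_nonempty in_components_connected
      closedin_compact[OF B closedin_component] unfolding C_def by blast+
  have Cdisj: "X = Y" if "X \<in> C" "Y \<in> C" "b \<in> X" "b \<in> Y" for X Y b
    using that components_nonoverlap unfolding C_def by blast
  have HB: "H y \<in> {0<..R} \<times> B" if "y \<in> \<Omega> - P" for y using Him that by blast
  define T where "T X = {y \<in> \<Omega> - P. snd (H y) \<in> X}" for X
  have TG: "G (r, b) \<in> T X" if "X \<in> C" "b \<in> X" "r \<in> {0<..R}" for r b X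
  proof -
    have rb: "(r, b) \<in> {0<..R} \<times> B" using C(1) that by blast
    then have "G (r, b) \<in> \<Omega> - P" using Gim by blast
    then show ?thesis using HG[OF rb] that by (simp add: T_def)
  qed
  have T_eq: "T X = G ` ({0<..R} \<times> X)" if X: "X \<in> C" for X
  proof
    show "G ` ({0<..R} \<times> X) \<subseteq> T X" using TG[OF X] by auto
    show "T X \<subseteq> G ` ({0<..R} \<times> X)"
    proof
      fix y assume y: "y \<in> T X"
      then have yc: "y \<in> \<Omega> - P" by (simp add: T_def)
      have "H y \<in> {0<..R} \<times> X" using HB[OF yc] y by (auto simp: T_def mem_Times_iff)
      then show "y \<in> G ` ({0<..R} \<times> X)" using GH[OF yc] by force
    qed
  qed
  have Tdisj: "X = Y" if "X \<in> C" "Y \<in> C" "y \<in> T X" "y \<in> T Y" for X Y y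
    using Cdisj[OF that(1,2)] that(3,4) by (auto simp: T_def)
  have Tne: "T X \<noteq> {}" if X: "X \<in> C" for X
  proof -
    obtain b where "b \<in> X" using C(2)[OF X] by blast
    then have "G (R, b) \<in> T X" using TG[OF X] R by auto
    then show ?thesis by blast
  qed
  have Tsub: "T X \<subseteq> \<Omega>" and TP: "T X \<inter> P = {}" for X by (auto simp: T_def)
  have cl\<Omega>: "closure (T X) \<subseteq> \<Omega>" for X
    using closure_minimal[OF Tsub compact_imp_closed[OF \<Omega>(1)]] .
  have clT: "closure (T X) - P = T X" if X: "X \<in> C" for X
  proof
    show "T X \<subseteq> closure (T X) - P" using closure_subset[of "T X"] TP by blast
    have "continuous_on (\<Omega> - P) (\<lambda>y. snd (H y))" using contH by (intro continuous_intros)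
    then have "closedin (top_of_set (\<Omega> - P)) ((\<Omega> - P) \<inter> (\<lambda>y. snd (H y)) -` X)"
      using compact_imp_closed[OF C(4)[OF X]] continuous_closedin_preimage by blast
    moreover have "(\<Omega> - P) \<inter> (\<lambda>y. snd (H y)) -` X = T X" by (auto simp: T_def)
    ultimately obtain K where K: "closed K" "T X = (\<Omega> - P) \<inter> K" unfolding closedin_closed by auto
    then have "closure (T X) \<subseteq> K" using closure_minimal[of "T X" K] by simp
    then show "closure (T X) - P \<subseteq> T X" using K cl\<Omega> by blast
  qed
  \<comment> \<open>The end set of the collar over \<open>X\<close>. Off \<open>P\<close> the
    closure adds nothing, by \<open>clT\<close>.\<close>
  define Q where "Q X = P \<inter> closure (T X)" for X
  have clTQ: "closure (T X) = T X \<union> Q X" if "X \<in> C" for X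
    using clT[OF that] closure_subset[of "T X"] by (auto simp: Q_def)
  have QC: "compact (Q X)" for X unfolding Q_def using P(2) by (simp add: compact_Int_closed)
  have connT: "\<exists>X\<in>C. D \<subseteq> T X" if D: "connected D" "D \<subseteq> \<Omega> - P" "D \<noteq> {}" for D
  proof -
    have "connected ((\<lambda>y. snd (H y)) ` D)"
      using D contH by (intro connected_continuous_image continuous_on_snd) (auto intro: continuous_on_subset)
    moreover have sub: "(\<lambda>y. snd (H y)) ` D \<subseteq> B" using D(2) HB by fastforce
    moreover have "B \<noteq> {}" using sub D(3) by blast
    ultimately obtain X where "X \<in> C" "(\<lambda>y. snd (H y)) ` D \<subseteq> X"
      using exists_component_superset unfolding C_def by metis
    then show ?thesis using D(2) by (auto simp: T_def)
  qed
  \<comment> \<open>Each side of \<open>P\<close> near \<open>p\<close> is connected, hence inside a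
    single collar, so \<open>F\<close> has at most two members. Both sides accumulate on all of
    \<open>N \<inter> P\<close>, so a collar accumulating at \<open>p\<close> accumulates on all of
    \<open>N \<inter> P\<close>.\<close>
  have side: "\<exists>N F. openin (top_of_set \<Omega>) N \<and> p \<in> N \<and> finite F \<and> card F \<le> 2 \<and>
      (\<forall>X\<in>C. p \<in> closure (T X) \<longrightarrow> X \<in> F) \<and> F \<subseteq> C \<and> F \<noteq> {} \<and> (\<forall>X\<in>F. N \<inter> P \<subseteq> Q X)" if p: "p \<in> P" for p
  proof -
    obtain N D1 D2 where N: "openin (top_of_set \<Omega>) N" "p \<in> N" "N - P \<subseteq> D1 \<union> D2"
      and D: "connected D1" "connected D2" "D1 \<subseteq> \<Omega> - P" "D2 \<subseteq> \<Omega> - P"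
      and cl: "N \<inter> P \<subseteq> closure D1 \<inter> closure D2"
      using sides[OF p] by blast
    have "D1 \<noteq> {}" "D2 \<noteq> {}" using cl p N(2) by auto
    then obtain X1 X2 where X: "X1 \<in> C" "D1 \<subseteq> T X1" "X2 \<in> C" "D2 \<subseteq> T X2" using connT D by metis
    have "X \<in> {X1, X2}" if XC: "X \<in> C" "p \<in> closure (T X)" for X
    proof -
      obtain O1 where O1: "open O1" "N = \<Omega> \<inter> O1" using N(1) openin_open by blast
      then have "O1 \<inter> T X \<noteq> {}"
        using XC(2) N(2) open_Int_closure_eq_empty[OF O1(1), of "T X"] by blast
      then obtain y where "y \<in> O1" "y \<in> T X" by blast
      then have "y \<in> N - P" "y \<in> T X" using O1 by (auto simp: T_def)
      then have "y \<in> T X1 \<or> y \<in> T X2" using N(3) X by blast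
      then show ?thesis using Tdisj[OF XC(1)] X \<open>y \<in> T X\<close> by blast
    qed
    moreover have "N \<inter> P \<subseteq> Q X" if "X \<in> {X1, X2}" for X
      using that cl closure_mono[OF X(2)] closure_mono[OF X(4)] by (auto simp: Q_def)
    moreover have "card {X1, X2} \<le> 2" by (simp add: card_insert_if)
    ultimately show ?thesis using N(1,2) X(1,3)
      by (intro exI[of _ N] exI[of _ "{X1, X2}"]) blast
  qed
  have Qopen: "openin (top_of_set P) (Q X)" if X: "X \<in> C" for X
  proof (subst openin_subopen, intro ballI)
    fix p assume p: "p \<in> Q X"
    then have "p \<in> P" by (simp add: Q_def)
    obtain N F where N: "openin (top_of_set \<Omega>) N" "p \<in> N" "\<And>X. X \<in> C \<Longrightarrow> p \<in> closure (T X) \<Longrightarrow> X \<in> F"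
        "\<And>X. X \<in> F \<Longrightarrow> N \<inter> P \<subseteq> Q X"
      using side[OF \<open>p \<in> P\<close>] by metis
    have "N \<inter> P \<subseteq> Q X" using N(3,4) X p by (simp add: Q_def)
    moreover have "openin (top_of_set P) (N \<inter> P)" using N(1) P(1) by (auto simp: openin_open)
    ultimately show "\<exists>S. openin (top_of_set P) S \<and> p \<in> S \<and> S \<subseteq> Q X" using N(2) \<open>p \<in> P\<close> by blast
  qed
  have Qcover: "\<exists>X\<in>C. p \<in> Q X" if "p \<in> P" for p
    using side[OF that] that by blast
  \<comment> \<open>Connectedness of the end set, phrased with a compact splitting. Off disjoint
    neighbourhoods \<open>O1\<close>, \<open>O2\<close> of the two pieces, the closure of the collar
    is a compact subset of \<open>T X\<close>, where the radius has a positive lower bound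
    \<open>m\<close>. The part of the collar below that radius is connected and would meet both
    neighbourhoods.\<close>
  have Qconn: "K = Q X \<or> K = {}" if X: "X \<in> C" and K: "compact K" "compact (Q X - K)" "K \<subseteq> Q X" for X K
  proof (rule ccontr)
    assume "\<not> (K = Q X \<or> K = {})"
    then obtain p1 p2 where p1: "p1 \<in> K" and p2: "p2 \<in> Q X - K" using K(3) by blast
    have "Hausdorff_space (euclidean :: 'a topology)"
      using hausdorff by (auto simp: Hausdorff_space_def disjnt_def)
    then obtain O1 O2 where O: "open O1" "open O2" "K \<subseteq> O1" "Q X - K \<subseteq> O2" "O1 \<inter> O2 = {}"
      using Hausdorff_space_compact_separation[of euclidean K "Q X - K"] K
      by (auto simp: disjnt_def)
    define M where "M = closure (T X) - (O1 \<union> O2)"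
    have "compact M"
      unfolding M_def using \<Omega>(1) cl\<Omega> O by (meson closed_closure closed_subset compact_diff closedin_compact open_Un)
    have MT: "M \<subseteq> T X" using clTQ[OF X] O by (auto simp: M_def)
    obtain m where m: "0 < m" "m \<le> R" "\<And>y. y \<in> M \<Longrightarrow> m \<le> fst (H y)"
    proof (cases "M = {}")
      case True
      then show ?thesis using that[of R] R by auto
    next
      case False
      have "continuous_on M (\<lambda>y. fst (H y))"
        using contH MT by (intro continuous_on_fst) (auto intro: continuous_on_subset simp: T_def)
      then obtain y where y: "y \<in> M" "\<And>y'. y' \<in> M \<Longrightarrow> fst (H y) \<le> fst (H y')"
        using continuous_attains_inf[OF \<open>compact M\<close> False] by metis
      have "y \<in> \<Omega> - P" using y(1) MT by (auto simp: T_def)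
      then have "fst (H y) \<in> {0<..R}" using HB by (metis mem_Times_iff)
      then show ?thesis using that[of "fst (H y)"] y(2) by auto
    qed
    \<comment> \<open>Half of \<open>m\<close> keeps the inner part \<open>?Z\<close>, of radii up
      to \<open>e\<close>, clear of \<open>M\<close>, and leaves \<open>e < R\<close>.\<close>
    define e where "e = m / 2"
    have e: "0 < e" "e < m" "e < R" using m by (auto simp: e_def)
    let ?Z = "G ` ({0<..e} \<times> X)"
    have Zsub: "{0<..e} \<times> X \<subseteq> {0<..R} \<times> B" using e C(1)[OF X] by auto
    have "connected ?Z"
      using C(3)[OF X] by (intro connected_continuous_image continuous_on_subset[OF contG Zsub] connected_Times) auto
    moreover have "?Z \<subseteq> O1 \<union> O2"
    proof
      fix y assume "y \<in> ?Z"
      then obtain r b where rb: "y = G (r, b)" "r \<in> {0<..e}" "b \<in> X" by blast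
      then have "(r, b) \<in> {0<..R} \<times> B" using Zsub by blast
      then have "fst (H y) = r" using HG rb(1) by simp
      then have "y \<notin> M" using m(3) rb(2) e by fastforce
      moreover have "y \<in> closure (T X)" using TG[OF X rb(3), of r] rb e closure_subset by auto
      ultimately show "y \<in> O1 \<union> O2" by (simp add: M_def)
    qed
    ultimately have Z: "?Z \<inter> O1 = {} \<or> ?Z \<inter> O2 = {}"
      using connectedD[of ?Z O1 O2] O by blast
    \<comment> \<open>The outer part is compact and misses \<open>P\<close>, so \<open>Q X\<close>
      lies in the closure of the inner part alone.\<close>
    let ?K = "G ` ({e..R} \<times> X)"
    have Ksub: "{e..R} \<times> X \<subseteq> {0<..R} \<times> B" using e C(1)[OF X] by auto
    have "compact ?K"
      using C(4)[OF X] by (intro compact_continuous_image continuous_on_subset[OF contG Ksub] compact_Times) auto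
    have "{0<..R} \<times> X = {0<..e} \<times> X \<union> {e..R} \<times> X" using e by auto
    then have "T X = ?Z \<union> ?K" using T_eq[OF X] by (metis image_Un)
    then have "closure (T X) = closure ?Z \<union> ?K"
      using compact_imp_closed[OF \<open>compact ?K\<close>] by (simp add: closure_Un)
    moreover have "?K \<subseteq> \<Omega> - P" using Gim Ksub by blast
    ultimately have QZ: "Q X \<subseteq> closure ?Z" unfolding Q_def by blast
    have "?Z \<inter> O1 \<noteq> {}"
      using p1 K(3) QZ O(1,3) open_Int_closure_eq_empty[OF O(1), of ?Z] by blast
    moreover have "?Z \<inter> O2 \<noteq> {}"
      using p2 QZ O(2,4) open_Int_closure_eq_empty[OF O(2), of ?Z] by blast
    ultimately show False using Z by blast
  qed
  \<comment> \<open>End sets are compact and open in \<open>P\<close>, so the intersection of two of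
    them splits each one into compact pieces; \<open>Qconn\<close> leaves equality or
    disjointness.\<close>
  have Qeq: "Q X = Q Y \<or> Q X \<inter> Q Y = {}" if X: "X \<in> C" and Y: "Y \<in> C" for X Y
  proof -
    have diff: "compact (Q X - Q Y)" if XY: "X \<in> C" "Y \<in> C" for X Y
    proof -
      have "closedin (top_of_set P) (P - Q Y)" using Qopen[OF XY(2)] by (simp add: closedin_diff)
      then have "compact (P - Q Y)" using closedin_compact[OF P(2)] by blast
      moreover have "Q X - Q Y = Q X \<inter> (P - Q Y)" by (auto simp: Q_def)
      ultimately show ?thesis using QC by (simp add: compact_Int)
    qed
    have "compact (Q X \<inter> Q Y)" using QC by (simp add: compact_Int)
    then have "Q X \<inter> Q Y = Q X \<or> Q X \<inter> Q Y = {}"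
      using Qconn[OF X, of "Q X \<inter> Q Y"] diff[OF X Y] by (simp add: Diff_Int)
    moreover have "Q X \<inter> Q Y = Q Y \<or> Q X \<inter> Q Y = {}"
      using Qconn[OF Y, of "Q X \<inter> Q Y"] diff[OF Y X] \<open>compact (Q X \<inter> Q Y)\<close> by (simp add: Diff_Int)
    ultimately show ?thesis by blast
  qed
  have QP: "Q X = P" if X: "X \<in> C" for X
  proof -
    \<comment> \<open>Collars are grouped by their end sets. Finiteness makes both groups closed and
      \<open>Qeq\<close> keeps them disjoint on \<open>P\<close>, so connectedness of \<Omega>
      admits one group only.\<close>
    define K1 where "K1 = (\<Union>Y\<in>{Y \<in> C. Q Y = Q X}. closure (T Y))"
    define K2 where "K2 = (\<Union>Y\<in>{Y \<in> C. Q Y \<noteq> Q X}. closure (T Y))"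
    have "closed K1" "closed K2" unfolding K1_def K2_def using fin by (auto simp: C_def intro!: closed_UN)
    moreover have "\<Omega> \<subseteq> K1 \<union> K2"
    proof
      fix y assume y: "y \<in> \<Omega>"
      have "\<exists>Y\<in>C. y \<in> closure (T Y)"
      proof (cases "y \<in> P")
        case True
        then show ?thesis using Qcover[OF True] by (auto simp: Q_def)
      next
        case False
        then obtain Y where "Y \<in> C" "y \<in> T Y" using connT[of "{y}"] y by auto
        then show ?thesis using closure_subset[of "T Y"] by blast
      qed
      then show "y \<in> K1 \<union> K2" by (auto simp: K1_def K2_def)
    qed
    moreover have "K1 \<inter> K2 = {}"
    proof -
      have "y \<notin> closure (T Y2)" if Y: "Y1 \<in> C" "Y2 \<in> C" "Q Y1 = Q X" "Q Y2 \<noteq> Q X" "y \<in> closure (T Y1)" for y Y1 Y2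
      proof
        assume y2: "y \<in> closure (T Y2)"
        show False
        proof (cases "y \<in> P")
          case True
          then have "y \<in> Q Y1" "y \<in> Q Y2" unfolding Q_def using Y(5) y2 by auto
          then show False using Qeq[OF Y(1,2)] Y(3,4) by auto
        next
          case False
          then have "y \<in> T Y1" "y \<in> T Y2" using clT Y y2 by blast+
          then show False using Tdisj[OF Y(1,2)] Y(3,4) by blast
        qed
      qed
      then show ?thesis by (auto simp: K1_def K2_def)
    qed
    moreover have "K1 \<inter> \<Omega> \<noteq> {}"
      using Tne[OF X] Tsub[of X] closure_subset[of "T X"] X by (auto simp: K1_def)
    ultimately have "K2 \<inter> \<Omega> = {}" using \<Omega>(2) unfolding connected_closed by blast
    then have same: "Q Y = Q X" if "Y \<in> C" for Y
      using Tne[OF that] Tsub[of Y] closure_subset[of "T Y"] that by (auto simp: K2_def)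
    show ?thesis
    proof
      show "P \<subseteq> Q X" using Qcover same by blast
    qed (simp add: Q_def)
  qed
  obtain p where p: "p \<in> P" using P(3) by blast
  obtain F where F: "finite F" "card F \<le> 2" "\<And>X. X \<in> C \<Longrightarrow> p \<in> closure (T X) \<Longrightarrow> X \<in> F"
    using side[OF p] by blast
  have "C \<subseteq> F"
  proof
    fix X assume X: "X \<in> C"
    have "p \<in> Q X" using QP[OF X] p by simp
    then show "X \<in> F" using F(3)[OF X] by (simp add: Q_def)
  qed
  from card_mono[OF F(1) this] show ?thesis using F(2) by (simp add: C_def)
qed

text \<open>For \<open>dim V = 0\<close> the punctured disc is connected and serves as both sides;
  for \<open>dim V = 1\<close> the sides are the half-discs on which the normal \<open>a\<close> has
  a sign. Accumulation is phrased through open sets, the form that passes through a continuous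
  map.\<close>

lemma subspace_two_sides:
  fixes V :: "'a::euclidean_space set"
  assumes V: "subspace V" "dim V < 2" and dim: "DIM('a) = 2" and y: "y \<in> V" and \<delta>: "0 < \<delta>"
  obtains D1 D2 where "connected D1" "connected D2" "D1 \<subseteq> ball y \<delta> - V" "D2 \<subseteq> ball y \<delta> - V"
    "ball y \<delta> - V \<subseteq> D1 \<union> D2"
    "\<And>z N. z \<in> ball y \<delta> \<inter> V \<Longrightarrow> open N \<Longrightarrow> z \<in> N \<Longrightarrow> N \<inter> D1 \<noteq> {} \<and> N \<inter> D2 \<noteq> {}"
proof -
  obtain a where a: "a \<noteq> 0" "V \<subseteq> {x. a \<bullet> x = 0}"
    using lowdim_subset_hyperplane[of V] V dim span_superset by force
  have push: "\<exists>s>0. z + s *\<^sub>R b \<in> N" if "open N" "z \<in> N" for N :: "'a set" and z b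
  proof -
    have "open ((\<lambda>s. z + s *\<^sub>R b) -` N)" using that(1) by (intro open_vimage continuous_intros)
    moreover have "0 \<in> (\<lambda>s. z + s *\<^sub>R b) -` N" using that by simp
    ultimately obtain e where "e > 0" "ball (0::real) e \<subseteq> (\<lambda>s. z + s *\<^sub>R b) -` N" using openE by blast
    then show ?thesis by (intro exI[of _ "e / 2"]) (auto simp: subset_iff)
  qed
  consider "dim V = 0" | "dim V = 1" using V(2) by linarith
  then show ?thesis
  proof cases
    case 1
    then have V0: "V = {0}" using V(1) by (metis dim_eq_0 subset_singletonD y empty_iff)
    then have y0: "y = 0" using y by simp
    have acc: "N \<inter> (ball y \<delta> - V) \<noteq> {}" if z: "z \<in> ball y \<delta> \<inter> V" and N: "open N" "z \<in> N" for z N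
    proof -
      have "open (N \<inter> ball y \<delta>)" "z \<in> N \<inter> ball y \<delta>" using N z by auto
      then obtain s where "s > 0" "z + s *\<^sub>R a \<in> N \<inter> ball y \<delta>" using push by blast
      moreover have "z + s *\<^sub>R a \<notin> V" using z V0 a(1) \<open>s > 0\<close> by auto
      ultimately show ?thesis by blast
    qed
    have "connected (ball y \<delta> - V)" using connected_punctured_ball[of y \<delta>] dim V0 y0 by simp
    then show ?thesis using that[of "ball y \<delta> - V" "ball y \<delta> - V"] acc by blast
  next
    case 2
    have "dim {x. a \<bullet> x = 0} = 1" using dim_hyperplane[OF a(1)] dim by simp
    then have Va: "V = {x. a \<bullet> x = 0}"
      using subspace_dim_equal[OF V(1) subspace_hyperplane a(2)] 2 by simp
    define D where "D b = ball y \<delta> \<inter> {x. b \<bullet> x > 0}" for b :: 'a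
    have conn: "connected (D b)" for b
      unfolding D_def by (intro convex_connected convex_Int convex_ball convex_halfspace_gt)
    have acc: "N \<inter> D b \<noteq> {}" if z: "z \<in> ball y \<delta> \<inter> V" and N: "open N" "z \<in> N" and b: "b = a \<or> b = - a" for z N b
    proof -
      have "open (N \<inter> ball y \<delta>)" "z \<in> N \<inter> ball y \<delta>" using N z by auto
      then obtain s where s: "s > 0" "z + s *\<^sub>R b \<in> N \<inter> ball y \<delta>" using push by blast
      have "b \<noteq> 0" "b \<bullet> z = 0" using b a(1) z Va by auto
      then have "b \<bullet> (z + s *\<^sub>R b) > 0" using s by (simp add: inner_add_right)
      then show ?thesis using s by (auto simp: D_def)
    qed
    show ?thesis
    proof (rule that[OF conn[of a] conn[of "- a"]])
      show "ball y \<delta> - V \<subseteq> D a \<union> D (- a)" by (auto simp: D_def Va)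
      show "D a \<subseteq> ball y \<delta> - V" "D (- a) \<subseteq> ball y \<delta> - V" by (auto simp: D_def Va)
      show "N \<inter> D a \<noteq> {} \<and> N \<inter> D (- a) \<noteq> {}" if "z \<in> ball y \<delta> \<inter> V" "open N" "z \<in> N" for z N
        using acc[OF that] by blast
    qed
  qed
qed

lemma smooth_map_std_continuous:
  assumes "smooth_map std_chart std_chart X Y f"
  shows "continuous_on X f"
  unfolding continuous_on_topological
proof (intro ballI allI impI)
  fix x B assume x: "x \<in> X" "open B" "f x \<in> B"
  obtain W k where W: "open W" "x \<in> W" "smooth_on W k" "\<And>z. z \<in> X \<Longrightarrow> z \<in> W \<Longrightarrow> f z = k z"
    using smooth_map_stdD[OF assms x(1), of "(UNIV, \<lambda>x. x)"] by auto
  have "open (W \<inter> k -` B)"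
    using smooth_on_continuous_on[OF W(3)] W(1) x(2) by (simp add: continuous_on_open_vimage Int_commute)
  moreover have "x \<in> W \<inter> k -` B" using W x by auto
  ultimately show "\<exists>A. open A \<and> x \<in> A \<and> (\<forall>y\<in>X. y \<in> A \<longrightarrow> f y \<in> B)" using W(4) by (intro exI[of _ "W \<inter> k -` B"]) auto
qed

text \<open>As \<open>P\<close> avoids the boundary, the chart image contains a full ball around the
  point, and the inverse of the straightening transports the two sides of the linear model into
  \<Omega>.\<close>

lemma (in manifold) submanifold_sides:
  assumes dim: "CARD('m) = 2" and S: "submanifold \<Omega> A k P" "k < 2" and int: "P \<inter> mfd_boundary \<Omega> A = {}"
    and p: "p \<in> P"
  shows "\<exists>N D1 D2. openin (top_of_set \<Omega>) N \<and> p \<in> N \<and> N - P \<subseteq> D1 \<union> D2 \<and>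
      connected D1 \<and> connected D2 \<and> D1 \<subseteq> \<Omega> - P \<and> D2 \<subseteq> \<Omega> - P \<and> N \<inter> P \<subseteq> closure D1 \<inter> closure D2"
proof -
  obtain c and W :: "(real ^ 'm) set" and \<Psi> :: "real ^ 'm \<Rightarrow> real ^ 'm" and V where c: "c \<in> A" "p \<in> fst c"
    and W: "open W" "snd c p \<in> W" "open (\<Psi> ` W)" and dif: "diffeo std_chart std_chart W (\<Psi> ` W) \<Psi>"
    and V: "subspace V" "dim V = k" "\<Psi> ` (W \<inter> snd c ` (P \<inter> fst c)) = \<Psi> ` W \<inter> V"
    using S(1) p unfolding submanifold_def by metis
  define \<Phi> where "\<Phi> = inv_into W \<Psi>"
  have inj: "inj_on \<Psi> W" and cont\<Psi>: "continuous_on W \<Psi>" and cont\<Phi>: "continuous_on (\<Psi> ` W) \<Phi>"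
    using dif smooth_map_std_continuous unfolding diffeo_def \<Phi>_def bij_betw_def by blast+
  have \<Phi>\<Psi>: "\<Phi> (\<Psi> z) = z" if "z \<in> W" for z using inj that by (simp add: \<Phi>_def)
  have p\<Omega>: "p \<in> \<Omega>" using S(1) p unfolding submanifold_def by blast
  have "snd c p $ bd_index > 0"
    using mfd_boundary_iff[OF c] coord_nonneg[OF c] int p by (metis IntI empty_iff less_eq_real_def)
  then obtain e where e: "e > 0" "ball (snd c p) e \<subseteq> chart_image c"
    using interior_chart_ball[OF c _ chart_domain_open[OF c(1)] c(2)] by metis
  \<comment> \<open>The straightening lives on an open set of coordinate space that may reach
    outside the chart image; on \<open>W1\<close> every point is the coordinate of a point of
    \<Omega>.\<close>
  define W1 where "W1 = W \<inter> ball (snd c p) e"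
  have W1: "open W1" "snd c p \<in> W1" "W1 \<subseteq> W" "W1 \<subseteq> chart_image c" using W e by (auto simp: W1_def)
  have im1: "\<Psi> ` W1 = \<Phi> -` W1 \<inter> \<Psi> ` W"
    using \<Phi>\<Psi> W1(3) by (force simp: subset_iff)
  have "open (\<Psi> ` W1)"
    unfolding im1 using cont\<Phi> W(3) W1(1) by (simp add: continuous_on_open_vimage)
  then obtain \<delta> where \<delta>: "\<delta> > 0" "ball (\<Psi> (snd c p)) \<delta> \<subseteq> \<Psi> ` W1" using W1(2) openE by blast
  let ?b = "ball (\<Psi> (snd c p)) \<delta>"
  have bW: "?b \<subseteq> \<Psi> ` W" using \<delta> W1(3) by blast
  have \<Phi>b: "\<Phi> y \<in> W1" "\<Psi> (\<Phi> y) = y" if y: "y \<in> ?b" for y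
  proof -
    obtain z where "z \<in> W1" "y = \<Psi> z" using y \<delta>(2) by blast
    then show "\<Phi> y \<in> W1" "\<Psi> (\<Phi> y) = y" using \<Phi>\<Psi> W1(3) by auto
  qed
  define \<theta> where "\<theta> y = param c (\<Phi> y)" for y
  have \<theta>c: "\<theta> y \<in> fst c" "snd c (\<theta> y) = \<Phi> y" if "y \<in> ?b" for y
    using \<Phi>b(1)[OF that] W1(4) param_in[OF c(1)] coord_param[OF c(1)] by (auto simp: \<theta>_def)
  have \<theta>P: "\<theta> y \<in> P \<longleftrightarrow> y \<in> V" if y: "y \<in> ?b" for y
  proof
    assume "\<theta> y \<in> P"
    then have "\<Phi> y \<in> W \<inter> snd c ` (P \<inter> fst c)"
      using \<theta>c[OF y] \<Phi>b(1)[OF y] W1(3) image_eqI[of "\<Phi> y" "snd c" "\<theta> y"] by auto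
    from imageI[OF this, of \<Psi>] show "y \<in> V" unfolding V(3) \<Phi>b(2)[OF y] by simp
  next
    assume "y \<in> V"
    with y bW have "y \<in> \<Psi> ` W \<inter> V" by blast
    then have "y \<in> \<Psi> ` (W \<inter> snd c ` (P \<inter> fst c))" unfolding V(3) .
    then obtain z where z: "z \<in> W" "z \<in> snd c ` (P \<inter> fst c)" "y = \<Psi> z" by (rule imageE) blast
    then have "\<Phi> y = z" using \<Phi>\<Psi> by simp
    then show "\<theta> y \<in> P" using z(2) param_coord[OF c(1)] by (auto simp: \<theta>_def)
  qed
  have cont\<theta>: "continuous_on ?b \<theta>"
  proof -
    have "continuous_on (chart_image c) (param c)" using chart_homeo[OF c(1)] by (simp add: homeomorphism_def)
    moreover have "continuous_on ?b \<Phi>" using cont\<Phi> bW continuous_on_subset by blast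
    moreover have "\<Phi> ` ?b \<subseteq> chart_image c" using \<Phi>b(1) W1(4) by blast
    ultimately show ?thesis unfolding \<theta>_def using continuous_on_compose2 by blast
  qed
  have "snd c p \<in> W \<inter> snd c ` (P \<inter> fst c)" using W(2) c(2) p by blast
  from imageI[OF this, of \<Psi>] have "\<Psi> (snd c p) \<in> V" unfolding V(3) by simp
  then obtain D1 D2 where D: "connected D1" "connected D2" "D1 \<subseteq> ?b - V" "D2 \<subseteq> ?b - V" "?b - V \<subseteq> D1 \<union> D2"
    and acc: "\<And>z N. z \<in> ?b \<inter> V \<Longrightarrow> open N \<Longrightarrow> z \<in> N \<Longrightarrow> N \<inter> D1 \<noteq> {} \<and> N \<inter> D2 \<noteq> {}"
    using subspace_two_sides[OF V(1) _ _ _ \<delta>(1)] V(2) S(2) dim by auto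
  define N where "N = {q \<in> fst c. snd c q \<in> W1 \<inter> \<Psi> -` ?b}"
  have "open (W1 \<inter> \<Psi> -` ?b)"
    using continuous_on_subset[OF cont\<Psi> W1(3)] W1(1) by (simp add: continuous_on_open_vimage Int_commute)
  then have oN: "openin (top_of_set \<Omega>) N" unfolding N_def using coord_preimage_open[OF c(1)] by blast
  have pN: "p \<in> N" using c W1(2) \<delta>(1) by (simp add: N_def)
  have N\<theta>: "\<exists>y\<in>?b. q = \<theta> y" if q: "q \<in> N" for q
  proof -
    have "\<Phi> (\<Psi> (snd c q)) = snd c q" "\<Psi> (snd c q) \<in> ?b" using q \<Phi>\<Psi> W1(3) by (auto simp: N_def)
    then show ?thesis using param_coord[OF c(1)] q by (intro bexI[of _ "\<Psi> (snd c q)"]) (auto simp: \<theta>_def N_def)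
  qed
  have \<theta>\<Omega>: "\<theta> ` D \<subseteq> \<Omega> - P" if "D \<subseteq> ?b - V" for D
    using that \<theta>c(1) \<theta>P chart_domain[OF c(1)] by blast
  have cl: "\<theta> y \<in> closure (\<theta> ` D)" if y: "y \<in> ?b" and D: "D \<subseteq> ?b" and ac: "\<And>N. open N \<Longrightarrow> y \<in> N \<Longrightarrow> N \<inter> D \<noteq> {}" for y D
  proof -
    have "U \<inter> \<theta> ` D \<noteq> {}" if U: "open U" "\<theta> y \<in> U" for U
    proof -
      have "open (\<theta> -` U \<inter> ?b)" using cont\<theta> U(1) by (simp add: continuous_on_open_vimage)
      then have "(\<theta> -` U \<inter> ?b) \<inter> D \<noteq> {}" using ac U(2) y by blast
      then show ?thesis by blast
    qed
    then show ?thesis by (meson closure_iff_nhds_not_empty disjoint_iff subset_eq)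
  qed
  have "N - P \<subseteq> \<theta> ` D1 \<union> \<theta> ` D2" using N\<theta> \<theta>P D(5) by blast
  moreover have "N \<inter> P \<subseteq> closure (\<theta> ` D1) \<inter> closure (\<theta> ` D2)"
  proof
    fix q assume q: "q \<in> N \<inter> P"
    then obtain y where y: "y \<in> ?b" "q = \<theta> y" using N\<theta> by blast
    then have "y \<in> ?b \<inter> V" using q \<theta>P by blast
    then show "q \<in> closure (\<theta> ` D1) \<inter> closure (\<theta> ` D2)"
      using cl[OF y(1), of D1] cl[OF y(1), of D2] acc D(3,4) y(2) by blast
  qed
  moreover have "connected (\<theta> ` D1)" "connected (\<theta> ` D2)"
    using D cont\<theta> by (auto intro!: connected_continuous_image intro: continuous_on_subset)
  ultimately show ?thesis using oN pN \<theta>\<Omega>[OF D(3)] \<theta>\<Omega>[OF D(4)] by blast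
qed

section \<open>Bound on the number of boundary components\<close>

theorem smooth_tube_boundary_components:
  fixes A :: "('p::t2_space, real ^ 'm) chart set"
  assumes dim: "CARD('m::finite) = 2" and tube: "smooth_tube \<Omega> A g P R"
    and fin: "finite (components (mfd_boundary \<Omega> A))"
  shows "card (components (mfd_boundary \<Omega> A)) \<le> 2"
proof -
  have \<Omega>: "compact \<Omega>" "connected \<Omega>" and riem: "riemannian_manifold \<Omega> A g"
    and Pne: "P \<noteq> {}" and cP: "compact P" and R: "0 < R"
    using tube unfolding smooth_tube_def by blast+
  obtain k where k: "k < CARD('m)" "submanifold \<Omega> A k P" using tube unfolding smooth_tube_def by blast
  then have P\<Omega>: "P \<subseteq> \<Omega>" unfolding submanifold_def by blast
  obtain E where E: "\<forall>r\<in>{0<..R}. \<forall>(p, \<nu>)\<in>unit_normal_bundle A g P. is_exp \<Omega> A g p (\<lambda>c. r *\<^sub>R \<nu> c) (E (r, p, \<nu>))"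
    "diffeo (bundle_charts A) A ({0<..R} \<times> unit_normal_bundle A g P) (\<Omega> - P) E"
    using tube unfolding smooth_tube_def by blast
  interpret tube \<Omega> A g P R E
  proof unfold_locales
    show "smooth_manifold \<Omega> A" using riem unfolding riemannian_manifold_def by blast
    show "is_exp \<Omega> A g p (\<lambda>c. r *\<^sub>R \<nu> c) (E (r, p, \<nu>))"
      if "r \<in> {0<..R}" "(p, \<nu>) \<in> unit_normal_bundle A g P" for r p \<nu>
      using E(1) that by blast
  qed (rule riem \<Omega>(1) P\<Omega> cP R E(2))+
  obtain j where j: "(UNIV :: 'm set) = {bd_index, j}" "j \<noteq> bd_index"
  proof -
    obtain x y :: 'm where "UNIV = {x, y}" "x \<noteq> y" using dim by (meson card_2_iff)
    then show ?thesis using that by (cases "x = bd_index") (metis UNIV_I insertE insert_commute singletonD)+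
  qed
  show ?thesis
  proof (rule collar_components_le_2[OF \<Omega> P\<Omega> cP Pne compact_mfd_boundary[OF \<Omega>(1)] R collar_homeomorphism[OF j] _ fin])
    fix p assume "p \<in> P"
    then show "\<exists>N D1 D2. openin (top_of_set \<Omega>) N \<and> p \<in> N \<and> N - P \<subseteq> D1 \<union> D2 \<and>
      connected D1 \<and> connected D2 \<and> D1 \<subseteq> \<Omega> - P \<and> D2 \<subseteq> \<Omega> - P \<and> N \<inter> P \<subseteq> closure D1 \<inter> closure D2"
      using submanifold_sides[OF dim k(2) _ foot_interior] k(1) dim by simp
  qed
qed

section \<open>Free boundary hypersurfaces\<close>

lemma smooth_on_vec_lambda:
  fixes f :: "'a::real_normed_vector \<Rightarrow> 'i::finite \<Rightarrow> 'b::real_normed_vector"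
  assumes W: "open W" and f: "\<And>i. smooth_on W (\<lambda>z. f z i)"
  shows "smooth_on W (\<lambda>z. \<chi> i. f z i)"
proof -
  have "bounded_linear (axis i :: 'b \<Rightarrow> 'b ^ 'i)" for i
  proof (rule bounded_linear_intro[where K=1])
    show "axis i (x + y) = (axis i x + axis i y :: 'b ^ 'i)" for x y by (simp add: vec_eq_iff axis_def)
    show "axis i (r *\<^sub>R x) = (r *\<^sub>R axis i x :: 'b ^ 'i)" for r x by (simp add: vec_eq_iff axis_def)
    fix x :: 'b
    have "norm (axis i x :: 'b ^ 'i) \<le> (\<Sum>j\<in>UNIV. norm (axis i x $ j))"
      unfolding norm_vec_def by (rule L2_set_le_sum) simp
    also have "\<dots> = (\<Sum>j\<in>UNIV. if j = i then norm x else 0)" by (intro sum.cong) (auto simp: axis_def)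
    finally show "norm (axis i x :: 'b ^ 'i) \<le> norm x * 1" by simp
  qed
  then have "smooth_on W (\<lambda>z. \<Sum>i\<in>UNIV. axis i (f z i))"
    by (rule smooth_on_sum[OF W smooth_on_bounded_linear[OF _ W f]])
  moreover have "(\<Sum>i\<in>UNIV. axis i (f z i)) = (\<chi> i. f z i)" for z
    by (simp add: vec_eq_iff axis_def sum.delta)
  ultimately show ?thesis by simp
qed

lemma linear_axis_expansion:
  fixes f :: "real ^ 'm::finite \<Rightarrow> 'b::real_vector"
  assumes "linear f"
  shows "f u = (\<Sum>i\<in>UNIV. u $ i *\<^sub>R f (axis i 1))"
proof -
  have "u = (\<Sum>i\<in>UNIV. u $ i *\<^sub>R axis i 1)" using basis_expansion[of u] by (simp add: scalar_mult_eq_scaleR)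
  then have "f u = f (\<Sum>i\<in>UNIV. u $ i *\<^sub>R axis i 1)" by simp
  then show ?thesis by (simp add: linear_sum[OF assms] linear_scale[OF assms])
qed

lemma differentiable_prod:
  fixes f :: "'i \<Rightarrow> 'a::real_normed_vector \<Rightarrow> real"
  assumes "\<And>i. i \<in> I \<Longrightarrow> f i differentiable (at x)"
  shows "(\<lambda>z. \<Prod>i\<in>I. f i z) differentiable (at x)"
  using assms by (induction I rule: infinite_finite_induct) auto

lemma differentiable_det:
  fixes M :: "'a::real_normed_vector \<Rightarrow> real ^ 'm::finite ^ 'm"
  assumes "\<And>i j. (\<lambda>z. M z $ i $ j) differentiable (at x)"
  shows "(\<lambda>z. det (M z)) differentiable (at x)"
  unfolding det_def
  using assms by (auto intro!: differentiable_sum differentiable_mult differentiable_const differentiable_prod finite_permutations)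

lemma matrix_inv_det_nonzero:
  fixes M :: "real ^ 'm::finite ^ 'm"
  assumes "det M \<noteq> 0"
  shows "M ** matrix_inv M = mat 1" "matrix_inv M ** M = mat 1"
proof -
  have "\<exists>M'. M ** M' = mat 1 \<and> M' ** M = mat 1"
    using assms invertible_det_nz unfolding invertible_def by blast
  then show "M ** matrix_inv M = mat 1" "matrix_inv M ** M = mat 1"
    unfolding matrix_inv_def by (metis (mono_tags, lifting) someI_ex)+
qed

text \<open>Cramer's rule writes the solution as quotients of determinants. The representative
  \<open>Y\<close> equals the solution wherever the determinant is nonzero, so it can stand for a
  gradient on a whole chart neighbourhood.\<close>

lemma differentiable_matrix_inv_mult:
  fixes M :: "'a::real_normed_vector \<Rightarrow> real ^ 'm::finite ^ 'm" and b :: "'a \<Rightarrow> real ^ 'm"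
  assumes M: "\<And>i j. (\<lambda>z. M z $ i $ j) differentiable (at x)" and b: "\<And>i. (\<lambda>z. b z $ i) differentiable (at x)"
    and inv: "det (M x) \<noteq> 0"
  obtains Y where "Y differentiable (at x)" "\<And>z. det (M z) \<noteq> 0 \<Longrightarrow> matrix_inv (M z) *v b z = Y z"
proof -
  define N where "N k z = (\<chi> i j. if j = k then b z $ i else M z $ i $ j)" for k z
  define Y where "Y z = (\<chi> k. det (N k z) / det (M z))" for z
  have Nd: "(\<lambda>z. N k z $ i $ j) differentiable (at x)" for k i j
    using M b by (cases "j = k") (auto simp: N_def)
  have quot: "(\<lambda>z. det (N k z) / det (M z)) differentiable (at x)" for k
    by (rule differentiable_divide[OF differentiable_det[OF Nd] differentiable_det[OF M] inv])
  have "Y differentiable (at x)"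
  proof (rule differentiable_componentwise_within[THEN iffD2], intro ballI)
    fix i :: "real ^ 'm" assume "i \<in> Basis"
    then obtain l where "i = axis l 1" by (auto simp: Basis_vec_def)
    then show "(\<lambda>z. Y z \<bullet> i) differentiable (at x)" using quot[of l] by (simp add: inner_axis Y_def)
  qed
  moreover have "matrix_inv (M z) *v b z = Y z" if nz: "det (M z) \<noteq> 0" for z
  proof -
    have "M z ** matrix_inv (M z) = mat 1" using matrix_inv_det_nonzero(1)[OF nz] .
    then have "M z *v (matrix_inv (M z) *v b z) = b z" by (simp add: matrix_vector_mul_assoc)
    then show ?thesis using cramer[OF nz] by (simp add: Y_def N_def)
  qed
  ultimately show ?thesis using that by blast
qed

section \<open>Immersions, the induced metric and the Laplacian of the squared norm\<close>

locale immersed = manifold \<Omega> A for \<Omega> :: "'p::t2_space set" and A :: "('p, real ^ 'm::finite) chart set" +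
  fixes F :: "'p \<Rightarrow> real ^ 'n::finite"
  assumes F: "immersion \<Omega> A F"
begin

abbreviation "dF \<equiv> \<lambda>c p. chart_D c F p"

lemma F_local_rep:
  assumes c: "c \<in> A" "p \<in> fst c"
  obtains W k where "local_rep c p F W k"
proof -
  have sm: "smooth_map A std_chart \<Omega> UNIV F" using F unfolding immersion_def by blast
  have p: "p \<in> \<Omega>" using c chart_domain by blast
  obtain W k where "local_rep c p (\<lambda>q. snd (UNIV, \<lambda>x. x) (F q)) W k"
    by (rule smooth_map_local_rep[OF sm _ p c, of "(UNIV, \<lambda>x. x)"]) (auto intro: openin_subtopology_self)
  then show ?thesis using that by simp
qed

lemma dF_linear: "c \<in> A \<Longrightarrow> p \<in> fst c \<Longrightarrow> linear (dF c p)"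
  using F_local_rep local_rep_linear by metis

lemma dF_nonzero:
  assumes "c \<in> A" "p \<in> fst c" "u \<noteq> 0"
  shows "dF c p u \<noteq> 0"
proof -
  have "inj (dF c p)" using F assms unfolding immersion_def by blast
  then show ?thesis using assms(3) linear_injective_0[OF dF_linear[OF assms(1,2)]] by blast
qed

lemma induced_metric_inner:
  assumes c: "c \<in> A" "p \<in> fst c"
  shows "u \<bullet> (induced_metric F c p *v v) = dF c p u \<bullet> dF c p v"
proof -
  have "dF c p u \<bullet> dF c p v = (\<Sum>i\<in>UNIV. u $ i *\<^sub>R dF c p (axis i 1)) \<bullet> (\<Sum>j\<in>UNIV. v $ j *\<^sub>R dF c p (axis j 1))"
    using linear_axis_expansion[OF dF_linear[OF c]] by metis
  also have "\<dots> = (\<Sum>i\<in>UNIV. \<Sum>j\<in>UNIV. u $ i * (v $ j * (dF c p (axis i 1) \<bullet> dF c p (axis j 1))))"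
    by (subst sum.swap) (simp add: inner_sum_left inner_sum_right sum_distrib_left mult.left_commute)
  also have "\<dots> = u \<bullet> (induced_metric F c p *v v)"
    by (simp add: induced_metric_def matrix_vector_mult_def inner_vec_def[of u] sum_distrib_left mult_ac)
  finally show ?thesis by simp
qed

lemma induced_metric_pos:
  assumes c: "c \<in> A" "p \<in> fst c" "u \<noteq> 0"
  shows "0 < u \<bullet> (induced_metric F c p *v u)"
  using dF_nonzero[OF assms] induced_metric_inner[OF c(1,2)] by simp

lemma induced_metric_invertible:
  assumes c: "c \<in> A" "p \<in> fst c"
  shows "invertible (induced_metric F c p)"
proof -
  have "inj ((*v) (induced_metric F c p))"
    unfolding linear_injective_0[OF matrix_vector_mul_linear] using induced_metric_pos[OF c] by fastforce
  then show ?thesis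
    by (simp add: invertible_left_inverse matrix_left_invertible_injective)
qed

lemma riemannian_manifold_induced_metric: "riemannian_manifold \<Omega> A (induced_metric F)"
  unfolding riemannian_manifold_def
proof (intro conjI ballI allI impI manifold)
  fix c p assume c: "c \<in> A" "p \<in> fst c"
  show "transpose (induced_metric F c p) = induced_metric F c p"
    by (simp add: transpose_def induced_metric_def inner_commute)
  show "0 < u \<bullet> (induced_metric F c p *v u)" if "u \<noteq> 0" for u using induced_metric_pos[OF c that] .
next
  fix c d p u v assume c: "c \<in> A" and d: "d \<in> A" and p: "p \<in> fst c \<inter> fst d"
  have "dF c p w = dF d p (chart_D c (snd d) p w)" for w
    using F_local_rep[of d p] chart_D_chain[of c p d F] c d p by (metis IntD1 IntD2)
  then show "u \<bullet> (induced_metric F c p *v v) =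
      chart_D c (snd d) p u \<bullet> (induced_metric F d p *v chart_D c (snd d) p v)"
    using c d p by (simp add: induced_metric_inner)
next
  fix c assume c: "c \<in> A"
  \<comment> \<open>Smoothness of the Gram matrix in \<open>c\<close> is tested in every chart
    \<open>d\<close>, so the extension of \<open>F\<close> in \<open>c\<close> is differentiated
    there and pulled back along the transition map.\<close>
  have "\<exists>W k. open W \<and> snd d p \<in> W \<and> smooth_on W k \<and>
      (\<forall>q\<in>fst c \<inter> fst d. snd d q \<in> W \<longrightarrow> induced_metric F c q = k (snd d q))"
    if p: "p \<in> fst c" and d: "d \<in> A" "p \<in> fst d" for p d
  proof -
    obtain W k where k: "local_rep c p F W k" using F_local_rep[OF c p] by metis
    obtain W' t where t: "local_rep d p (snd c) W' t" "\<And>z. z \<in> W' \<inter> chart_image d \<Longrightarrow> param d z \<in> fst c \<and> snd c (param d z) = t z"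
      using transition_local_rep[OF d c p] by blast
    obtain V where V: "local_rep d p F V (\<lambda>z. k (t z))" "V \<subseteq> W'" "t ` V \<subseteq> W"
      using local_rep_change[OF d c p k t(1)] t(2) by metis
    have oV: "open V" "snd d p \<in> V" and oW: "open W" "smooth_on W k"
      using V(1) k by (auto simp: local_rep_def)
    have smt: "smooth_on V t" using t(1) V(2) smooth_on_subset by (auto simp: local_rep_def)
    define K where "K z = (\<chi> i j. frechet_derivative k (at (t z)) (axis i 1) \<bullet> frechet_derivative k (at (t z)) (axis j 1))" for z
    have "smooth_on V K"
      unfolding K_def
      by (rule smooth_on_vec_lambda[OF oV(1) smooth_on_vec_lambda[OF oV(1)
          smooth_on_bilinear[OF bounded_bilinear_inner oV(1)]]];
          rule smooth_on_compose[OF oV(1) oW(1) V(3) smt smooth_on_frechet_derivative[OF oW(2)]])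
    moreover have "induced_metric F c q = K (snd d q)" if q: "q \<in> fst c \<inter> fst d" "snd d q \<in> V" for q
    proof -
      have "snd c q = t (snd d q)" using t(2)[of "snd d q"] q V(2) param_coord[OF d(1), of q] by auto
      moreover have "t (snd d q) \<in> W" using V(3) q by blast
      ultimately have "dF c q = frechet_derivative k (at (t (snd d q)))"
        using local_rep_derivative[OF c _ local_rep_at(1)[OF c _ _ k]] q by (metis IntD1)
      then show ?thesis by (simp add: K_def induced_metric_def)
    qed
    ultimately show ?thesis using oV by blast
  qed
  then show "smooth_map A std_chart (fst c) UNIV (induced_metric F c)"
    by (simp add: smooth_map_def)
qed

text \<open>The gradient of \<open>- |F|\<^sup>2 / (2 m)\<close> is \<open>X = - F\<^sup>T / m\<close>. Differentiating \<open>g\<^sub>j\<^sub>a X\<^sup>a = - F \<bullet> F\<^sub>j / m\<close> in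
  the direction \<open>i\<close> and contracting with \<open>g\<^sup>i\<^sup>j\<close> gives \<open>div X = - 1 - H \<bullet> (dF X + F / m)\<close>, where
  \<open>H = g\<^sup>i\<^sup>j F\<^sub>i\<^sub>j\<close> and \<open>dF X + F / m\<close> is normal.\<close>

lemma laplacian_norm_square:
  assumes c: "c \<in> A" "p \<in> fst c"
    and mean: "\<And>n. unit_normal F c p n \<Longrightarrow> immersion_mean_curvature F c p n = 0"
  shows "laplacian (induced_metric F) (\<lambda>q. (1 - F q \<bullet> F q) / (2 * real CARD('m))) c p = 1"
proof -
  let ?m = "real CARD('m)" and ?g = "induced_metric F"
  have m: "?m > 0" by simp
  define v where "v q = (1 - F q \<bullet> F q) / (2 * ?m)" for q
  define x where "x = snd c p"
  obtain W k where k: "local_rep c p F W k" using F_local_rep[OF c] by metis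
  have W: "open W" "x \<in> W" and smk: "smooth_on W k" using k by (auto simp: local_rep_def x_def)
  let ?Dk = "\<lambda>z. frechet_derivative k (at z)"
  define k1 where "k1 j z = ?Dk z (axis j 1)" for j :: 'm and z
  define k2 where "k2 i j = frechet_derivative (k1 j) (at x) (axis i 1)" for i j :: 'm
  have smk1: "smooth_on W (k1 j)" for j unfolding k1_def using smooth_on_frechet_derivative[OF smk] .
  have dk: "(k has_derivative ?Dk z) (at z)" if "z \<in> W" for z using smooth_on_has_derivative[OF smk that] .
  have dk1: "(k1 j has_derivative frechet_derivative (k1 j) (at x)) (at x)" for j
    using smooth_on_has_derivative[OF smk1 W(2)] .
  have sym: "k2 i j = k2 j i" for i j
    unfolding k2_def k1_def using symmetric_second_derivative[OF smk W] .
  have chart: "param c z \<in> fst c" "snd c (param c z) = z" "F (param c z) = k z" "dF c (param c z) = ?Dk z"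
    if z: "z \<in> W \<inter> chart_image c" for z
  proof -
    show q: "param c z \<in> fst c" and sq: "snd c (param c z) = z"
      using param_in[OF c(1)] coord_param[OF c(1)] z by auto
    have "snd c (param c z) \<in> W" using sq z by simp
    from local_rep_at[OF c(1) q this k] show "F (param c z) = k z" "dF c (param c z) = ?Dk z"
      using local_rep_derivative[OF c(1) q] sq by auto
  qed
  have xim: "x \<in> W \<inter> chart_image c" and px: "param c x = p" using W c param_coord[OF c] by (auto simp: x_def)
  define G where "G z = (\<chi> i j. k1 i z \<bullet> k1 j z)" for z
  \<comment> \<open>The covariant components of the gradient, that is, the partial derivatives of
    \<open>v\<close>; \<open>Y\<close> below holds the contravariant ones.\<close>
  define b where "b z = (\<chi> j. - (k z \<bullet> k1 j z) / ?m)" for z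
  have Gz: "?g c (param c z) = G z" if "z \<in> W \<inter> chart_image c" for z
    unfolding induced_metric_def G_def chart(4)[OF that] k1_def ..
  have detG: "det (G z) \<noteq> 0" if "z \<in> W \<inter> chart_image c" for z
    using induced_metric_invertible[OF c(1) chart(1)[OF that]] Gz[OF that] invertible_det_nz by metis
  have dv: "chart_D c v (param c z) (axis j 1) = b z $ j" if z: "z \<in> W \<inter> chart_image c" for z j
  proof -
    have "((\<lambda>y. (1 - k y \<bullet> k y) / (2 * ?m)) has_derivative (\<lambda>h. - (k z \<bullet> ?Dk z h) / ?m)) (at z)"
      using dk z by (auto intro!: derivative_eq_intros simp: inner_commute field_simps)
    then have "chart_D c v (param c z) = (\<lambda>h. - (k z \<bullet> ?Dk z h) / ?m)"
      by (intro chart_D_eqI[OF c(1) chart(1)[OF z] W(1), where k="\<lambda>y. (1 - k y \<bullet> k y) / (2 * ?m)"])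
         (use z chart in \<open>auto simp: v_def\<close>)
    then show ?thesis by (simp add: b_def k1_def)
  qed
  have dG: "((\<lambda>z. G z $ i $ j) has_derivative
      (\<lambda>h. k1 i x \<bullet> frechet_derivative (k1 j) (at x) h + frechet_derivative (k1 i) (at x) h \<bullet> k1 j x)) (at x)" for i j
    unfolding G_def vec_lambda_beta by (rule has_derivative_inner[OF dk1 dk1])
  have db: "((\<lambda>z. b z $ j) has_derivative
      (\<lambda>h. - (k x \<bullet> frechet_derivative (k1 j) (at x) h + ?Dk x h \<bullet> k1 j x) / ?m)) (at x)" for j
    unfolding b_def vec_lambda_beta
    by (rule bounded_linear.has_derivative[OF bounded_linear_divide
          has_derivative_minus[OF has_derivative_inner[OF dk[OF W(2)] dk1]]])
  obtain Y where Y: "Y differentiable (at x)" "\<And>z. det (G z) \<noteq> 0 \<Longrightarrow> matrix_inv (G z) *v b z = Y z"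
    by (rule differentiable_matrix_inv_mult[where M=G and b=b, OF differentiableI[OF dG] differentiableI[OF db] detG[OF xim]]) blast
  define DY where "DY = frechet_derivative Y (at x)"
  have DY: "(Y has_derivative DY) (at x)" using Y(1) by (simp add: DY_def frechet_derivative_works)
  have grad: "gradient ?g v (param c z) c = Y z" if z: "z \<in> W \<inter> chart_image c" for z
    using Y(2)[OF detG[OF z]] dv[OF z] Gz[OF z] by (simp add: gradient_def)
  have Dgrad: "chart_D c (\<lambda>q. gradient ?g v q c) p = DY"
    by (rule chart_D_eqI[OF c, folded x_def, OF W DY grad])
  have GY: "G z *v Y z = b z" if z: "z \<in> W \<inter> chart_image c" for z
  proof -
    have "G z ** matrix_inv (G z) = mat 1" using matrix_inv_det_nonzero(1)[OF detG[OF z]] .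
    then show ?thesis by (simp add: Y(2)[OF detG[OF z], symmetric] matrix_vector_mul_assoc)
  qed
  define h where "h = matrix_inv (G x)"
  have hG: "h ** G x = mat 1" unfolding h_def using matrix_inv_det_nonzero(2)[OF detG[OF xim]] .
  have Gsym: "G x $ i $ j = G x $ j $ i" for i j by (simp add: G_def inner_commute)
  have Dg: "chart_D c (\<lambda>q. ?g c q $ j $ l) p (axis i 1) = k1 j x \<bullet> k2 i l + k2 i j \<bullet> k1 l x" for i j l
  proof -
    have "chart_D c (\<lambda>q. ?g c q $ j $ l) p =
      (\<lambda>h. k1 j x \<bullet> frechet_derivative (k1 l) (at x) h + frechet_derivative (k1 j) (at x) h \<bullet> k1 l x)"
      by (rule chart_D_eqI[OF c, folded x_def, OF W dG]) (simp add: Gz)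
    then show ?thesis by (simp add: k2_def)
  qed
  \<comment> \<open>By symmetry of second derivatives the three metric derivatives collapse to
    \<open>2 * (k2 i a \<bullet> k1 l x)\<close>. Only symbols with a repeated index enter the
    divergence.\<close>
  have chr: "christoffel ?g c p i i a = (\<Sum>l\<in>UNIV. h $ i $ l * (k2 i a \<bullet> k1 l x))" for i a
  proof -
    have comb: "(k1 a x \<bullet> k2 i l + k2 i a \<bullet> k1 l x) + (k1 i x \<bullet> k2 a l + k2 a i \<bullet> k1 l x) -
        (k1 i x \<bullet> k2 l a + k2 l i \<bullet> k1 a x) = 2 * (k2 i a \<bullet> k1 l x)" for l
      using sym[of a i] sym[of l a] sym[of l i] by (simp add: inner_commute)
    have "?g c p = G x" using Gz[OF xim] px by simp
    then have "christoffel ?g c p i i a = 1 / 2 * (\<Sum>l\<in>UNIV. h $ i $ l * (2 * (k2 i a \<bullet> k1 l x)))"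
      unfolding christoffel_def Dg h_def by (simp only: comb)
    also have "\<dots> = (\<Sum>l\<in>UNIV. h $ i $ l * (k2 i a \<bullet> k1 l x))"
      by (simp add: sum_distrib_left)
    finally show ?thesis .
  qed
  have div: "divergence ?g (gradient ?g v) c p =
      (\<Sum>i\<in>UNIV. DY (axis i 1) $ i + (\<Sum>a\<in>UNIV. christoffel ?g c p i i a * Y x $ a))"
  proof -
    have contract: "(\<Sum>i'\<in>UNIV. \<Sum>a\<in>UNIV. C i' a * axis i 1 $ i' * y a) = (\<Sum>a\<in>UNIV. C i a * y a)"
      for C :: "'m \<Rightarrow> 'm \<Rightarrow> real" and i y
    proof -
      have "(\<Sum>i'\<in>UNIV. \<Sum>a\<in>UNIV. C i' a * axis i 1 $ i' * y a) =
          (\<Sum>i'\<in>UNIV. if i' = i then \<Sum>a\<in>UNIV. C i' a * y a else 0)"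
        by (intro sum.cong) (auto simp: axis_def)
      then show ?thesis by simp
    qed
    have "gradient ?g v p c = Y x" using grad[OF xim] px by simp
    then show ?thesis unfolding divergence_def cov_deriv_def by (simp add: Dgrad contract)
  qed
  \<comment> \<open>Differentiation of \<open>G Y = b\<close> in direction \<open>i\<close>. The
    equation is known on the chart image only, so both sides are compared as \<open>chart_D\<close>
    of the same function.\<close>
  have ident: "(\<Sum>a\<in>UNIV. (k1 j x \<bullet> k2 i a) * Y x $ a + (k2 i j \<bullet> k1 a x) * Y x $ a + G x $ j $ a * DY (axis i 1) $ a) =
      - (k x \<bullet> k2 i j + G x $ i $ j) / ?m" for i j
  proof -
    have DYa: "((\<lambda>z. Y z $ a) has_derivative (\<lambda>h. DY h $ a)) (at x)" for a
      by (rule bounded_linear.has_derivative[OF bounded_linear_vec_nth DY])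
    have "((\<lambda>z. \<Sum>a\<in>UNIV. G z $ j $ a * Y z $ a) has_derivative
       (\<lambda>h. \<Sum>a\<in>UNIV. G x $ j $ a * DY h $ a +
         (k1 j x \<bullet> frechet_derivative (k1 a) (at x) h + frechet_derivative (k1 j) (at x) h \<bullet> k1 a x) * Y x $ a)) (at x)"
      by (rule has_derivative_sum has_derivative_mult dG DYa)+
    from chart_D_eqI[OF c, folded x_def, OF W this, of "\<lambda>q. b (snd c q) $ j"]
    have "chart_D c (\<lambda>q. b (snd c q) $ j) p = (\<lambda>h. \<Sum>a\<in>UNIV. G x $ j $ a * DY h $ a +
         (k1 j x \<bullet> frechet_derivative (k1 a) (at x) h + frechet_derivative (k1 j) (at x) h \<bullet> k1 a x) * Y x $ a)"
      using GY chart(2) by (simp add: matrix_vector_mult_def vec_eq_iff)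
    moreover from chart_D_eqI[OF c, folded x_def, OF W db, of "\<lambda>q. b (snd c q) $ j"]
    have "chart_D c (\<lambda>q. b (snd c q) $ j) p =
       (\<lambda>h. - (k x \<bullet> frechet_derivative (k1 j) (at x) h + ?Dk x h \<bullet> k1 j x) / ?m)"
      using chart(2) by simp
    ultimately have "(\<Sum>a\<in>UNIV. G x $ j $ a * DY (axis i 1) $ a + (k1 j x \<bullet> k2 i a + k2 i j \<bullet> k1 a x) * Y x $ a) =
        - (k x \<bullet> k2 i j + k1 i x \<bullet> k1 j x) / ?m"
      unfolding k2_def k1_def[of i x] by metis
    then show ?thesis by (simp add: G_def algebra_simps)
  qed
  \<comment> \<open>\<open>T\<close> is the differential of \<open>F\<close> applied to the
    gradient, minus the tangential part of \<open>F / m\<close>; hence \<open>n0\<close> is the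
    normal part of \<open>F / m\<close>. \<open>S\<close> is the metric trace of the second
    derivatives of \<open>F\<close>.\<close>
  define T where "T = (\<Sum>a\<in>UNIV. Y x $ a *\<^sub>R k1 a x)"
  define n0 where "n0 = T + (1 / ?m) *\<^sub>R k x"
  define S where "S = (\<Sum>i\<in>UNIV. \<Sum>j\<in>UNIV. h $ i $ j *\<^sub>R k2 i j)"
  have n0: "n0 \<bullet> k1 j x = 0" for j
  proof -
    have "T \<bullet> k1 j x = (G x *v Y x) $ j"
      by (simp add: T_def inner_sum_left matrix_vector_mult_def G_def inner_commute[of "k1 j x"] mult.commute)
    then show ?thesis using GY[OF xim] by (simp add: n0_def inner_add_left b_def)
  qed
  \<comment> \<open>Minimality concerns unit normals, so \<open>n0\<close> has to be normalized and
    the case \<open>n0 = 0\<close> set apart.\<close>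
  have S: "S \<bullet> n0 = 0"
  proof (cases "n0 = 0")
    case False
    define n where "n = (1 / norm n0) *\<^sub>R n0"
    have "n \<bullet> dF c p u = 0" for u
      using linear_axis_expansion[OF dF_linear[OF c], of u] n0 chart(4)[OF xim] px
      by (simp add: n_def inner_sum_right k1_def)
    then have "unit_normal F c p n" using False by (simp add: unit_normal_def n_def)
    moreover have "second_fundamental_form F c p n $ i $ j = k2 i j \<bullet> n" for i j
    proof -
      have "chart_D c (\<lambda>q. dF c q (axis j 1)) p = frechet_derivative (k1 j) (at x)"
        by (rule chart_D_eqI[OF c, folded x_def, OF W dk1]) (simp add: chart k1_def)
      then show ?thesis by (simp add: second_fundamental_form_def k2_def)
    qed
    moreover have "?g c p = G x" using Gz[OF xim] px by simp
    ultimately have "1 / ?m * (\<Sum>i\<in>UNIV. \<Sum>j\<in>UNIV. h $ i $ j * (k2 i j \<bullet> n)) = 0"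
      using mean[of n] by (simp add: immersion_mean_curvature_def h_def)
    then have "S \<bullet> n = 0" using m by (simp add: S_def inner_sum_left)
    then show ?thesis using False by (simp add: n_def)
  qed simp
  \<comment> \<open>Trace of \<open>ident\<close>: the first sum becomes the Christoffel part of the
    divergence, the second \<open>S \<bullet> T\<close>, the third the trace of \<open>DY\<close>;
    on the right, \<open>G\<close> contracted with its inverse gives \<open>m\<close>, hence the 1.
    The terms with \<open>S\<close> cancel.\<close>
  let ?sum = "\<lambda>f. \<Sum>i\<in>UNIV. \<Sum>j\<in>UNIV. h $ i $ j * f i j"
  have "?sum (\<lambda>i j. \<Sum>a\<in>UNIV. (k1 j x \<bullet> k2 i a) * Y x $ a + (k2 i j \<bullet> k1 a x) * Y x $ a + G x $ j $ a * DY (axis i 1) $ a) =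
      ?sum (\<lambda>i j. - (k x \<bullet> k2 i j + G x $ i $ j) / ?m)"
    using ident by simp
  moreover have "?sum (\<lambda>i j. \<Sum>a\<in>UNIV. (k1 j x \<bullet> k2 i a) * Y x $ a + (k2 i j \<bullet> k1 a x) * Y x $ a + G x $ j $ a * DY (axis i 1) $ a) =
      ?sum (\<lambda>i j. \<Sum>a\<in>UNIV. (k1 j x \<bullet> k2 i a) * Y x $ a) + ?sum (\<lambda>i j. \<Sum>a\<in>UNIV. (k2 i j \<bullet> k1 a x) * Y x $ a) +
      ?sum (\<lambda>i j. \<Sum>a\<in>UNIV. G x $ j $ a * DY (axis i 1) $ a)"
    by (simp add: sum.distrib distrib_left)
  moreover have "?sum (\<lambda>i j. \<Sum>a\<in>UNIV. (k1 j x \<bullet> k2 i a) * Y x $ a) =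
      (\<Sum>i\<in>UNIV. \<Sum>a\<in>UNIV. christoffel ?g c p i i a * Y x $ a)"
  proof (rule sum.cong[OF refl])
    fix i
    have "(\<Sum>j\<in>UNIV. h $ i $ j * (\<Sum>a\<in>UNIV. (k1 j x \<bullet> k2 i a) * Y x $ a)) =
        (\<Sum>a\<in>UNIV. \<Sum>j\<in>UNIV. h $ i $ j * (k2 i a \<bullet> k1 j x) * Y x $ a)"
      unfolding sum_distrib_left by (subst sum.swap) (simp add: inner_commute mult.assoc)
    then show "(\<Sum>j\<in>UNIV. h $ i $ j * (\<Sum>a\<in>UNIV. (k1 j x \<bullet> k2 i a) * Y x $ a)) =
        (\<Sum>a\<in>UNIV. christoffel ?g c p i i a * Y x $ a)"
      by (simp add: chr sum_distrib_right)
  qed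
  moreover have "?sum (\<lambda>i j. \<Sum>a\<in>UNIV. (k2 i j \<bullet> k1 a x) * Y x $ a) = S \<bullet> T"
  proof -
    have "(\<Sum>a\<in>UNIV. (k2 i j \<bullet> k1 a x) * Y x $ a) = k2 i j \<bullet> T" for i j
      by (simp add: T_def inner_sum_right mult.commute)
    then show ?thesis by (simp add: S_def inner_sum_left)
  qed
  moreover have "?sum (\<lambda>i j. \<Sum>a\<in>UNIV. G x $ j $ a * DY (axis i 1) $ a) = (\<Sum>i\<in>UNIV. DY (axis i 1) $ i)"
  proof (rule sum.cong[OF refl])
    fix i
    have "(\<Sum>j\<in>UNIV. h $ i $ j * (\<Sum>a\<in>UNIV. G x $ j $ a * DY (axis i 1) $ a)) = (h *v (G x *v DY (axis i 1))) $ i"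
      by (simp add: matrix_vector_mult_def)
    then show "(\<Sum>j\<in>UNIV. h $ i $ j * (\<Sum>a\<in>UNIV. G x $ j $ a * DY (axis i 1) $ a)) = DY (axis i 1) $ i"
      by (simp add: matrix_vector_mul_assoc hG)
  qed
  moreover have "?sum (\<lambda>i j. - (k x \<bullet> k2 i j + G x $ i $ j) / ?m) = - (S \<bullet> k x) / ?m - 1"
  proof -
    have "?sum (\<lambda>i j. G x $ i $ j) = (\<Sum>i\<in>UNIV. (h ** G x) $ i $ i)"
      by (simp add: matrix_matrix_mult_def Gsym)
    also have "\<dots> = ?m" by (simp add: hG mat_def)
    finally have tr: "?sum (\<lambda>i j. G x $ i $ j) = ?m" .
    have "?sum (\<lambda>i j. - (k x \<bullet> k2 i j + G x $ i $ j) / ?m) = - (?sum (\<lambda>i j. k x \<bullet> k2 i j + G x $ i $ j) / ?m)"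
      unfolding sum_divide_distrib sum_negf[symmetric] using m by (intro sum.cong refl) (simp add: field_simps)
    also have "?sum (\<lambda>i j. k x \<bullet> k2 i j + G x $ i $ j) = S \<bullet> k x + ?sum (\<lambda>i j. G x $ i $ j)"
      by (simp add: S_def inner_sum_left distrib_left sum.distrib inner_commute[of "k x"])
    finally show ?thesis unfolding tr using m by (simp add: field_simps)
  qed
  moreover have "S \<bullet> T = - (S \<bullet> k x) / ?m" using S by (simp add: n0_def inner_add_right)
  ultimately have "divergence ?g (gradient ?g v) c p = - 1"
    unfolding div sum.distrib by simp
  then show ?thesis by (simp add: laplacian_def v_def[abs_def])
qed

text \<open>The inward normal is tested against velocities of curves defined on all of
  \<open>(-1, 1)\<close>, so the coordinate line is slowed down until it stays in the chart. The
  factor \<open>e\<close> is harmless, since only orthogonality is read off.\<close>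

lemma boundary_coordinate_tangent:
  assumes c: "c \<in> A" "p \<in> fst c" and p: "snd c p $ bd_index = 0" and j: "j \<noteq> bd_index"
  obtains e w where "e > 0" "w \<in> sub_tangent A (mfd_boundary \<Omega> A) p" "w \<in> tangent_space A p" "w c = e *\<^sub>R axis j 1"
proof -
  obtain e where e: "e > 0" "\<And>z. z \<in> half_space \<Longrightarrow> dist z (snd c p) < e \<Longrightarrow> z \<in> chart_image c"
    using chart_nbhd[OF c chart_domain_open[OF c(1)] c(2)] by metis
  define b where "b = (e / 2) *\<^sub>R (axis j 1 :: real ^ 'm)"
  have nb: "norm b < e" using e by (simp add: b_def)
  define x where "x s = snd c p + s *\<^sub>R b" for s :: real
  let ?I = "{-1<..<1::real}"
  have xbd: "x s $ bd_index = 0" for s using p j by (simp add: x_def b_def axis_def)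
  have xim: "x s \<in> chart_image c" if "s \<in> ?I" for s
  proof (rule e(2))
    show "x s \<in> half_space" using xbd by (simp add: half_space_def)
    have "\<bar>s\<bar> * norm b \<le> 1 * norm b" using that by (intro mult_right_mono) auto
    then show "dist (x s) (snd c p) < e" using nb by (simp add: x_def dist_norm)
  qed
  have smx: "smooth_on V x" if "open V" for V
    unfolding x_def
    by (rule smooth_on_add[OF that smooth_on_const smooth_on_linear[OF bounded_linear_scaleR_left]])
  define \<gamma> where "\<gamma> s = param c (x s)" for s
  have \<gamma>c: "\<gamma> s \<in> fst c" "snd c (\<gamma> s) = x s" if "s \<in> ?I" for s
    using param_in[OF c(1) xim[OF that]] coord_param[OF c(1) xim[OF that]] by (auto simp: \<gamma>_def)
  have "\<exists>W k. open W \<and> s \<in> W \<and> smooth_on W k \<and> (\<forall>r\<in>?I. r \<in> W \<longrightarrow> \<gamma> r \<in> fst d \<and> snd d (\<gamma> r) = k r)"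
    if s: "s \<in> ?I" and d: "d \<in> A" "\<gamma> s \<in> fst d" for s d
  proof -
    obtain W t where t: "local_rep c (\<gamma> s) (snd d) W t" "\<And>z. z \<in> W \<inter> chart_image c \<Longrightarrow> param c z \<in> fst d \<and> snd d (param c z) = t z"
      using transition_local_rep[OF c(1) \<gamma>c(1)[OF s] d] by blast
    have W: "open W" "x s \<in> W" "smooth_on W t" using t(1) \<gamma>c(2)[OF s] by (auto simp: local_rep_def)
    have V: "open (x -` W)" unfolding x_def using W(1) by (intro open_vimage continuous_intros)
    have "smooth_on (x -` W) (\<lambda>r. t (x r))"
      by (rule smooth_on_compose[OF V W(1) _ smx[OF V] W(3)]) auto
    moreover have "\<gamma> r \<in> fst d \<and> snd d (\<gamma> r) = t (x r)" if "r \<in> ?I" "r \<in> x -` W" for r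
      using t(2)[of "x r"] xim[OF that(1)] that(2) by (simp add: \<gamma>_def)
    ultimately show ?thesis using V W(2) by (intro exI[of _ "x -` W"] exI[of _ "\<lambda>r. t (x r)"]) auto
  qed
  moreover have "\<gamma> ` ?I \<subseteq> mfd_boundary \<Omega> A"
    using mfd_boundary_iff[OF c(1)] \<gamma>c xbd by auto
  ultimately have sm: "smooth_map std_chart A ?I (mfd_boundary \<Omega> A) \<gamma>"
    unfolding smooth_map_def by simp
  have \<gamma>0: "\<gamma> 0 = p" using param_coord[OF c] by (simp add: \<gamma>_def x_def)
  have nontriv: "at 0 within ?I \<noteq> bot" using at_within_open[of 0 ?I] by simp
  have "((\<lambda>s. x s) has_vector_derivative b) (at 0 within ?I)"
    unfolding x_def has_vector_derivative_def by (auto intro!: derivative_eq_intros)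
  then have "((snd c \<circ> \<gamma>) has_vector_derivative b) (at 0 within ?I)"
    by (rule has_vector_derivative_transform[rotated 2]) (use \<gamma>c(2) in auto)
  moreover have "((snd c \<circ> \<gamma>) has_vector_derivative velocity A ?I \<gamma> 0 c) (at 0 within ?I)"
    by (rule curve_has_derivative[OF sm _ c(1) _ nontriv]) (use \<gamma>0 c(2) in auto)
  ultimately have "velocity A ?I \<gamma> 0 c = b"
    using vector_derivative_unique_within[OF nontriv] by blast
  moreover have "velocity A ?I \<gamma> 0 \<in> tangent_space A (\<gamma> 0)"
    by (rule velocity_tangent[OF sm _ nontriv]) simp
  moreover have "velocity A ?I \<gamma> 0 \<in> sub_tangent A (mfd_boundary \<Omega> A) p"
    unfolding sub_tangent_def using sm \<gamma>0 by blast
  ultimately show ?thesis using that[of "e / 2" "velocity A ?I \<gamma> 0"] e \<gamma>0 by (simp add: b_def)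
qed

text \<open>\<open>y\<close> solves the normal equations for projecting \<open>F p\<close> to the
  tangent plane, so the remainder \<open>n0\<close> is normal. Orthogonality makes
  \<open>n0 \<bullet> F p\<close> vanish, and this number is \<open>n0 \<bullet> n0\<close>.\<close>

lemma tangential_position:
  assumes c: "c \<in> A" "p \<in> fst c" and orth: "\<And>n. unit_normal F c p n \<Longrightarrow> n \<bullet> F p = 0"
  obtains y where "F p = dF c p y"
proof -
  obtain y where y: "induced_metric F c p *v y = (\<chi> j. F p \<bullet> dF c p (axis j 1))"
    using positive_definite_solve[OF induced_metric_pos[OF c]] by metis
  define n0 where "n0 = F p - dF c p y"
  have n0: "n0 \<bullet> dF c p u = 0" for u
  proof -
    have "dF c p y \<bullet> dF c p u = u \<bullet> (\<chi> j. F p \<bullet> dF c p (axis j 1))"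
      using induced_metric_inner[OF c, of u y] y by (simp add: inner_commute)
    also have "\<dots> = F p \<bullet> dF c p u"
      using linear_axis_expansion[OF dF_linear[OF c], of u] by (simp add: inner_vec_def[of u] inner_sum_right)
    finally show ?thesis by (simp add: n0_def inner_diff_left)
  qed
  have "n0 = 0"
  proof (rule ccontr)
    assume nz: "n0 \<noteq> 0"
    then have "unit_normal F c p ((1 / norm n0) *\<^sub>R n0)" using n0 by (simp add: unit_normal_def)
    then have "n0 \<bullet> F p = 0" using orth nz by fastforce
    moreover have "n0 \<bullet> F p = n0 \<bullet> n0" using n0[of y] by (simp add: n0_def inner_diff_right)
    ultimately show False using nz by simp
  qed
  then show ?thesis using that by (simp add: n0_def)
qed

text \<open>Both \<open>F p\<close> and \<open>dF \<nu>\<close> are unit tangent vectors orthogonal to the boundary, hence equal up to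
  sign.\<close>

lemma inward_normal_position:
  assumes sphere: "F ` mfd_boundary \<Omega> A \<subseteq> sphere 0 1" and ball: "F ` \<Omega> \<subseteq> cball 0 1"
    and p: "p \<in> mfd_boundary \<Omega> A" and c: "c \<in> A" "p \<in> fst c"
    and orth: "\<And>n. unit_normal F c p n \<Longrightarrow> n \<bullet> F p = 0"
    and \<nu>: "inward_unit_normal \<Omega> A (induced_metric F) p \<nu>"
  shows "F p \<bullet> dF c p (\<nu> c) = - 1"
proof -
  let ?i = "bd_index :: 'm"
  have lin: "linear (dF c p)" using dF_linear[OF c] .
  have bd: "snd c p $ ?i = 0" using mfd_boundary_iff[OF c] p by blast
  have riem: "riemannian_manifold \<Omega> A (induced_metric F)" by (rule riemannian_manifold_induced_metric)
  define u where "u = \<nu> c"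
  have \<nu>t: "\<nu> \<in> tangent_space A p" and ubd: "u $ ?i > 0" using \<nu> c by (auto simp: inward_unit_normal_def u_def)
  have uu: "dF c p u \<bullet> dF c p u = 1"
    using \<nu> rinner_chart[OF riem c \<nu>t \<nu>t] induced_metric_inner[OF c]
    by (simp add: inward_unit_normal_def u_def)
  obtain W k where k: "local_rep c p F W k" using F_local_rep[OF c] by metis
  have W: "open W" "snd c p \<in> W" "smooth_on W k" and eqk: "\<And>z. z \<in> W \<inter> chart_image c \<Longrightarrow> F (param c z) = k z"
    using k by (auto simp: local_rep_def)
  have kp: "k (snd c p) = F p" using local_rep_at(2)[OF c W(2) k] by simp
  obtain e0 where e0: "e0 > 0" "\<And>z. z \<in> half_space \<Longrightarrow> dist z (snd c p) < e0 \<Longrightarrow> z \<in> chart_image c"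
    using chart_nbhd[OF c chart_domain_open[OF c(1)] c(2)] by metis
  \<comment> \<open>Derivative of \<open>|F|^2\<close> along a coordinate line; the extension
    \<open>k\<close> makes it two-sided although the line may leave the half-space.\<close>
  have Dsq: "((\<lambda>s. k (snd c p + s *\<^sub>R w) \<bullet> k (snd c p + s *\<^sub>R w)) has_vector_derivative 2 * (F p \<bullet> dF c p w)) (at 0)" for w
  proof -
    have "(k has_derivative dF c p) (at (snd c p + 0 *\<^sub>R w))"
      using smooth_on_has_derivative[OF W(3,2)] local_rep_derivative[OF c k] by simp
    moreover have "((\<lambda>s. snd c p + s *\<^sub>R w) has_derivative (\<lambda>h. h *\<^sub>R w)) (at 0)"
      by (auto intro!: derivative_eq_intros)
    ultimately have "((\<lambda>s. k (snd c p + s *\<^sub>R w)) has_derivative (\<lambda>h. dF c p (h *\<^sub>R w))) (at 0)"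
      using diff_chain_at[of "\<lambda>s. snd c p + s *\<^sub>R w" _ 0 k] by (simp add: o_def)
    from has_derivative_inner[OF this this] show ?thesis
      by (simp add: has_vector_derivative_def kp linear_scale[OF lin] inner_commute mult.left_commute)
  qed
  define Z where "Z w = (\<lambda>s. snd c p + s *\<^sub>R w) -` (W \<inter> ball (snd c p) e0)" for w
  have Z: "open (Z w)" "0 \<in> Z w" for w
    unfolding Z_def using W e0 by (auto intro!: open_vimage continuous_intros)
  have Zim: "snd c p + s *\<^sub>R w \<in> W \<inter> chart_image c" if "s \<in> Z w" "snd c p + s *\<^sub>R w \<in> half_space" for s w
    using that e0(2) by (auto simp: Z_def dist_commute)
  have tang: "F p \<bullet> dF c p (axis j 1) = 0" "dF c p u \<bullet> dF c p (axis j 1) = 0" if j: "j \<noteq> ?i" for j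
  proof -
    have "((\<lambda>s. 1) has_vector_derivative 2 * (F p \<bullet> dF c p (axis j 1))) (at 0)"
      unfolding has_vector_derivative_def
    proof (rule has_derivative_transform_near[OF Dsq[of "axis j 1", unfolded has_vector_derivative_def] Z])
      fix s assume s: "s \<in> Z (axis j 1)"
      let ?z = "snd c p + s *\<^sub>R axis j 1"
      have zbd: "?z $ ?i = 0" using bd j by (simp add: axis_def)
      then have z: "?z \<in> W \<inter> chart_image c" using Zim[OF s] by (simp add: half_space_def)
      have "param c ?z \<in> mfd_boundary \<Omega> A"
        using mfd_boundary_iff[OF c(1) param_in[OF c(1)]] coord_param[OF c(1)] z zbd by auto
      then have "norm (F (param c ?z)) = 1" using sphere by auto
      then show "k ?z \<bullet> k ?z = 1" using eqk[OF z] by (simp add: norm_eq_1)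
    qed simp
    from vector_derivative_unique_at[OF this has_vector_derivative_const[of 1 "at 0"]]
    show "F p \<bullet> dF c p (axis j 1) = 0" by simp
    obtain e w where w: "e > 0" "w \<in> sub_tangent A (mfd_boundary \<Omega> A) p" "w \<in> tangent_space A p" "w c = e *\<^sub>R axis j 1"
      using boundary_coordinate_tangent[OF c bd j] .
    have "rinner A (induced_metric F) p \<nu> w = 0" using \<nu> w(2) by (simp add: inward_unit_normal_def)
    then have "dF c p u \<bullet> dF c p (e *\<^sub>R axis j 1) = 0"
      using rinner_chart[OF riem c \<nu>t w(3)] induced_metric_inner[OF c] w(4) by (simp add: u_def)
    then show "dF c p u \<bullet> dF c p (axis j 1) = 0" using w(1) linear_scale[OF lin] by simp
  qed
  have normal_only: "a \<bullet> dF c p w = w $ ?i * (a \<bullet> dF c p (axis ?i 1))"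
    if "\<And>j. j \<noteq> ?i \<Longrightarrow> a \<bullet> dF c p (axis j 1) = 0" for a w
  proof -
    have "a \<bullet> dF c p w = (\<Sum>j\<in>UNIV. w $ j * (a \<bullet> dF c p (axis j 1)))"
      using linear_axis_expansion[OF lin, of w] by (simp add: inner_sum_right)
    also have "\<dots> = (\<Sum>j\<in>UNIV. if j = ?i then w $ ?i * (a \<bullet> dF c p (axis ?i 1)) else 0)"
      using that by (intro sum.cong) auto
    finally show ?thesis by simp
  qed
  obtain y where y: "F p = dF c p y" using tangential_position[OF c orth] by metis
  \<comment> \<open>\<open>F p \<bullet> dF c p u\<close> equals both
    \<open>u $ ?i * \<alpha>\<close> and \<open>y $ ?i * \<beta>\<close>, while unit length says
    \<open>y $ ?i * \<alpha> = 1\<close> and \<open>u $ ?i * \<beta> = 1\<close>. Multiplying the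
    two expressions gives the square 1.\<close>
  define \<alpha> where "\<alpha> = F p \<bullet> dF c p (axis ?i 1)"
  define \<beta> where "\<beta> = dF c p u \<bullet> dF c p (axis ?i 1)"
  have "F p \<bullet> F p = 1" using sphere p by (auto simp: norm_eq_1[symmetric])
  then have 1: "y $ ?i * \<alpha> = 1" using normal_only[of "F p" y] tang(1) y by (simp add: \<alpha>_def)
  have 2: "u $ ?i * \<beta> = 1" using normal_only[of "dF c p u" u] tang(2) uu by (simp add: \<beta>_def)
  have 3: "F p \<bullet> dF c p u = u $ ?i * \<alpha>" using normal_only[of "F p" u] tang(1) by (simp add: \<alpha>_def)
  have 4: "F p \<bullet> dF c p u = y $ ?i * \<beta>"
    using normal_only[of "dF c p u" y] tang(2) y by (simp add: \<beta>_def inner_commute)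
  have "(F p \<bullet> dF c p u) * (F p \<bullet> dF c p u) = (u $ ?i * \<alpha>) * (y $ ?i * \<beta>)" using 3 4 by simp
  also have "\<dots> = (y $ ?i * \<alpha>) * (u $ ?i * \<beta>)" by (simp add: mult_ac)
  finally have sq: "(F p \<bullet> dF c p u)\<^sup>2 = 1" using 1 2 by (simp add: power2_eq_square)
  \<comment> \<open>The sign: \<open>|F|^2\<close> is at most 1 on \<Omega> and equals 1 at
    \<open>p\<close>, while \<open>u\<close> points into the half-space, so it cannot increase along
    \<open>u\<close>.\<close>
  have "((\<lambda>s. - (k (snd c p + s *\<^sub>R u) \<bullet> k (snd c p + s *\<^sub>R u))) has_vector_derivative - (2 * (F p \<bullet> dF c p u))) (at 0 within {0..})"
    using has_vector_derivative_minus[OF Dsq[of u]] has_vector_derivative_at_within by blast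
  then have "0 \<le> - (2 * (F p \<bullet> dF c p u))"
  proof (rule deriv_nonneg_right[OF _ _ _ Z, where e=1])
    fix s :: real assume s: "s \<in> {0..}" "s \<in> Z u"
    let ?z = "snd c p + s *\<^sub>R u"
    have "?z \<in> half_space" using s(1) bd ubd by (simp add: half_space_def)
    then have z: "?z \<in> W \<inter> chart_image c" using Zim[OF s(2)] by blast
    then have "param c ?z \<in> \<Omega>" using param_in[OF c(1)] chart_domain[OF c(1)] by blast
    then have "norm (k ?z) \<le> 1" using ball eqk[OF z] by auto
    then have "k ?z \<bullet> k ?z \<le> 1" by (simp add: dot_square_norm power_le_one)
    then show "- (k (snd c p + 0 *\<^sub>R u) \<bullet> k (snd c p + 0 *\<^sub>R u)) \<le> - (k ?z \<bullet> k ?z)"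
      using kp \<open>F p \<bullet> F p = 1\<close> by simp
  qed auto
  then have "F p \<bullet> dF c p u \<le> 0" by simp
  then show ?thesis using sq by (auto simp: power2_eq_1_iff u_def)
qed

end

section \<open>The explicit solution of the overdetermined problem\<close>

theorem free_boundary_harmonic_domain:
  fixes \<Omega> :: "'p::t2_space set" and A :: "('p, real ^ 'm::finite) chart set" and F :: "'p \<Rightarrow> real ^ 'n::finite"
  assumes "minimal_free_boundary_hypersurface \<Omega> A F"
  shows "harmonic_domain \<Omega> A (induced_metric F)"
proof -
  note hyp = assms[unfolded minimal_free_boundary_hypersurface_def]
  interpret immersed \<Omega> A F using hyp by unfold_locales auto
  have sphere: "F ` mfd_boundary \<Omega> A \<subseteq> sphere 0 1" and ball: "F ` \<Omega> \<subseteq> cball 0 1"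
    and mean: "\<And>c p n. c \<in> A \<Longrightarrow> p \<in> fst c \<Longrightarrow> unit_normal F c p n \<Longrightarrow> immersion_mean_curvature F c p n = 0"
    and orth: "\<And>c p n. p \<in> mfd_boundary \<Omega> A \<Longrightarrow> c \<in> A \<Longrightarrow> p \<in> fst c \<Longrightarrow> unit_normal F c p n \<Longrightarrow> n \<bullet> F p = 0"
    using hyp by blast+
  let ?m = "real CARD('m)"
  \<comment> \<open>\<open>|F|^2\<close> has Laplacian \<open>- 2 * ?m\<close> in the non-negative
    convention, which fixes the divisor. The normal derivative is then \<open>1 / ?m\<close>,
    because \<open>F p \<bullet> chart_D c F p (\<nu> c) = - 1\<close>.\<close>
  define v where "v = (\<lambda>q. (1 - F q \<bullet> F q) / (2 * ?m))"
  have rep: "\<exists>W k. local_rep c p F W k \<and> local_rep c p v W (\<lambda>z. (1 - k z \<bullet> k z) / (2 * ?m))"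
    if c: "c \<in> A" "p \<in> fst c" for c p
  proof -
    obtain W k where k: "local_rep c p F W k" using F_local_rep[OF c] by metis
    then have W: "open W" "smooth_on W k" by (auto simp: local_rep_def)
    have "smooth_on W (\<lambda>z. (1 / (2 * ?m)) *\<^sub>R (1 + (- 1) *\<^sub>R (k z \<bullet> k z)))"
      by (intro smooth_on_bounded_linear[OF bounded_linear_scaleR_right W(1)] smooth_on_add[OF W(1) smooth_on_const]
          smooth_on_bilinear[OF bounded_bilinear_inner W(1) W(2) W(2)])
    then have "local_rep c p v W (\<lambda>z. (1 - k z \<bullet> k z) / (2 * ?m))"
      using k by (simp add: local_rep_def v_def)
    with k show ?thesis by blast
  qed
  have smooth: "smooth_map A std_chart \<Omega> UNIV v"
  proof -
    have "\<exists>W k. open W \<and> snd c p \<in> W \<and> smooth_on W k \<and> (\<forall>z\<in>\<Omega> \<inter> fst c. snd c z \<in> W \<longrightarrow> v z = k (snd c z))"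
      if c: "c \<in> A" "p \<in> fst c" for c p
    proof -
      obtain W k where k: "local_rep c p v W k" using rep[OF c] by blast
      have "v z = k (snd c z)" if "z \<in> \<Omega> \<inter> fst c" "snd c z \<in> W" for z
        using local_rep_at(2)[OF c(1) _ that(2) k] that(1) by blast
      moreover have "open W" "snd c p \<in> W" "smooth_on W k" using k by (auto simp: local_rep_def)
      ultimately show ?thesis by blast
    qed
    then show ?thesis by (simp add: smooth_map_def)
  qed
  have lap: "laplacian (induced_metric F) v c p = 1" if "c \<in> A" "p \<in> fst c" for c p
    using laplacian_norm_square[OF that mean[OF that]] by (simp add: v_def)
  have zero: "v p = 0" if "p \<in> mfd_boundary \<Omega> A" for p
    using sphere that by (auto simp: v_def norm_eq_1[symmetric])
  have normal: "chart_D c v p (\<nu> c) = 1 / ?m"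
    if p: "p \<in> mfd_boundary \<Omega> A" and \<nu>: "inward_unit_normal \<Omega> A (induced_metric F) p \<nu>" and c: "c \<in> A" "p \<in> fst c" for p \<nu> c
  proof -
    obtain W k where k: "local_rep c p F W k" "local_rep c p v W (\<lambda>z. (1 - k z \<bullet> k z) / (2 * ?m))"
      using rep[OF c] by blast
    have W: "snd c p \<in> W" "smooth_on W k" using k by (auto simp: local_rep_def)
    let ?D = "frechet_derivative k (at (snd c p))"
    have "((\<lambda>y. (1 - k y \<bullet> k y) / (2 * ?m)) has_derivative (\<lambda>h. - (k (snd c p) \<bullet> ?D h) / ?m)) (at (snd c p))"
      using smooth_on_has_derivative[OF W(2,1)] by (auto intro!: derivative_eq_intros simp: inner_commute field_simps)
    from frechet_derivative_at[OF this]
    have "chart_D c v p = (\<lambda>h. - (k (snd c p) \<bullet> ?D h) / ?m)" using local_rep_derivative[OF c k(2)] by simp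
    moreover have "k (snd c p) = F p" "?D = chart_D c F p"
      using local_rep_at(2)[OF c W(1) k(1)] local_rep_derivative[OF c k(1)] by auto
    ultimately show ?thesis
      using inward_normal_position[OF sphere ball p c orth[OF p c] \<nu>] by simp
  qed
  show ?thesis
    unfolding harmonic_domain_def
  proof (intro conjI exI[of _ v])
    show "compact \<Omega>" using hyp by blast
    show "riemannian_manifold \<Omega> A (induced_metric F)" by (rule riemannian_manifold_induced_metric)
    show "\<exists>a. \<forall>p\<in>mfd_boundary \<Omega> A. \<forall>\<nu>. inward_unit_normal \<Omega> A (induced_metric F) p \<nu> \<longrightarrow>
       (\<forall>c\<in>A. p \<in> fst c \<longrightarrow> chart_D c v p (\<nu> c) = a)"
      by (intro exI[of _ "1 / ?m"] ballI allI impI normal)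
  qed (use smooth lap zero in blast)+
qed

theorem mainTheorem3:
  fixes \<Omega> :: "'p::t2_space set"
    and A :: "('p, real ^ 2) chart set"
    and F :: "'p \<Rightarrow> real ^ 3"
  assumes "minimal_free_boundary_hypersurface \<Omega> A F"
    and "card (components (mfd_boundary \<Omega> A)) > 2"
  shows "harmonic_domain \<Omega> A (induced_metric F) \<and> \<not> isoparametric_tube \<Omega> A (induced_metric F)"
proof
  show "harmonic_domain \<Omega> A (induced_metric F)"
    using free_boundary_harmonic_domain assms(1) .
  \<comment> \<open>An infinite set has \<open>card\<close> equal to 0, so the bound on
    \<open>card\<close> already contains finiteness.\<close>
  have "finite (components (mfd_boundary \<Omega> A))"
    using assms(2) card.infinite by fastforce
  then have "\<not> smooth_tube \<Omega> A (induced_metric F) P R" for P R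
    using smooth_tube_boundary_components[of \<Omega> A "induced_metric F" P R] assms(2) by auto
  then show "\<not> isoparametric_tube \<Omega> A (induced_metric F)"
    unfolding isoparametric_tube_def by blast
qed

end
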